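(* Let $\mathcal{X}$ be a smooth $n$-dimensional compact orbifold with (nonempty) boundary $\partial\mathcal{X}$ and assume that the interior $\mathrm{int}\,\mathcal{X}$ does not have any codimension $1$ singular strata. Then there is no smooth complete orbifold map ${}_\star f:\mathcal{X}\to\partial\mathcal{X}$ with ${}_\star f|_{\partial\mathcal{X}}=\mathrm{Id}$.
   Context: Smooth means $C^\infty$. Orbifold with boundary. An $n$-dimensional smooth orbifold with boundary $\mathcal{X}$ consists of a paracompact Hausdorff space $X_{\mathcal{X}}$ (the underlying space) with the following local structure. For each $x\in X_{\mathcal{X}}$ and neighborhood $U$ of $x$ there are a neighborhood $U_x\subset U$ of $x$, a space $\tilde U_x$ diffeomorphic to $\mathbb{R}^n$ or to the closed upper half-space $\mathbb{R}^n_+$, a finite group $\Gamma_x$ acting smoothly and effectively on $\tilde U_x$ and fixing $0\in\tilde U_x$, and a homeomorphism $\phi_x:\tilde U_x/\Gamma_x\to U_x$ with $\phi_x(0)=x$. These satisfy: if $U_z\subset U_x$ is another such neighborhood with data $\tilde U_z,\Gamma_z,\phi_z$, there are a smooth embedding $\tilde\psi_{zx}:\tilde U_z\to\tilde U_x$ and an injective homomorphism $\theta_{zx}:\Gamma_z\to\Gamma_x$ such that $\tilde\psi_{zx}$ is $\theta_{zx}$-equivariant and covers the inclusion $U_z\subset U_x$. The pair $(\tilde U_x,\Gamma_x)$ is an orbifold chart at $x$, and $\Gamma_x$ the isotropy group of $x$. The boundary $\partial\mathcal{X}$ consists of those $x$ for which $\tilde U_x$ is diffeomorphic to $\mathbb{R}^n_+$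 (with $x$ corresponding to $0\in\partial\mathbb{R}^n_+$); it is a smooth $(n-1)$-dimensional orbifold without boundary, with charts $(\partial\tilde U_x,\Gamma_x)$. The interior is $\mathrm{int}\,\mathcal{X}=\mathcal{X}\setminus\partial\mathcal{X}$. Compact means the underlying space is compact. Here $\partial\mathcal{X}$ is assumed nonempty. Singular strata. The singular set is the set of points with $\Gamma_x\neq\{e\}$. The singular stratum through a singular point $x\in\mathrm{int}\,\mathcal{X}$ is, near $x$, the image in $U_x$ of the fixed point set of $\Gamma_x$ in $\tilde U_x$; its dimension is that of the subspace of $T_0\tilde U_x$ fixed by $\Gamma_x$. Thus "no codimension $1$ singular strata in the interior" means that for no $x\in\mathrm{int}\,\mathcal{X}$ does the subspace of $T_0\tilde U_x\cong\mathbb{R}^n$ fixed by $\Gamma_x$ have dimension $n-1$. Complete orbifold map. A smooth complete orbifold map ${}_\star f=(f,\{\tilde f_x\},\{\Theta_{f,x}\}):\mathcal{X}\to\mathcal{P}$ consists of a continuous map $f:X_{\mathcal{X}}\to X_{\mathcal{P}}$ and, for each $x\in\mathcal{X}$, a group homomorphism $\Theta_{f,x}:\Gamma_x\to\Gamma_{f(x)}$ and a smooth $\Theta_{f,x}$-equivariant map $\tilde f_x:\tilde U_x\to\tilde V_{f(x)}$ covering $f|_{U_x}$, where $(\tilde U_x,\Gamma_x)$ and $(\tilde V_{f(x)},\Gamma_{f(x)})$ are orbifold charts at $x$ and $f(x)$. Two such maps are identified if for each $x$ the lifts agree as germs at $0\in\tilde U_x$ and the homomorphisms agree. The condition ${}_\star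 f|_{\partial\mathcal{X}}=\mathrm{Id}$ means that the restriction of ${}_\star f$ to $\partial\mathcal{X}$ (restricting $f$ to $\partial\mathcal{X}$ and the lifts at boundary points to $\partial\tilde U_x$) is the identity complete orbifold map of $\partial\mathcal{X}$: identity underlying map, identity lifts and identity homomorphisms. *)

theory Defs
  imports "HOL-Analysis.Analysis" "HOL-Algebra.Group_Action"
begin

section \<open>Smooth maps between subsets of Euclidean spaces\<close>

text \<open>\<open>Ck_on k f W\<close> is only used for open \<open>W\<close>: all iterated directional derivatives of \<open>f\<close> up to
  order \<open>k\<close> exist as Frechet derivatives and are continuous.\<close>

fun Ck_on ::
  "nat \<Rightarrow> ('v::euclidean_space \<Rightarrow> 'w::euclidean_space) \<Rightarrow> 'v set \<Rightarrow> bool"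
where
  "Ck_on 0 f W \<longleftrightarrow> continuous_on W f"
| "Ck_on (Suc k) f W \<longleftrightarrow>
     (\<forall>p\<in>W. f differentiable (at p)) \<and>
     (\<forall>v. Ck_on k (\<lambda>p. frechet_derivative f (at p) v) W)"

text \<open>On an arbitrary subset \<open>A\<close>, for instance a closed half-space or a hyperplane, smooth means
  locally extendable to a \<open>C\<close>-infinity map on an open subset of the ambient space.\<close>

definition smooth_map ::
  "'v::euclidean_space set \<Rightarrow> ('v \<Rightarrow> 'w::euclidean_space) \<Rightarrow> bool"
where
  "smooth_map A f \<longleftrightarrow>
     (\<forall>p\<in>A. \<exists>W g. open W \<and> p \<in> W \<and> (\<forall>k. Ck_on k g W) \<and> (\<forall>q\<in>W \<inter> A. g q = f q))"

definition diffeomorphism ::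
  "'v::euclidean_space set \<Rightarrow> 'w::euclidean_space set \<Rightarrow> ('v \<Rightarrow> 'w) \<Rightarrow> bool"
where
  "diffeomorphism A B f \<longleftrightarrow>
     bij_betw f A B \<and> smooth_map A f \<and> smooth_map B (inv_into A f)"

text \<open>A smooth embedding is a diffeomorphism onto its image.\<close>

definition smooth_embedding ::
  "'v::euclidean_space set \<Rightarrow> 'w::euclidean_space set \<Rightarrow> ('v \<Rightarrow> 'w) \<Rightarrow> bool"
where
  "smooth_embedding A B f \<longleftrightarrow> f ` A \<subseteq> B \<and> diffeomorphism A (f ` A) f"

text \<open>The model spaces of dimension \<open>n\<close> are realised as linear subspaces of dimension \<open>n\<close> of the
  ambient space and their closed half-spaces, so that the boundary of an orbifold with charts in
  \<open>'v\<close> again has charts in \<open>'v\<close>.\<close>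

definition euclidean_domain :: "nat \<Rightarrow> 'v::euclidean_space set \<Rightarrow> bool" where
  "euclidean_domain n A \<longleftrightarrow>
     (\<exists>S h. subspace (S :: 'v set) \<and> dim S = n \<and> diffeomorphism A S h)"

definition half_space_coords ::
  "nat \<Rightarrow> 'v::euclidean_space set \<Rightarrow> 'v set \<Rightarrow> 'v \<Rightarrow> ('v \<Rightarrow> 'v) \<Rightarrow> bool"
where
  "half_space_coords n A S e h \<longleftrightarrow>
     subspace S \<and> dim S = n \<and> e \<in> S \<and> e \<noteq> 0 \<and>
     diffeomorphism A {v \<in> S. 0 \<le> v \<bullet> e} h"

text \<open>The boundary of a set diffeomorphic to an \<open>n\<close>-dimensional closed half-space; it is empty
  if there is no such diffeomorphism.\<close>

definition half_space_boundary ::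
  "nat \<Rightarrow> 'v::euclidean_space set \<Rightarrow> 'v set"
where
  "half_space_boundary n A = {p \<in> A. \<exists>S e h. half_space_coords n A S e h \<and> h p \<bullet> e = 0}"


section \<open>Orbifolds with boundary\<close>

definition paracompact_space :: "'a topology \<Rightarrow> bool" where
  "paracompact_space T \<longleftrightarrow>
     (\<forall>\<U>. (\<forall>U\<in>\<U>. openin T U) \<and> \<Union>\<U> = topspace T \<longrightarrow>
       (\<exists>\<V>. (\<forall>V\<in>\<V>. openin T V \<and> (\<exists>U\<in>\<U>. V \<subseteq> U)) \<and> \<Union>\<V> = topspace T \<and>
            locally_finite_in T \<V>))"

text \<open>The quotient topology on the set of orbits.\<close>

definition orbit_topology ::
  "('g, 'm) monoid_scheme \<Rightarrow> 'v::topological_space set \<Rightarrow> ('g \<Rightarrow> 'v \<Rightarrow> 'v) \<Rightarrow> 'v set topology"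
where
  "orbit_topology G A \<alpha> =
     topology (\<lambda>\<O>. \<O> \<subseteq> orbits G A \<alpha> \<and> openin (top_of_set A) {p \<in> A. orbit G \<alpha> p \<in> \<O>})"

lemma openin_orbit_topology:
  "openin (orbit_topology G A \<alpha>) \<O> \<longleftrightarrow>
     \<O> \<subseteq> orbits G A \<alpha> \<and> openin (top_of_set A) {p \<in> A. orbit G \<alpha> p \<in> \<O>}"
proof -
  have "istopology (\<lambda>\<O>. \<O> \<subseteq> orbits G A \<alpha> \<and>
          openin (top_of_set A) {p \<in> A. orbit G \<alpha> p \<in> \<O>})"
    unfolding istopology_def
  proof (intro conjI allI impI)
    fix S T
    assume *: "S \<subseteq> orbits G A \<alpha> \<and> openin (top_of_set A) {p \<in> A. orbit G \<alpha> p \<in> S}"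
      "T \<subseteq> orbits G A \<alpha> \<and> openin (top_of_set A) {p \<in> A. orbit G \<alpha> p \<in> T}"
    have "{p \<in> A. orbit G \<alpha> p \<in> S \<inter> T} =
        {p \<in> A. orbit G \<alpha> p \<in> S} \<inter> {p \<in> A. orbit G \<alpha> p \<in> T}"
      by auto
    with * show "openin (top_of_set A) {p \<in> A. orbit G \<alpha> p \<in> S \<inter> T}"
      by (simp add: openin_Int)
  next
    fix \<K>
    assume *: "\<forall>K\<in>\<K>. K \<subseteq> orbits G A \<alpha> \<and> openin (top_of_set A) {p \<in> A. orbit G \<alpha> p \<in> K}"
    have "{p \<in> A. orbit G \<alpha> p \<in> \<Union>\<K>} = (\<Union>K\<in>\<K>. {p \<in> A. orbit G \<alpha> p \<in> K})"
      by auto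
    with * show "openin (top_of_set A) {p \<in> A. orbit G \<alpha> p \<in> \<Union>\<K>}"
      by (metis (no_types, lifting) imageE openin_Union)
  qed blast+
  then show ?thesis
    by (simp add: orbit_topology_def topology_inverse')
qed

text \<open>A chart consists of the space upstairs, the finite group with its action, and the map \<open>\<phi>\<close>
  from the orbit space. The neighbourhood downstairs and the centre are determined by \<open>\<phi>\<close>.\<close>

record ('a, 'v, 'g) orbifold_chart =
  ch_dom :: "'v set"
  ch_grp :: "'g monoid"
  ch_act :: "'g \<Rightarrow> 'v \<Rightarrow> 'v"
  ch_phi :: "'v set \<Rightarrow> 'a"

definition ch_nbhd :: "('a, 'v, 'g) orbifold_chart \<Rightarrow> 'a set" where
  "ch_nbhd C = ch_phi C ` orbits (ch_grp C) (ch_dom C) (ch_act C)"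

definition ch_proj :: "('a, 'v, 'g) orbifold_chart \<Rightarrow> 'v \<Rightarrow> 'a" where
  "ch_proj C v = ch_phi C (orbit (ch_grp C) (ch_act C) v)"

definition ch_center :: "('a, 'v::zero, 'g) orbifold_chart \<Rightarrow> 'a" where
  "ch_center C = ch_proj C 0"

definition is_chart ::
  "nat \<Rightarrow> 'a topology \<Rightarrow> ('a, 'v::euclidean_space, 'g) orbifold_chart \<Rightarrow> bool"
where
  "is_chart n T C \<longleftrightarrow>
     0 \<in> ch_dom C \<and>
     (euclidean_domain n (ch_dom C) \<or> 0 \<in> half_space_boundary n (ch_dom C)) \<and>
     finite (carrier (ch_grp C)) \<and>
     faithful_action (ch_grp C) (ch_dom C) (ch_act C) \<and>
     (\<forall>g\<in>carrier (ch_grp C). smooth_map (ch_dom C) (ch_act C g) \<and> ch_act C g 0 = 0) \<and>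
     openin T (ch_nbhd C) \<and>
     homeomorphic_map (orbit_topology (ch_grp C) (ch_dom C) (ch_act C))
       (subtopology T (ch_nbhd C)) (ch_phi C)"

definition chart_embedding ::
  "('a, 'v::euclidean_space, 'g) orbifold_chart \<Rightarrow> ('a, 'v, 'g) orbifold_chart \<Rightarrow>
   ('v \<Rightarrow> 'v) \<Rightarrow> ('g \<Rightarrow> 'g) \<Rightarrow> bool"
where
  "chart_embedding C D \<psi> \<theta> \<longleftrightarrow>
     smooth_embedding (ch_dom C) (ch_dom D) \<psi> \<and>
     \<theta> \<in> hom (ch_grp C) (ch_grp D) \<and> inj_on \<theta> (carrier (ch_grp C)) \<and>
     (\<forall>g\<in>carrier (ch_grp C). \<forall>v\<in>ch_dom C. \<psi> (ch_act C g v) = ch_act D (\<theta> g) (\<psi> v)) \<and>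
     (\<forall>v\<in>ch_dom C. ch_proj D (\<psi> v) = ch_proj C v)"

record ('a, 'v, 'g) orbifold =
  orb_space :: "'a topology"
  orb_charts :: "('a, 'v, 'g) orbifold_chart set"

definition orb_boundary ::
  "nat \<Rightarrow> ('a, 'v::euclidean_space, 'g) orbifold \<Rightarrow> 'a set"
where
  "orb_boundary n X =
     {ch_center C | C. C \<in> orb_charts X \<and> 0 \<in> half_space_boundary n (ch_dom C)}"

definition orb_interior ::
  "nat \<Rightarrow> ('a, 'v::euclidean_space, 'g) orbifold \<Rightarrow> 'a set"
where
  "orb_interior n X = topspace (orb_space X) - orb_boundary n X"

text \<open>The last clause says that being a boundary point does not depend on the chart, so that the
  charts of \<open>X\<close> restrict to charts of its boundary. Without it, a half-space chart could be embedded
  as one side of the mirror in a Euclidean chart on which a reflection acts.\<close>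

definition smooth_orbifold ::
  "nat \<Rightarrow> ('a, 'v::euclidean_space, 'g) orbifold \<Rightarrow> bool"
where
  "smooth_orbifold n X \<longleftrightarrow>
     Hausdorff_space (orb_space X) \<and> paracompact_space (orb_space X) \<and>
     (\<forall>C\<in>orb_charts X. is_chart n (orb_space X) C) \<and>
     (\<forall>x U. openin (orb_space X) U \<and> x \<in> U \<longrightarrow>
        (\<exists>C\<in>orb_charts X. ch_center C = x \<and> ch_nbhd C \<subseteq> U)) \<and>
     (\<forall>C\<in>orb_charts X. \<forall>D\<in>orb_charts X. ch_nbhd C \<subseteq> ch_nbhd D \<longrightarrow>
        (\<exists>\<psi> \<theta>. chart_embedding C D \<psi> \<theta>)) \<and>
     (\<forall>C\<in>orb_charts X. \<forall>v\<in>ch_dom C.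
        ch_proj C v \<in> orb_boundary n X \<longleftrightarrow> v \<in> half_space_boundary n (ch_dom C))"

text \<open>Orbits of boundary points are the same for the restricted action, hence \<open>ch_phi\<close> is kept.\<close>

definition boundary_chart ::
  "nat \<Rightarrow> ('a, 'v::euclidean_space, 'g) orbifold_chart \<Rightarrow> ('a, 'v, 'g) orbifold_chart"
where
  "boundary_chart n C =
     \<lparr>ch_dom = half_space_boundary n (ch_dom C),
      ch_grp = ch_grp C,
      ch_act = (\<lambda>g. restrict (ch_act C g) (half_space_boundary n (ch_dom C))),
      ch_phi = ch_phi C\<rparr>"

definition boundary_orbifold ::
  "nat \<Rightarrow> ('a, 'v::euclidean_space, 'g) orbifold \<Rightarrow> ('a, 'v, 'g) orbifold"
where
  "boundary_orbifold n X =
     \<lparr>orb_space = subtopology (orb_space X) (orb_boundary n X),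
      orb_charts = boundary_chart n ` {C \<in> orb_charts X. ch_center C \<in> orb_boundary n X}\<rparr>"

text \<open>For a chart at an interior point of an orbifold of dimension \<open>DIM('v)\<close> the domain is open in
  \<open>'v\<close>, so its tangent space at \<open>0\<close> is \<open>'v\<close> and the derivatives below are well defined.\<close>

definition fixed_tangent_space ::
  "('a, 'v::euclidean_space, 'g) orbifold_chart \<Rightarrow> 'v set"
where
  "fixed_tangent_space C =
     {v. \<forall>g\<in>carrier (ch_grp C). frechet_derivative (ch_act C g) (at 0) v = v}"

definition no_interior_codim1_strata ::
  "('a, 'v::euclidean_space, 'g) orbifold \<Rightarrow> bool"
where
  "no_interior_codim1_strata X \<longleftrightarrow>
     (\<forall>C\<in>orb_charts X. ch_center C \<in> orb_interior DIM('v) X \<longrightarrow>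
        dim (fixed_tangent_space C) \<noteq> DIM('v) - 1)"


section \<open>Complete orbifold maps\<close>

text \<open>For each point \<open>x\<close> the data comprise a chart at \<open>x\<close>, a chart at the image of \<open>x\<close>, a lift
  between them and a homomorphism of isotropy groups.\<close>

record ('a, 'v, 'g, 'b, 'w, 'h) complete_map =
  cm_fun :: "'a \<Rightarrow> 'b"
  cm_src :: "'a \<Rightarrow> ('a, 'v, 'g) orbifold_chart"
  cm_tgt :: "'a \<Rightarrow> ('b, 'w, 'h) orbifold_chart"
  cm_lift :: "'a \<Rightarrow> 'v \<Rightarrow> 'w"
  cm_hom :: "'a \<Rightarrow> 'g \<Rightarrow> 'h"

definition smooth_complete_map ::
  "('a, 'v::euclidean_space, 'g) orbifold \<Rightarrow> ('b, 'w::euclidean_space, 'h) orbifold \<Rightarrow>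
   ('a, 'v, 'g, 'b, 'w, 'h) complete_map \<Rightarrow> bool"
where
  "smooth_complete_map X P F \<longleftrightarrow>
     continuous_map (orb_space X) (orb_space P) (cm_fun F) \<and>
     (\<forall>x\<in>topspace (orb_space X).
        let C = cm_src F x; D = cm_tgt F x; \<Theta> = cm_hom F x; l = cm_lift F x in
          C \<in> orb_charts X \<and> ch_center C = x \<and>
          D \<in> orb_charts P \<and> ch_center D = cm_fun F x \<and>
          \<Theta> \<in> hom (ch_grp C) (ch_grp D) \<and>
          l \<in> ch_dom C \<rightarrow> ch_dom D \<and> smooth_map (ch_dom C) l \<and>
          (\<forall>g\<in>carrier (ch_grp C). \<forall>v\<in>ch_dom C. l (ch_act C g v) = ch_act D (\<Theta> g) (l v)) \<and>
          (\<forall>v\<in>ch_dom C. ch_proj D (l v) = cm_fun F (ch_proj C v)))"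

text \<open>Charts at the same point that coincide after shrinking their domains around \<open>0\<close>; lifts and
  homomorphisms can only be compared with respect to such charts.\<close>

definition same_chart_germ ::
  "('a, 'v::euclidean_space, 'g) orbifold_chart \<Rightarrow> ('a, 'v, 'g) orbifold_chart \<Rightarrow> bool"
where
  "same_chart_germ C D \<longleftrightarrow>
     carrier (ch_grp C) = carrier (ch_grp D) \<and>
     (\<exists>W. open W \<and> 0 \<in> W \<and> ch_dom C \<inter> W = ch_dom D \<inter> W \<and>
       (\<forall>v\<in>ch_dom C \<inter> W. ch_proj C v = ch_proj D v \<and>
          (\<forall>g\<in>carrier (ch_grp C). ch_act C g v = ch_act D g v)))"

definition same_complete_map ::
  "('a, 'v::euclidean_space, 'g) orbifold \<Rightarrow>
   ('a, 'v, 'g, 'b, 'w::euclidean_space, 'h) complete_map \<Rightarrow>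
   ('a, 'v, 'g, 'b, 'w, 'h) complete_map \<Rightarrow> bool"
where
  "same_complete_map X F G \<longleftrightarrow>
     (\<forall>x\<in>topspace (orb_space X).
        cm_fun F x = cm_fun G x \<and>
        same_chart_germ (cm_src F x) (cm_src G x) \<and>
        same_chart_germ (cm_tgt F x) (cm_tgt G x) \<and>
        (\<exists>W. open W \<and> 0 \<in> W \<and>
           (\<forall>v\<in>ch_dom (cm_src F x) \<inter> W. cm_lift F x v = cm_lift G x v)) \<and>
        (\<forall>g\<in>carrier (ch_grp (cm_src F x)). cm_hom F x g = cm_hom G x g))"

definition identity_complete_map ::
  "('a \<Rightarrow> ('a, 'v, 'g) orbifold_chart) \<Rightarrow> ('a, 'v, 'g, 'a, 'v, 'g) complete_map"
where
  "identity_complete_map c =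
     \<lparr>cm_fun = (\<lambda>x. x), cm_src = c, cm_tgt = c, cm_lift = (\<lambda>x v. v), cm_hom = (\<lambda>x g. g)\<rparr>"

definition restrict_to_boundary ::
  "nat \<Rightarrow> ('a, 'v::euclidean_space, 'g) orbifold \<Rightarrow>
   ('a, 'v, 'g, 'b, 'w, 'h) complete_map \<Rightarrow> ('a, 'v, 'g, 'b, 'w, 'h) complete_map"
where
  "restrict_to_boundary n X F =
     \<lparr>cm_fun = restrict (cm_fun F) (orb_boundary n X),
      cm_src = (\<lambda>x. boundary_chart n (cm_src F x)),
      cm_tgt = cm_tgt F,
      cm_lift = (\<lambda>x. restrict (cm_lift F x) (half_space_boundary n (ch_dom (cm_src F x)))),
      cm_hom = cm_hom F\<rparr>"

text \<open>The identity lifts are taken in the charts in which the restriction of \<open>F\<close> is given.\<close>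

definition is_identity_on_boundary ::
  "nat \<Rightarrow> ('a, 'v::euclidean_space, 'g) orbifold \<Rightarrow>
   ('a, 'v, 'g, 'a, 'v, 'g) complete_map \<Rightarrow> bool"
where
  "is_identity_on_boundary n X F \<longleftrightarrow>
     same_complete_map (boundary_orbifold n X) (restrict_to_boundary n X F)
       (identity_complete_map (cm_src (restrict_to_boundary n X F)))"

end

theory Submission
  imports Defs
begin

text \<open>Let \<open>f\<close> be a retraction onto the boundary. A generic point \<open>y\<close> of the boundary is a regular value of the lifts of
  \<open>f\<close>, by Sard's theorem for maps from \<open>n\<close> to \<open>n - 1\<close> dimensions, and its isotropy group acts
  trivially on the boundary near it. At a point \<open>x\<close> of the fibre of \<open>y\<close> the lift is therefore an
  invariant submersion, so that the isotropy group of \<open>x\<close> acts trivially on the tangent space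
  modulo the one-dimensional kernel: either it acts trivially, or it has a fixed space of
  codimension one. The latter is excluded in the interior by assumption, and on the boundary because
  the action preserves the half-space. Hence the fibre is a compact one-manifold whose only
  boundary point is \<open>y\<close>, and there is none.\<close>

section \<open>Smooth maps\<close>

text \<open>One value \<open>y\<close> must be generic for all lifts at once, while each lift is
  given only near a chart centre. Compactness leaves finitely many charts, and the bad values of
  each are kept closed with empty interior in the boundary: this survives finite unions and the
  finite-to-one boundary charts. Sard's theorem serves only to show that a compact set of critical
  values has empty interior. Its proof counts cells on strata of constant rank, because for a drop
  of one dimension the second order remainder decides. At \<open>y\<close> itself nothing excludes
  at first that the fibre is tangent to the boundary. Transversality comes from
  \<open>f x = x\<close> there: in boundary coordinates the lift agrees along the wall with a chart
  embedding, whose derivative is injective. Lifts on a half-space extend past the wall in many ways,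
  so derivatives there are pinned down by the points of the half-space on the axes through the base
  point.\<close>

lemma Ck_on_continuous: "Ck_on k f W \<Longrightarrow> continuous_on W f"
  by (cases k) (auto intro!: differentiable_imp_continuous_on
      simp: differentiable_on_def differentiable_at_withinI)

lemma Ck_on_SucD: "Ck_on (Suc k) f W \<Longrightarrow> Ck_on k f W"
proof (induction k arbitrary: f)
  case 0
  then show ?case using Ck_on_continuous[OF 0] by simp
next
  case (Suc k)
  from Suc.prems show ?case
    using Suc.IH by (subst (asm) Ck_on.simps(2), subst Ck_on.simps(2)) blast
qed

lemma Ck_on_subset: "Ck_on k f W \<Longrightarrow> V \<subseteq> W \<Longrightarrow> Ck_on k f V"
  by (induction k arbitrary: f) (auto intro: continuous_on_subset)

lemma Ck_on_has_derivative:
  "Ck_on (Suc k) f W \<Longrightarrow> p \<in> W \<Longrightarrow> (f has_derivative frechet_derivative f (at p)) (at p)"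
  by (simp add: frechet_derivative_works)

lemma Ck_on_transform:
  assumes "Ck_on k f W" "open W" "\<And>p. p \<in> W \<Longrightarrow> f p = g p"
  shows "Ck_on k g W"
  using assms(1,3)
proof (induction k arbitrary: f g)
  case 0
  then show ?case by (auto cong: continuous_on_cong)
next
  case (Suc k)
  have d: "(g has_derivative frechet_derivative f (at p)) (at p)" if "p \<in> W" for p
    using has_derivative_transform_within_open[OF Ck_on_has_derivative[OF Suc.prems(1) that]
        assms(2) that] Suc.prems(2) by blast
  then have e: "frechet_derivative g (at p) = frechet_derivative f (at p)" if "p \<in> W" for p
    using frechet_derivative_at that by metis
  show ?case
  proof (simp, intro conjI ballI allI)
    fix p assume "p \<in> W" then show "g differentiable at p" using d differentiable_def by blast
  next
    fix v
    show "Ck_on k (\<lambda>p. frechet_derivative g (at p) v) W"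
      by (rule Suc.IH[of "\<lambda>p. frechet_derivative f (at p) v"]) (use Suc.prems e in auto)
  qed
qed

lemma Ck_on_SucI:
  assumes "open W" "\<And>p. p \<in> W \<Longrightarrow> (f has_derivative f' p) (at p)"
    and "\<And>v. Ck_on k (\<lambda>p. f' p v) W"
  shows "Ck_on (Suc k) f W"
proof -
  have e: "frechet_derivative f (at p) = f' p" if "p \<in> W" for p
    using frechet_derivative_at assms(2) that by metis
  show ?thesis
  proof (simp, intro conjI ballI allI)
    fix p assume "p \<in> W" then show "f differentiable at p" using assms(2) differentiable_def by blast
  next
    fix v
    show "Ck_on k (\<lambda>p. frechet_derivative f (at p) v) W"
      by (rule Ck_on_transform[OF assms(3)[of v] assms(1)]) (use e in auto)
  qed
qed

lemma Ck_on_const: "open W \<Longrightarrow> Ck_on k (\<lambda>p. c) W"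
proof (induction k arbitrary: c)
  case (Suc k)
  show ?case by (rule Ck_on_SucI[where f' = "\<lambda>p v. 0"]) (use Suc in auto)
qed simp

lemma Ck_on_bounded_linear:
  assumes "bounded_linear T" "open W"
  shows "Ck_on k T W"
proof (cases k)
  case 0
  then show ?thesis using assms by (simp add: linear_continuous_on)
next
  case (Suc j)
  show ?thesis unfolding Suc
    by (rule Ck_on_SucI[where f' = "\<lambda>p. T"])
      (use assms in \<open>auto intro: bounded_linear_imp_has_derivative Ck_on_const\<close>)
qed

lemma Ck_on_linear_compose:
  assumes "bounded_linear T" "open W" "Ck_on k f W"
  shows "Ck_on k (\<lambda>p. T (f p)) W"
  using assms(3)
proof (induction k arbitrary: f)
  case 0
  then show ?case using assms by (auto intro: bounded_linear.continuous_on)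
next
  case (Suc k)
  show ?case
    by (rule Ck_on_SucI[where f' = "\<lambda>p v. T (frechet_derivative f (at p) v)"])
      (use assms Suc in \<open>auto intro!: bounded_linear.has_derivative[OF assms(1)]
        Ck_on_has_derivative[OF Suc.prems]\<close>)
qed

lemma Ck_on_add:
  assumes "open W" "Ck_on k f W" "Ck_on k g W"
  shows "Ck_on k (\<lambda>p. f p + g p) W"
  using assms(2,3)
proof (induction k arbitrary: f g)
  case 0
  then show ?case by (auto intro: continuous_on_add)
next
  case (Suc k)
  show ?case
    by (rule Ck_on_SucI[where
          f' = "\<lambda>p v. frechet_derivative f (at p) v + frechet_derivative g (at p) v"])
      (use assms Suc in \<open>auto intro!: has_derivative_add
        Ck_on_has_derivative[OF Suc.prems(1)] Ck_on_has_derivative[OF Suc.prems(2)]\<close>)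
qed

lemma Ck_on_sum:
  assumes "open W" "finite I" "\<And>i. i \<in> I \<Longrightarrow> Ck_on k (f i) W"
  shows "Ck_on k (\<lambda>p. \<Sum>i\<in>I. f i p) W"
  using assms(2,3) by induction (auto intro: Ck_on_const Ck_on_add assms(1))

lemma Ck_on_scaleR:
  assumes "open W" "Ck_on k \<phi> W" "Ck_on k f W"
  shows "Ck_on k (\<lambda>p. \<phi> p *\<^sub>R f p) W"
  using assms(2,3)
proof (induction k arbitrary: \<phi> f)
  case 0
  then show ?case by (auto intro: continuous_on_scaleR)
next
  case (Suc k)
  show ?case
  proof (rule Ck_on_SucI[OF assms(1)])
    fix p assume "p \<in> W"
    then show "((\<lambda>p. \<phi> p *\<^sub>R f p) has_derivative (\<lambda>v. \<phi> p *\<^sub>R frechet_derivative f (at p) v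
          + frechet_derivative \<phi> (at p) v *\<^sub>R f p)) (at p)"
      by (intro has_derivative_scaleR Ck_on_has_derivative[OF Suc.prems(1)]
          Ck_on_has_derivative[OF Suc.prems(2)])
  next
    fix v
    show "Ck_on k (\<lambda>p. \<phi> p *\<^sub>R frechet_derivative f (at p) v
          + frechet_derivative \<phi> (at p) v *\<^sub>R f p) W"
      using Suc.prems by (intro Ck_on_add assms(1) Suc.IH Ck_on_SucD[OF Suc.prems(1)]
          Ck_on_SucD[OF Suc.prems(2)]) auto
  qed
qed

lemma Ck_on_compose:
  assumes "open W" "open V" "f ` W \<subseteq> V" "Ck_on k f W" "Ck_on k g V"
  shows "Ck_on k (\<lambda>p. g (f p)) W"
  using assms(4,5)
proof (induction k arbitrary: g)
  case 0
  then show ?case using assms(3) continuous_on_compose2 by auto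
next
  case (Suc k)
  let ?Df = "\<lambda>p. frechet_derivative f (at p)" and ?Dg = "\<lambda>p. frechet_derivative g (at p)"
  have d: "((\<lambda>p. g (f p)) has_derivative (\<lambda>v. ?Dg (f p) (?Df p v))) (at p)" if "p \<in> W" for p
    by (rule has_derivative_compose[OF Ck_on_has_derivative[OF Suc.prems(1) that]
          Ck_on_has_derivative[OF Suc.prems(2)]]) (use assms(3) that in auto)
  have lin: "linear (?Dg (f p))" if "p \<in> W" for p
    using Ck_on_has_derivative[OF Suc.prems(2), of "f p"] assms(3) that has_derivative_linear by blast
  \<comment> \<open>The direction \<open>?Df p v\<close> moves with \<open>p\<close>, while
    \<open>Ck_on\<close> speaks only of derivatives in a fixed direction. Expanding it in the basis
    leaves products of functions to which the induction hypothesis and the assumptions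
    apply.\<close>
  have e: "?Dg (f p) (?Df p v) = (\<Sum>b\<in>Basis. (?Df p v \<bullet> b) *\<^sub>R ?Dg (f p) b)" if "p \<in> W" for p v
  proof -
    have "?Dg (f p) (?Df p v) = ?Dg (f p) (\<Sum>b\<in>Basis. (?Df p v \<bullet> b) *\<^sub>R b)"
      by (simp add: euclidean_representation)
    also have "\<dots> = (\<Sum>b\<in>Basis. (?Df p v \<bullet> b) *\<^sub>R ?Dg (f p) b)"
      by (simp add: linear_sum[OF lin[OF that]] linear_cmul[OF lin[OF that]])
    finally show ?thesis .
  qed
  show ?case
  proof (rule Ck_on_SucI[OF assms(1) d])
    fix v
    show "Ck_on k (\<lambda>p. ?Dg (f p) (?Df p v)) W"
    proof (rule Ck_on_transform[OF _ assms(1)])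
      show "Ck_on k (\<lambda>p. \<Sum>b\<in>Basis. (?Df p v \<bullet> b) *\<^sub>R ?Dg (f p) b) W"
      proof (intro Ck_on_sum Ck_on_scaleR assms(1) finite_Basis)
        fix b :: 'b
        show "Ck_on k (\<lambda>p. ?Df p v \<bullet> b) W"
          by (rule Ck_on_linear_compose[OF bounded_linear_inner_left assms(1)])
            (use Suc.prems in auto)
        show "Ck_on k (\<lambda>p. ?Dg (f p) b) W"
          by (rule Suc.IH[OF Ck_on_SucD[OF Suc.prems(1)]]) (use Suc.prems in auto)
      qed
    qed (use e in auto)
  qed
qed

lemma smooth_mapE:
  assumes "smooth_map A f" "p \<in> A"
  obtains W g where "open W" "p \<in> W" "\<And>k. Ck_on k g W" "\<And>q. q \<in> W \<Longrightarrow> q \<in> A \<Longrightarrow> g q = f q"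
  using assms unfolding smooth_map_def by fastforce

lemma smooth_map_continuous_on:
  assumes "smooth_map A f"
  shows "continuous_on A f"
  unfolding continuous_on_eq_continuous_within
proof
  fix p assume "p \<in> A"
  then obtain W g where W: "open W" "p \<in> W" "\<And>k. Ck_on k g W" "\<And>q. q \<in> W \<Longrightarrow> q \<in> A \<Longrightarrow> g q = f q"
    using smooth_mapE[OF assms] by metis
  have "continuous_on (W \<inter> A) g"
    using Ck_on_continuous[OF W(3)] by (rule continuous_on_subset) auto
  then have "continuous_on (W \<inter> A) f"
    using continuous_on_cong[OF refl, of "W \<inter> A" g f] W(4) by blast
  then have "continuous (at p within (W \<inter> A)) f"
    using W(2) \<open>p \<in> A\<close> by (simp add: continuous_on_eq_continuous_within)
  moreover have "at p within (W \<inter> A) = at p within A"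
    by (rule at_within_nhd[OF W(2,1)]) auto
  ultimately show "continuous (at p within A) f" by simp
qed

lemma smooth_map_compose:
  assumes "smooth_map A f" "f ` A \<subseteq> B" "smooth_map B g"
  shows "smooth_map A (\<lambda>p. g (f p))"
  unfolding smooth_map_def
proof
  fix p assume p: "p \<in> A"
  obtain W f' where W: "open W" "p \<in> W" "\<And>k. Ck_on k f' W" "\<And>q. q \<in> W \<Longrightarrow> q \<in> A \<Longrightarrow> f' q = f q"
    using smooth_mapE[OF assms(1) p] by metis
  obtain V g' where V: "open V" "f p \<in> V" "\<And>k. Ck_on k g' V" "\<And>q. q \<in> V \<Longrightarrow> q \<in> B \<Longrightarrow> g' q = g q"
    using smooth_mapE[OF assms(3), of "f p"] p assms(2) by blast
  let ?U = "W \<inter> f' -` V"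
  have U: "open ?U"
    using Ck_on_continuous[OF W(3)] W(1) V(1) continuous_open_preimage by blast
  show "\<exists>W h. open W \<and> p \<in> W \<and> (\<forall>k. Ck_on k h W) \<and> (\<forall>q\<in>W \<inter> A. h q = g (f q))"
  proof (intro exI[of _ ?U] exI[of _ "\<lambda>q. g' (f' q)"] conjI allI ballI)
    show "open ?U" by fact
    show "p \<in> ?U" using W p V by auto
    show "Ck_on k (\<lambda>q. g' (f' q)) ?U" for k
      by (rule Ck_on_compose[OF U V(1) _ Ck_on_subset[OF W(3)] V(3)]) auto
    show "g' (f' q) = g (f q)" if "q \<in> ?U \<inter> A" for q
      using that W(4)[of q] V(4)[of "f q"] assms(2) by auto
  qed
qed

lemma smooth_map_subset:
  assumes "smooth_map B f" "A \<subseteq> B"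
  shows "smooth_map A f"
  unfolding smooth_map_def
proof
  fix p assume "p \<in> A"
  then obtain W g where "open W" "p \<in> W" "\<And>k. Ck_on k g W" "\<And>q. q \<in> W \<Longrightarrow> q \<in> B \<Longrightarrow> g q = f q"
    using smooth_mapE[OF assms(1)] assms(2) by (metis subsetD)
  then show "\<exists>W g. open W \<and> p \<in> W \<and> (\<forall>k. Ck_on k g W) \<and> (\<forall>q\<in>W \<inter> A. g q = f q)"
    using assms(2) by (intro exI[of _ W] exI[of _ g]) auto
qed

text \<open>\<open>Ck_on\<close> yields continuity of directional derivatives one direction at a
  time. Bounds on the finitely many basis directions become uniform in the direction here and, for
  second derivatives, in \<open>bilinear_norm_le_Basis\<close>.\<close>

lemma linear_norm_le_Basis:
  fixes h :: "'a::euclidean_space \<Rightarrow> 'b::real_normed_vector" and c :: real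
  assumes "linear h" "\<And>b. b \<in> Basis \<Longrightarrow> norm (h b) \<le> c"
  shows "norm (h v) \<le> DIM('a) * c * norm v"
proof -
  have "h v = (\<Sum>b\<in>Basis. (v \<bullet> b) *\<^sub>R h b)"
    by (metis (no_types, lifting) assms(1) euclidean_representation linear_cmul linear_sum sum.cong)
  also have "norm \<dots> \<le> (\<Sum>b\<in>(Basis::'a set). norm v * c)"
    by (rule order_trans[OF norm_sum sum_mono])
      (auto intro!: mult_mono assms(2) Basis_le_norm)
  finally show ?thesis by (simp add: mult_ac)
qed

lemma bilinear_norm_le_Basis:
  fixes h :: "'a::euclidean_space \<Rightarrow> 'c::euclidean_space \<Rightarrow> 'b::real_normed_vector" and c :: real
  assumes "\<And>v. linear (\<lambda>x. h x v)" "\<And>x. linear (h x)"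
    and "\<And>b b'. b \<in> Basis \<Longrightarrow> b' \<in> Basis \<Longrightarrow> norm (h b b') \<le> c"
  shows "norm (h x v) \<le> DIM('a) * (DIM('c) * c) * norm x * norm v"
proof -
  have "norm (h b v) \<le> DIM('c) * c * norm v" if "b \<in> Basis" for b
    by (rule linear_norm_le_Basis[OF assms(2)]) (use assms(3) that in auto)
  then have "norm (h x v) \<le> DIM('a) * (DIM('c) * c * norm v) * norm x"
    by (rule linear_norm_le_Basis[OF assms(1)])
  then show ?thesis by (simp add: mult_ac)
qed

section \<open>Second order estimates\<close>

locale C2_map =
  fixes f :: "'a::euclidean_space \<Rightarrow> 'b::euclidean_space" and W
  assumes W: "open W" and C2: "Ck_on 2 f W"
begin

definition D where "D p v = frechet_derivative f (at p) v"
text \<open>The direction \<open>x\<close> belongs to the second differentiation and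
  \<open>v\<close> to the first; linearity is proved separately for the two slots.\<close>

definition D2 where "D2 p x v = frechet_derivative (\<lambda>q. D q v) (at p) x"

lemma D_deriv: "p \<in> W \<Longrightarrow> (f has_derivative D p) (at p)"
  using Ck_on_has_derivative[of 1 f W p] C2 unfolding D_def numeral_2_eq_2 by simp

lemma Ck_D: "Ck_on 1 (\<lambda>p. D p v) W"
  using C2 unfolding D_def numeral_2_eq_2 by simp

lemma D2_deriv: "p \<in> W \<Longrightarrow> ((\<lambda>q. D q v) has_derivative (\<lambda>x. D2 p x v)) (at p)"
  using Ck_on_has_derivative[of 0 "\<lambda>q. D q v" W p] Ck_D[of v] unfolding D2_def by simp

lemma D_cont: "continuous_on W (\<lambda>p. D p v)"
  using Ck_on_continuous[OF Ck_D] .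

lemma D2_cont: "continuous_on W (\<lambda>p. D2 p x v)"
  using Ck_D[of v] unfolding D2_def by simp

lemma D_linear: "p \<in> W \<Longrightarrow> linear (D p)"
  using D_deriv has_derivative_linear by blast

lemma D2_linear: "p \<in> W \<Longrightarrow> linear (\<lambda>x. D2 p x v)"
  using D2_deriv has_derivative_linear by blast

text \<open>Linearity in the inner slot is inherited from \<open>D q\<close> through uniqueness of
  the derivative.\<close>

lemma D2_linear': assumes p: "p \<in> W" shows "linear (D2 p x)"
proof -
  have "((\<lambda>q. D q (v + w)) has_derivative (\<lambda>x. D2 p x v + D2 p x w)) (at p)" for v w
    by (rule has_derivative_transform_within_open
        [OF has_derivative_add[OF D2_deriv[OF p, of v] D2_deriv[OF p, of w]] W p])
      (simp add: linear_add[OF D_linear])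
  moreover have "((\<lambda>q. D q (c *\<^sub>R v)) has_derivative (\<lambda>x. c *\<^sub>R D2 p x v)) (at p)" for c v
    by (rule has_derivative_transform_within_open
        [OF has_derivative_scaleR_right[OF D2_deriv[OF p, of v]] W p])
      (simp add: linear_cmul[OF D_linear])
  ultimately show ?thesis
    using has_derivative_unique[OF D2_deriv[OF p]]
    by (intro linearI) metis+
qed

lemma D_near:
  assumes "p0 \<in> W" "e > 0"
  obtains \<rho> where "\<rho> > 0" "ball p0 \<rho> \<subseteq> W"
    "\<And>p v. p \<in> ball p0 \<rho> \<Longrightarrow> norm (D p v - D p0 v) \<le> e * norm v"
proof -
  let ?e = "e / DIM('a)"
  have "\<forall>\<^sub>F p in at p0. \<forall>b\<in>Basis. dist (D p b) (D p0 b) < ?e"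
    using D_cont assms W by (intro eventually_ball_finite ballI finite_Basis tendstoD)
      (auto simp: continuous_on_eq_continuous_at isCont_def)
  then obtain d where d: "d > 0" "\<And>p. p \<noteq> p0 \<Longrightarrow> dist p p0 < d \<Longrightarrow> \<forall>b\<in>Basis. dist (D p b) (D p0 b) < ?e"
    unfolding eventually_at by blast
  obtain r where r: "r > 0" "ball p0 r \<subseteq> W" using W assms(1) openE by blast
  show ?thesis
  proof
    show "min d r > 0" using d r by simp
    show sub: "ball p0 (min d r) \<subseteq> W" using r by auto
    fix p v assume p: "p \<in> ball p0 (min d r)"
    have "linear (\<lambda>v. D p v - D p0 v)"
      using D_linear p sub assms(1) by (intro linear_compose_sub) auto
    moreover have "norm (D p b - D p0 b) \<le> ?e" if "b \<in> Basis" for b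
      using d(2)[of p] p that assms(2) by (cases "p = p0") (auto simp: dist_commute dist_norm norm_minus_commute intro: less_imp_le)
    ultimately show "norm (D p v - D p0 v) \<le> e * norm v"
      using linear_norm_le_Basis[of "\<lambda>v. D p v - D p0 v" ?e v] by simp
  qed
qed

text \<open>Uniform continuity on the compact ball is used for each pair of basis vectors; the
  minimum of the finitely many moduli serves all directions.\<close>

lemma D2_uniform:
  assumes "cball p0 R \<subseteq> W" "e > 0"
  obtains \<rho> where "\<rho> > 0"
    "\<And>p q x v. p \<in> cball p0 R \<Longrightarrow> q \<in> cball p0 R \<Longrightarrow> norm (q - p) \<le> \<rho> \<Longrightarrow>
      norm (D2 q x v - D2 p x v) \<le> e * norm x * norm v"
proof -
  let ?e = "e / (DIM('a) * DIM('a))"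
  have e: "?e > 0" using assms by simp
  define P where "P i j d \<longleftrightarrow> d > 0 \<and> (\<forall>p\<in>cball p0 R. \<forall>q\<in>cball p0 R. dist q p < d \<longrightarrow>
      dist (D2 q i j) (D2 p i j) < ?e)" for i j d
  have "\<exists>d. P i j d" for i j
    using compact_uniformly_continuous[OF continuous_on_subset[OF D2_cont assms(1)] compact_cball, of i j] e
    unfolding uniformly_continuous_on_def P_def by simp
  then have Pd: "P i j (SOME d. P i j d)" for i j
    by (rule someI_ex)
  define d where "d i j = (SOME d. P i j d)" for i j
  have "P i j (d i j)" for i j using Pd unfolding d_def .
  then have d: "\<And>i j. d i j > 0"
    "\<And>i j p q. p \<in> cball p0 R \<Longrightarrow> q \<in> cball p0 R \<Longrightarrow> dist q p < d i j \<Longrightarrow>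
      dist (D2 q i j) (D2 p i j) < ?e"
    unfolding P_def by simp_all
  define m where "m = Min ((\<lambda>(i, j). d i j) ` (Basis \<times> Basis))"
  have m: "m > 0" "\<And>i j. i \<in> Basis \<Longrightarrow> j \<in> Basis \<Longrightarrow> m \<le> d i j"
    unfolding m_def using d(1) by (auto simp: Min_gr_iff intro!: Min_le)
  show ?thesis
  proof
    show "m / 2 > 0" using m by simp
    fix p q x v assume pq: "p \<in> cball p0 R" "q \<in> cball p0 R" "norm (q - p) \<le> m / 2"
    have lin: "linear (\<lambda>x. D2 q x v - D2 p x v)" "linear (\<lambda>v. D2 q x v - D2 p x v)" for x v
      using pq assms(1) by (auto intro!: linear_compose_sub D2_linear D2_linear')
    have "norm (D2 q x v - D2 p x v) \<le> DIM('a) * (DIM('a) * ?e) * norm x * norm v"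
      using pq m(2) d(2)[OF pq(1,2)] m(1)
      by (intro bilinear_norm_le_Basis lin less_imp_le) (force simp: dist_norm)
    then show "norm (D2 q x v - D2 p x v) \<le> e * norm x * norm v" by simp
  qed
qed

lemma D2_bounded:
  assumes "cball p0 R \<subseteq> W"
  obtains C where "C > 0"
    "\<And>p x v. p \<in> cball p0 R \<Longrightarrow> norm (D2 p x v) \<le> C * norm x * norm v"
proof -
  have "\<exists>B. \<forall>p\<in>cball p0 R. norm (D2 p i j) \<le> B" for i j
    using compact_imp_bounded[OF compact_continuous_image[OF continuous_on_subset[OF D2_cont assms]]]
    unfolding bounded_iff by auto
  then obtain B where B: "\<And>i j p. p \<in> cball p0 R \<Longrightarrow> norm (D2 p i j) \<le> B i j" by metis
  define M where "M = (\<Sum>i\<in>Basis. \<Sum>j\<in>Basis. \<bar>B i j\<bar>) + 1"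
  have M: "\<bar>B i j\<bar> \<le> M" if "i \<in> Basis" "j \<in> Basis" for i j
  proof -
    have "\<bar>B i j\<bar> \<le> (\<Sum>j\<in>Basis. \<bar>B i j\<bar>)" using that by (intro member_le_sum) auto
    also have "\<dots> \<le> (\<Sum>i\<in>Basis. \<Sum>j\<in>Basis. \<bar>B i j\<bar>)"
      using that(1) by (rule member_le_sum[where f = "\<lambda>i. \<Sum>j\<in>Basis. \<bar>B i j\<bar>"]) (auto intro: sum_nonneg)
    finally show ?thesis unfolding M_def by simp
  qed
  have M0: "M > 0" unfolding M_def by (intro add_nonneg_pos sum_nonneg) auto
  show ?thesis
  proof
    show "DIM('a) * (DIM('a) * M) > 0" using M0 by simp
    fix p x v assume p: "p \<in> cball p0 R"
    show "norm (D2 p x v) \<le> DIM('a) * (DIM('a) * M) * norm x * norm v"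
    proof (rule bilinear_norm_le_Basis)
      show "linear (\<lambda>x. D2 p x v)" "linear (D2 p x)" for x v
        using D2_linear D2_linear' assms p by auto
      fix b b' :: 'a assume "b \<in> Basis" "b' \<in> Basis"
      then show "norm (D2 p b b') \<le> M" using B[OF p, of b b'] M[of b b'] by linarith
    qed
  qed
qed

text \<open>The mean value inequality is used twice: the bound on \<open>D2\<close> makes
  \<open>D\<close> Lipschitz, and this bounds the derivative of \<open>f - D p\<close> along the
  segment from \<open>p\<close> to \<open>q\<close> by \<open>C * norm (q - p)\<close>.\<close>

lemma D_Lipschitz:
  assumes "cball p0 R \<subseteq> W"
  obtains C where "C > 0"
    "\<And>p q v. p \<in> cball p0 R \<Longrightarrow> q \<in> cball p0 R \<Longrightarrow> norm (D q v - D p v) \<le> C * norm (q - p) * norm v"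
    "\<And>p q. p \<in> cball p0 R \<Longrightarrow> q \<in> cball p0 R \<Longrightarrow> norm (f q - f p - D p (q - p)) \<le> C * norm (q - p) ^ 2"
proof -
  obtain C where C: "C > 0" "\<And>p x v. p \<in> cball p0 R \<Longrightarrow> norm (D2 p x v) \<le> C * norm x * norm v"
    using D2_bounded[OF assms] by blast
  have 1: "norm (D q v - D p v) \<le> C * norm (q - p) * norm v"
    if "p \<in> cball p0 R" "q \<in> cball p0 R" for p q v
  proof -
    have "norm (D q v - D p v) \<le> (C * norm v) * norm (q - p)"
    proof (rule differentiable_bound[OF convex_cball _ _ that(2,1)])
      fix x assume x: "x \<in> cball p0 R"
      show "((\<lambda>q. D q v) has_derivative (\<lambda>y. D2 x y v)) (at x within cball p0 R)"
        using D2_deriv x assms has_derivative_at_withinI by blast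
      show "onorm (\<lambda>y. D2 x y v) \<le> C * norm v"
        using C(2)[OF x, of _ v] by (intro onorm_le) (simp add: mult_ac)
    qed
    then show ?thesis by (simp add: mult_ac)
  qed
  show ?thesis
  proof (rule that[OF C(1) 1])
    fix p q assume pq: "p \<in> cball p0 R" "q \<in> cball p0 R"
    have seg: "closed_segment p q \<subseteq> cball p0 R"
      by (rule closed_segment_subset[OF pq convex_cball])
    have "norm ((f q - D p q) - (f p - D p p)) \<le> (C * norm (q - p)) * norm (q - p)"
    proof (rule differentiable_bound[OF convex_closed_segment])
      fix x assume x: "x \<in> closed_segment p q"
      then have xW: "x \<in> W" "x \<in> cball p0 R" using seg assms by auto
      have blD: "bounded_linear (D p)" using D_linear pq assms linear_conv_bounded_linear by blast
      show "((\<lambda>q. f q - D p q) has_derivative (\<lambda>y. D x y - D p y)) (at x within closed_segment p q)"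
        by (intro has_derivative_diff has_derivative_at_withinI[OF D_deriv[OF xW(1)]]
            bounded_linear_imp_has_derivative[OF blD])
      have "norm (x - p) \<le> norm (q - p)"
        using segment_bound(1)[OF x] .
      then have "norm (D x y - D p y) \<le> (C * norm (q - p)) * norm y" for y
        using 1[OF pq(1) xW(2), of y] C(1)
        by (meson mult_left_mono mult_right_mono norm_ge_zero less_imp_le order_trans)
      then show "onorm (\<lambda>y. D x y - D p y) \<le> C * norm (q - p)"
        by (rule onorm_le)
    qed auto
    then show "norm (f q - f p - D p (q - p)) \<le> C * norm (q - p) ^ 2"
      using linear_diff[OF D_linear, of p q p] pq assms
      by (auto simp: power2_eq_square subset_iff) (simp add: algebra_simps)
  qed
qed

text \<open>Mere continuity of the second derivative gives no rate, so the remainder is an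
  arbitrarily small multiple of the square. What matters is that one \<rho> serves all base points
  of the ball.\<close>

lemma Taylor_uniform:
  assumes "cball p0 R \<subseteq> W" "e > 0"
  obtains \<rho> where "\<rho> > 0"
    "\<And>p q v. p \<in> cball p0 R \<Longrightarrow> q \<in> cball p0 R \<Longrightarrow> norm (q - p) \<le> \<rho> \<Longrightarrow>
      norm (D q v - D p v - D2 p (q - p) v) \<le> e * norm (q - p) * norm v"
    "\<And>p q. p \<in> cball p0 R \<Longrightarrow> q \<in> cball p0 R \<Longrightarrow> norm (q - p) \<le> \<rho> \<Longrightarrow>
      norm (f q - f p - D p (q - p) - (1/2) *\<^sub>R D2 p (q - p) (q - p)) \<le> e * norm (q - p) ^ 2"
proof -
  obtain \<rho> where \<rho>: "\<rho> > 0" "\<And>p q x v. p \<in> cball p0 R \<Longrightarrow> q \<in> cball p0 R \<Longrightarrow> norm (q - p) \<le> \<rho> \<Longrightarrow>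
      norm (D2 q x v - D2 p x v) \<le> e * norm x * norm v"
    using D2_uniform[OF assms] by blast
  have 1: "norm (D q v - D p v - D2 p (q - p) v) \<le> e * norm (q - p) * norm v"
    if pq: "p \<in> cball p0 R" "q \<in> cball p0 R" "norm (q - p) \<le> \<rho>" for p q v
  proof -
    have seg: "closed_segment p q \<subseteq> cball p0 R"
      by (rule closed_segment_subset[OF pq(1,2) convex_cball])
    have "norm ((D q v - D2 p q v) - (D p v - D2 p p v)) \<le> (e * norm v) * norm (q - p)"
    proof (rule differentiable_bound[OF convex_closed_segment])
      fix x assume x: "x \<in> closed_segment p q"
      then have xW: "x \<in> W" "x \<in> cball p0 R" using seg assms by auto
      have bl: "bounded_linear (\<lambda>x. D2 p x v)"
        using D2_linear pq assms linear_conv_bounded_linear by blast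
      show "((\<lambda>q. D q v - D2 p q v) has_derivative (\<lambda>y. D2 x y v - D2 p y v)) (at x within closed_segment p q)"
        by (intro has_derivative_diff has_derivative_at_withinI[OF D2_deriv[OF xW(1)]]
            bounded_linear_imp_has_derivative[OF bl])
      have "norm (x - p) \<le> \<rho>"
        using segment_bound(1)[OF x] pq(3) by linarith
      then have "norm (D2 x y v - D2 p y v) \<le> (e * norm v) * norm y" for y
        using \<rho>(2)[OF pq(1) xW(2), of y v] by (simp add: mult_ac)
      then show "onorm (\<lambda>y. D2 x y v - D2 p y v) \<le> e * norm v"
        by (rule onorm_le)
    qed auto
    then show ?thesis
      using linear_diff[OF D2_linear, of p q p v] pq assms
      by (auto simp: subset_iff) (simp add: algebra_simps)
  qed
  show ?thesis
  proof (rule that[OF \<rho>(1) 1])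
    fix p q assume pq: "p \<in> cball p0 R" "q \<in> cball p0 R" "norm (q - p) \<le> \<rho>"
    define x where "x = q - p"
    \<comment> \<open>With the quadratic Taylor polynomial subtracted along the segment, the
      derivative of \<open>g\<close> is the first order remainder already estimated in
      \<open>1\<close>.\<close>
    define g where "g t = f (p + t *\<^sub>R x) - t *\<^sub>R D p x - (t^2/2) *\<^sub>R D2 p x x" for t :: real
    have inseg: "p + t *\<^sub>R x \<in> cball p0 R" if "t \<in> {0..1}" for t
    proof -
      have "p + t *\<^sub>R x \<in> closed_segment p q"
        unfolding closed_segment_def x_def using that by (auto intro!: exI[of _ t] simp: algebra_simps)
      then show ?thesis using closed_segment_subset[OF pq(1,2) convex_cball] by blast
    qed
    have "norm (g 1 - g 0) \<le> (e * norm x ^ 2) * norm (1 - 0 :: real)"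
    proof (rule differentiable_bound[of "{0..1}"])
      fix t :: real assume t: "t \<in> {0..1}"
      let ?y = "p + t *\<^sub>R x"
      have y: "?y \<in> cball p0 R" "?y \<in> W" using inseg[OF t] assms by auto
      have lin: "linear (D ?y)" using D_linear y by blast
      have "((\<lambda>t. f (p + t *\<^sub>R x)) has_derivative (\<lambda>s. D ?y (s *\<^sub>R x))) (at t within {0..1})"
        by (rule has_derivative_compose[where f = "\<lambda>t. p + t *\<^sub>R x" and g = f, OF _ D_deriv[OF y(2)]])
          (auto intro!: derivative_eq_intros)
      then show "(g has_derivative (\<lambda>s. s *\<^sub>R (D ?y x - D p x - t *\<^sub>R D2 p x x))) (at t within {0..1})"
        unfolding g_def
        by (auto intro!: derivative_eq_intros simp: linear_cmul[OF lin] algebra_simps)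
      have "norm (D ?y x - D p x - D2 p (?y - p) x) \<le> e * norm (?y - p) * norm x"
      proof (rule 1[OF pq(1) y(1)])
        have "norm (?y - p) \<le> 1 * norm x" using t by (auto intro!: mult_left_le_one_le)
        then show "norm (?y - p) \<le> \<rho>" using pq(3) unfolding x_def by simp
      qed
      also have "\<dots> \<le> e * norm x * norm x"
        using t assms(2) by (auto intro!: mult_right_mono mult_left_le_one_le simp: mult.assoc)
      finally have "norm (D ?y x - D p x - t *\<^sub>R D2 p x x) \<le> e * norm x ^ 2"
        using linear_cmul[OF D2_linear, of p t x x] pq assms by (auto simp: power2_eq_square subset_iff mult_ac)
      then show "onorm (\<lambda>s. s *\<^sub>R (D ?y x - D p x - t *\<^sub>R D2 p x x)) \<le> e * norm x ^ 2"
        by (intro onorm_le) (simp add: mult.commute mult_left_mono)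
    qed auto
    then show "norm (f q - f p - D p (q - p) - (1/2) *\<^sub>R D2 p (q - p) (q - p)) \<le> e * norm (q - p) ^ 2"
      unfolding g_def x_def by (simp add: algebra_simps)
  qed
qed

end

section \<open>A covering criterion for negligible images\<close>

lemma floor_divide_eq_imp_close:
  fixes x y \<eta> :: real
  assumes "\<eta> > 0" "\<lfloor>x / \<eta>\<rfloor> = \<lfloor>y / \<eta>\<rfloor>"
  shows "\<bar>x - y\<bar> \<le> \<eta>"
proof -
  have "\<bar>x / \<eta> - y / \<eta>\<bar> \<le> 1" using assms(2) by linarith
  then show ?thesis using assms(1) by (simp add: diff_divide_distrib[symmetric] abs_divide field_simps)
qed

lemma card_floor_cells:
  fixes M \<eta> :: real
  assumes "0 < \<eta>" "\<eta> \<le> 1" "0 \<le> M"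
  shows "finite {k::int. \<bar>real_of_int k\<bar> \<le> M / \<eta> + 1}"
    and "real (card {k::int. \<bar>real_of_int k\<bar> \<le> M / \<eta> + 1}) \<le> (2 * M + 3) / \<eta>"
proof -
  let ?N = "\<lfloor>M / \<eta> + 1\<rfloor>"
  have eq: "{k::int. \<bar>real_of_int k\<bar> \<le> M / \<eta> + 1} = {-?N..?N}"
    by (auto simp: abs_le_iff) linarith+
  then show "finite {k::int. \<bar>real_of_int k\<bar> \<le> M / \<eta> + 1}" by simp
  have N0: "?N \<ge> 0" using assms by (auto simp: le_floor_iff)
  have "real (card {-?N..?N}) = 2 * of_int ?N + 1" using N0 by simp
  also have "\<dots> \<le> 2 * (M / \<eta> + 1) + 1" by (smt (verit) of_int_floor_le)
  \<comment> \<open>The additive 3 is at most \<open>3 / \<eta>\<close> because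
    \<open>\<eta> \<le> 1\<close>.\<close>
  also have "\<dots> \<le> (2 * M + 3) / \<eta>" using assms by (simp add: field_simps)
  finally show "real (card {k::int. \<bar>real_of_int k\<bar> \<le> M / \<eta> + 1}) \<le> (2 * M + 3) / \<eta>"
    unfolding eq .
qed

text \<open>Points are sorted into cells by the \<open>J\<close> coordinates of their image at scale
  \<eta> and by the functions \<open>l i\<close> at scale \<delta>. The number of cells is at most a
  constant over \<eta>^|J| \<delta>^|I|, and the image of each lies in a box of volume a constant
  times \<eta>^|J| \<tau>^m with m the number of remaining coordinates. The powers of \<eta> cancel,
  so \<eta> can be made tiny at no cost and only \<tau> against \<delta> is constrained.\<close>

lemma negligible_image_by_cells:
  fixes f :: "'a \<Rightarrow> 'b::euclidean_space" and l :: "'i \<Rightarrow> 'a \<Rightarrow> real"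
  assumes J: "J \<subseteq> Basis" and I: "finite I" and M: "M > 0"
    and fM: "\<And>p b. p \<in> S \<Longrightarrow> b \<in> J \<Longrightarrow> \<bar>f p \<bullet> b\<bar> \<le> M"
    and lM: "\<And>p i. p \<in> S \<Longrightarrow> i \<in> I \<Longrightarrow> \<bar>l i p\<bar> \<le> M"
    and main: "\<And>\<epsilon>. \<epsilon> > 0 \<Longrightarrow> \<exists>\<delta> \<eta> \<tau>. 0 < \<delta> \<and> \<delta> \<le> 1 \<and> 0 < \<eta> \<and> \<eta> \<le> 1 \<and> 0 < \<tau> \<and>
        \<tau> ^ card (Basis - J) \<le> \<epsilon> * \<delta> ^ card I \<and>
        (\<forall>p\<in>S. \<forall>q\<in>S. (\<forall>b\<in>J. \<bar>f q \<bullet> b - f p \<bullet> b\<bar> \<le> \<eta>) \<and> (\<forall>i\<in>I. \<bar>l i q - l i p\<bar> \<le> \<delta>) \<longrightarrow>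
           (\<forall>c\<in>Basis - J. \<bar>f q \<bullet> c - f p \<bullet> c\<bar> \<le> \<tau>))"
  shows "negligible (f ` S)"
  unfolding negligible_outer_le
proof (intro allI impI)
  fix e :: real assume e: "e > 0"
  have finJ: "finite J" using J finite_Basis finite_subset by blast
  define m where "m = card (Basis - J)"
  \<comment> \<open>\<open>A\<close> gathers the factors 2 from the sides of the boxes and the
    factors \<open>2 * M + 3\<close> from the cell counts. None depends on the scales, so
    \<open>e / A\<close> can be passed to \<open>main\<close>.\<close>
  define A where "A = 2 ^ card J * (2 * M + 3) ^ card J * 2 ^ m * (2 * M + 3) ^ card I"
  have A: "A > 0" unfolding A_def using M by simp
  obtain \<delta> \<eta> \<tau> where par: "0 < \<delta>" "\<delta> \<le> 1" "0 < \<eta>" "\<eta> \<le> 1" "0 < \<tau>"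
      "\<tau> ^ m \<le> (e / A) * \<delta> ^ card I"
    and close: "\<And>p q c. p \<in> S \<Longrightarrow> q \<in> S \<Longrightarrow> (\<And>b. b \<in> J \<Longrightarrow> \<bar>f q \<bullet> b - f p \<bullet> b\<bar> \<le> \<eta>) \<Longrightarrow>
        (\<And>i. i \<in> I \<Longrightarrow> \<bar>l i q - l i p\<bar> \<le> \<delta>) \<Longrightarrow> c \<in> Basis - J \<Longrightarrow> \<bar>f q \<bullet> c - f p \<bullet> c\<bar> \<le> \<tau>"
    using main[of "e / A"] e A unfolding m_def by (metis divide_pos_pos)
  define \<kappa> where "\<kappa> p = (restrict (\<lambda>b. \<lfloor>f p \<bullet> b / \<eta>\<rfloor>) J, restrict (\<lambda>i. \<lfloor>l i p / \<delta>\<rfloor>) I)" for p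
  define Z where "Z t = {k::int. \<bar>real_of_int k\<bar> \<le> M / t + 1}" for t
  define K where "K = (J \<rightarrow>\<^sub>E Z \<eta>) \<times> (I \<rightarrow>\<^sub>E Z \<delta>)"
  have finZ: "finite (Z \<eta>)" "finite (Z \<delta>)"
    and cardZ: "real (card (Z \<eta>)) \<le> (2 * M + 3) / \<eta>" "real (card (Z \<delta>)) \<le> (2 * M + 3) / \<delta>"
    unfolding Z_def using card_floor_cells par M by auto
  have finK: "finite K" unfolding K_def using finZ finJ I by (intro finite_cartesian_product finite_PiE) auto
  have inZ: "\<lfloor>x / t\<rfloor> \<in> Z t" if "\<bar>x\<bar> \<le> M" "0 < t" for x t
  proof -
    have "x / t \<le> M / t" "- (M / t) \<le> x / t"
      using that divide_right_mono[of x M t] divide_right_mono[of "-M" x t] by auto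
    then show ?thesis unfolding Z_def mem_Collect_eq by linarith
  qed
  have \<kappa>K: "\<kappa> ` S \<subseteq> K"
    unfolding \<kappa>_def K_def using inZ fM lM par by auto
  have cardK: "real (card K) \<le> ((2 * M + 3) / \<eta>) ^ card J * ((2 * M + 3) / \<delta>) ^ card I"
    unfolding K_def card_cartesian_product using finJ I M par
    by (auto simp: card_PiE intro!: mult_mono power_mono cardZ)
  \<comment> \<open>Each occupied cell is represented by one of its points, and its box is centred
    at the image of that point.\<close>
  define rep where "rep k = (SOME p. p \<in> S \<and> \<kappa> p = k)" for k
  have rep: "rep (\<kappa> p) \<in> S" "\<kappa> (rep (\<kappa> p)) = \<kappa> p" if "p \<in> S" for p
    using someI[of "\<lambda>q. q \<in> S \<and> \<kappa> q = \<kappa> p" p] that unfolding rep_def by auto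
  define w :: 'b where "w = (\<Sum>b\<in>Basis. (if b \<in> J then \<eta> else \<tau>) *\<^sub>R b)"
  have w: "w \<bullet> b = (if b \<in> J then \<eta> else \<tau>)" if "b \<in> Basis" for b
    unfolding w_def using that by (simp add: inner_sum_left_Basis)
  define B where "B k = cbox (f (rep k) - w) (f (rep k) + w)" for k
  have cB: "measure lebesgue (B k) = (2 * \<eta>) ^ card J * (2 * \<tau>) ^ m" for k
  proof -
    have "measure lebesgue (B k) = (\<Prod>b\<in>Basis. 2 * (w \<bullet> b))"
      unfolding B_def using w par
      by (subst measure_completion, simp, subst content_cbox)
        (auto simp: inner_diff_left inner_add_left algebra_simps intro!: prod.cong)
    also have "\<dots> = (\<Prod>b\<in>Basis. if b \<in> J then 2 * \<eta> else 2 * \<tau>)"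
      by (rule prod.cong) (auto simp: w)
    also have "\<dots> = (\<Prod>b\<in>J. 2 * \<eta>) * (\<Prod>b\<in>Basis - J. 2 * \<tau>)"
      using prod.If_cases[of "Basis :: 'b set" "\<lambda>b. b \<in> J" "\<lambda>_. 2 * \<eta>" "\<lambda>_. 2 * \<tau>"] J
      by (simp add: Int_absorb1 Diff_eq inf.absorb2)
    finally show ?thesis unfolding m_def by simp
  qed
  define T where "T = (\<Union>k\<in>\<kappa> ` S. B k)"
  have fin: "finite (\<kappa> ` S)" using \<kappa>K finK finite_subset by blast
  have "f ` S \<subseteq> T"
  proof
    fix z assume "z \<in> f ` S"
    then obtain p where p: "p \<in> S" "z = f p" by blast
    let ?q = "rep (\<kappa> p)"
    have J': "\<bar>f p \<bullet> b - f ?q \<bullet> b\<bar> \<le> \<eta>" if "b \<in> J" for b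
      using fun_cong[OF arg_cong[OF rep(2)[OF p(1)], of fst], of b] that par(3)
      by (auto simp: \<kappa>_def intro: floor_divide_eq_imp_close)
    have I': "\<bar>l i p - l i ?q\<bar> \<le> \<delta>" if "i \<in> I" for i
      using fun_cong[OF arg_cong[OF rep(2)[OF p(1)], of snd], of i] that par(1)
      by (auto simp: \<kappa>_def intro: floor_divide_eq_imp_close)
    have "\<bar>f p \<bullet> b - f ?q \<bullet> b\<bar> \<le> w \<bullet> b" if "b \<in> Basis" for b
      using J' close[OF rep(1)[OF p(1)] p(1) J' I', of b] w[OF that] that by auto
    then have "z \<in> B (\<kappa> p)"
      unfolding B_def mem_box p(2) by (auto simp: inner_diff_left inner_add_left abs_le_iff algebra_simps)
    then show "z \<in> T" unfolding T_def using p by blast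
  qed
  moreover have "T \<in> lmeasurable"
    unfolding T_def B_def by (intro fmeasurable.finite_UN fin) auto
  moreover have "measure lebesgue T \<le> e"
  proof -
    have "measure lebesgue T \<le> (\<Sum>k\<in>\<kappa> ` S. measure lebesgue (B k))"
      unfolding T_def by (rule measure_UNION_le[OF fin]) (simp add: B_def)
    also have "\<dots> = real (card (\<kappa> ` S)) * ((2 * \<eta>) ^ card J * (2 * \<tau>) ^ m)"
      by (simp add: cB)
    also have "\<dots> \<le> (((2 * M + 3) / \<eta>) ^ card J * ((2 * M + 3) / \<delta>) ^ card I) * ((2 * \<eta>) ^ card J * (2 * \<tau>) ^ m)"
      using card_mono[OF finK \<kappa>K] cardK par by (intro mult_right_mono) auto
    also have "\<dots> = A * (\<tau> ^ m / \<delta> ^ card I)"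
      unfolding A_def power_mult_distrib[of 2] using par
      by (simp add: power_mult_distrib[of 2] power_divide field_simps)
    also have "\<dots> \<le> e"
      using par A by (simp add: field_simps)
    finally show ?thesis .
  qed
  ultimately show "\<exists>T. f ` S \<subseteq> T \<and> T \<in> lmeasurable \<and> measure lebesgue T \<le> e" by blast
qed

section \<open>Sard's theorem in corank one\<close>

definition part_norm :: "'b::euclidean_space set \<Rightarrow> 'b \<Rightarrow> real" where
  "part_norm J z = (\<Sum>b\<in>J. \<bar>z \<bullet> b\<bar>)"

lemma part_norm_nonneg [simp]: "0 \<le> part_norm J z"
  unfolding part_norm_def by (simp add: sum_nonneg)

lemma part_norm_add: "part_norm J (x + y) \<le> part_norm J x + part_norm J y"
  unfolding part_norm_def sum.distrib[symmetric] by (intro sum_mono) (simp add: inner_add_left)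

lemma part_norm_le:
  assumes "J \<subseteq> Basis"
  shows "part_norm J (z::'b::euclidean_space) \<le> DIM('b) * norm z"
proof -
  have "part_norm J z \<le> (\<Sum>b\<in>J. norm z)"
    unfolding part_norm_def using assms by (intro sum_mono Basis_le_norm) auto
  also have "\<dots> \<le> DIM('b) * norm z"
    using assms by (simp add: card_mono mult_right_mono)
  finally show ?thesis .
qed

lemma part_norm_perturb:
  fixes e :: real
  assumes "J \<subseteq> Basis" "norm (x - y) \<le> e"
  shows "part_norm J (x::'b::euclidean_space) \<le> part_norm J y + DIM('b) * e"
proof -
  have "part_norm J x \<le> part_norm J y + part_norm J (x - y)"
    using part_norm_add[of J y "x - y"] by simp
  also have "part_norm J (x - y) \<le> DIM('b) * e"
    using part_norm_le[OF assms(1), of "x - y"] assms(2) by (meson mult_left_mono of_nat_0_le_iff order_trans)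
  finally show ?thesis by simp
qed

lemma inner_span_Basis_zero:
  assumes "z \<in> span J" "J \<subseteq> Basis" "c \<in> Basis - J"
  shows "z \<bullet> c = 0"
  using assms(1)
proof (induction rule: span_induct_alt)
  case (step a b z)
  then have "b \<bullet> c = 0" using assms(2,3) inner_not_same_Basis by blast
  then show ?case using step by (simp add: inner_add_left)
qed simp

text \<open>One \<open>E\<close> pays for the coordinate \<open>c\<close>, and
  \<open>DIM('b)\<close> of them for the change of \<open>part_norm\<close>, a sum of at most that
  many coordinates.\<close>

lemma graph_bound_perturb:
  fixes E :: real
  assumes "J \<subseteq> Basis" "c \<in> Basis" "\<bar>d \<bullet> c\<bar> \<le> part_norm J d" "norm (z - d) \<le> E"
  shows "\<bar>z \<bullet> c\<bar> \<le> part_norm J (z::'b::euclidean_space) + (real DIM('b) + 1) * E"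
proof -
  have "\<bar>z \<bullet> c\<bar> \<le> \<bar>d \<bullet> c\<bar> + \<bar>(z - d) \<bullet> c\<bar>" by (simp add: inner_diff_left)
  also have "\<bar>(z - d) \<bullet> c\<bar> \<le> norm (z - d)" using assms(2) by (rule Basis_le_norm)
  also have "\<bar>d \<bullet> c\<bar> \<le> part_norm J d" by (rule assms(3))
  also have "part_norm J d \<le> part_norm J z + DIM('b) * E"
    by (rule part_norm_perturb[OF assms(1)]) (use assms(4) in \<open>simp only: norm_minus_commute\<close>)
  finally show ?thesis using assms(4) by (simp add: algebra_simps)
qed

lemma norm_le_part_norm:
  assumes "z \<in> span J" "J \<subseteq> Basis"
  shows "norm z \<le> part_norm J z"
proof -
  have "norm z \<le> (\<Sum>b\<in>Basis. \<bar>z \<bullet> b\<bar>)" by (rule norm_le_l1)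
  also have "\<dots> = part_norm J z"
    unfolding part_norm_def using assms inner_span_Basis_zero[OF assms]
    by (intro sum.mono_neutral_right) auto
  finally show ?thesis .
qed

lemma in_span_Basis_if:
  assumes "\<And>c. c \<in> Basis - J \<Longrightarrow> z \<bullet> c = 0" "J \<subseteq> Basis"
  shows "z \<in> span J"
proof -
  have "z = (\<Sum>b\<in>Basis. (z \<bullet> b) *\<^sub>R b)" by (simp add: euclidean_representation)
  also have "\<dots> = (\<Sum>b\<in>J. (z \<bullet> b) *\<^sub>R b)"
    using assms by (intro sum.mono_neutral_right) auto
  also have "\<dots> \<in> span J" by (intro span_sum span_scale span_base)
  finally show ?thesis .
qed

text \<open>Continuity gives a positive minimum on the compact unit sphere, and homogeneity spreads
  it. The lemma is applied to sums of seminorms whose common kernel is trivial.\<close>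

lemma homogeneous_positive_bound:
  fixes N :: "'a::euclidean_space \<Rightarrow> real"
  assumes "continuous_on UNIV N" "\<And>c x. N (c *\<^sub>R x) = \<bar>c\<bar> * N x" "\<And>x. x \<noteq> 0 \<Longrightarrow> N x > 0"
  obtains C where "C > 0" "\<And>x. norm x \<le> C * N x"
proof -
  obtain b :: 'a where b: "b \<in> Basis" using nonempty_Basis by blast
  have ne: "sphere (0::'a) 1 \<noteq> {}" using b by (auto intro!: exI[of _ b])
  obtain y where y: "y \<in> sphere 0 1" "\<And>x. x \<in> sphere 0 1 \<Longrightarrow> N y \<le> N x"
    using continuous_attains_inf[OF compact_sphere ne continuous_on_subset[OF assms(1)]] by auto
  have "y \<noteq> 0" using y(1) by auto
  then have Ny: "N y > 0" by (rule assms(3))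
  show ?thesis
  proof
    show "1 / N y > 0" using Ny by simp
    fix x
    show "norm x \<le> 1 / N y * N x"
    proof (cases "x = 0")
      case True
      then show ?thesis using assms(2)[of 0 x] by simp
    next
      case False
      have "N y \<le> N ((1 / norm x) *\<^sub>R x)" using False by (intro y(2)) simp
      also have "\<dots> = N x / norm x" using assms(2) by simp
      finally show ?thesis using False Ny by (simp add: field_simps)
    qed
  qed
qed

lemma continuous_part_norm:
  "continuous_on A g \<Longrightarrow> continuous_on A (\<lambda>x. part_norm J (g x))"
  unfolding part_norm_def by (intro continuous_intros)

lemma part_norm_scaleR: "part_norm J (c *\<^sub>R x) = \<bar>c\<bar> * part_norm J x"
  unfolding part_norm_def by (simp add: sum_distrib_left abs_mult)

section \<open>Kernel, range and complement of a linear map\<close>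

lemma dim_image_inj_subspace:
  fixes L :: "'a::euclidean_space \<Rightarrow> 'b::euclidean_space"
  assumes "linear L" "subspace S" "inj_on L S"
  shows "dim (L ` S) = dim S"
proof -
  have "inj_on L (span S)"
    by (rule inj_on_subset[OF assms(3) span_minimal[OF order_refl assms(2)]])
  then show ?thesis using dim_image_eq[OF assms(1)] by blast
qed

lemma kernel_subspace: "linear L \<Longrightarrow> subspace {x. L x = 0}"
  by (rule linear_subspace_kernel)

text \<open>The orthogonal complement of the kernel is mapped isomorphically onto the range. It is
  kept explicit because the derivatives at nearby points are studied on this same
  complement.\<close>

lemma dim_kernel_range:
  fixes L :: "'a::euclidean_space \<Rightarrow> 'b::euclidean_space"
  assumes L: "linear L"
  shows "dim {x. L x = 0} + dim (range L) = DIM('a)"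
    and "inj_on L {y. \<forall>x\<in>{x. L x = 0}. orthogonal x y}"
    and "dim {y. \<forall>x\<in>{x. L x = 0}. orthogonal x y} = dim (range L)"
proof -
  let ?K = "{x. L x = 0}"
  let ?Q = "{y. \<forall>x\<in>?K. orthogonal x y}"
  have subQ: "subspace ?Q"
    unfolding subspace_def by (auto simp: orthogonal_def inner_add_right)
  have 1: "dim ?Q + dim ?K = DIM('a)"
    using dim_subspace_orthogonal_to_vectors[OF kernel_subspace[OF L] subspace_UNIV] by simp
  show 2: "inj_on L ?Q"
  proof (rule inj_onI)
    fix x y assume xy: "x \<in> ?Q" "y \<in> ?Q" "L x = L y"
    have "x - y \<in> ?Q" using subQ xy by (simp only: subspace_diff)
    moreover have "x - y \<in> ?K" using xy by (simp add: linear_diff[OF L])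
    ultimately have "orthogonal (x - y) (x - y)" by blast
    then show "x = y" by (simp add: orthogonal_def)
  qed
  have "L ` ?Q = range L"
  proof
    show "range L \<subseteq> L ` ?Q"
    proof clarify
      fix x
      obtain y z where yz: "y \<in> span ?K" "\<And>w. w \<in> span ?K \<Longrightarrow> orthogonal z w" "x = y + z"
        using orthogonal_subspace_decomp_exists[of ?K x] by blast
      have "y \<in> ?K"
        using span_minimal[OF order_refl kernel_subspace[OF L]] yz(1) by (rule subsetD)
      then have "L y = 0" by simp
      moreover have "z \<in> ?Q" using yz(2) by (auto simp: orthogonal_commute span_base)
      ultimately show "L x \<in> L ` ?Q" using yz(3) by (auto simp: linear_add[OF L])
    qed
  qed auto
  then have "dim (range L) = dim ?Q"
    using dim_image_inj_subspace[OF L subQ 2] by simp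
  then show "dim {x. L x = 0} + dim (range L) = DIM('a)" "dim ?Q = dim (range L)"
    using 1 by auto
qed

text \<open>The seminorm \<open>part_norm J (L x)\<close> vanishes just on the kernel, where inner
  products with a basis separate points; together they dominate the norm. The set \<open>B\<close>
  will supply the cell functions in the directions that \<open>L\<close> does not see, which is why
  its size is recorded.\<close>

lemma kernel_norm_bound:
  fixes L :: "'a::euclidean_space \<Rightarrow> 'b::euclidean_space"
  assumes L: "linear L" and J: "J \<subseteq> Basis" "range L \<subseteq> span J"
  obtains B C where "finite B" "B \<subseteq> {x. L x = 0}" "card B + dim (range L) = DIM('a)" "C > 0"
    "\<And>x. norm x \<le> C * (part_norm J (L x) + (\<Sum>b\<in>B. \<bar>x \<bullet> b\<bar>))"
proof -
  obtain B where B: "B \<subseteq> {x. L x = 0}" "independent B" "card B = dim {x. L x = 0}"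
      "span B = {x. L x = 0}"
    using orthonormal_basis_subspace[OF kernel_subspace[OF L]] by metis
  have finB: "finite B" using B(2) independent_imp_finite by blast
  define N where "N x = part_norm J (L x) + (\<Sum>b\<in>B. \<bar>x \<bullet> b\<bar>)" for x
  have "continuous_on UNIV N"
    unfolding N_def
    by (intro continuous_intros continuous_part_norm linear_continuous_on)
      (use L linear_conv_bounded_linear in blast)
  moreover have "N (c *\<^sub>R x) = \<bar>c\<bar> * N x" for c x
    unfolding N_def by (simp add: linear_cmul[OF L] part_norm_scaleR abs_mult sum_distrib_left algebra_simps)
  moreover have "N x > 0" if "x \<noteq> 0" for x
  proof (rule ccontr)
    assume "\<not> N x > 0"
    then have 0: "part_norm J (L x) = 0" "(\<Sum>b\<in>B. \<bar>x \<bullet> b\<bar>) = 0"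
    proof -
      have "(\<Sum>b\<in>B. \<bar>x \<bullet> b\<bar>) \<ge> 0" by (simp add: sum_nonneg)
      then show "part_norm J (L x) = 0" "(\<Sum>b\<in>B. \<bar>x \<bullet> b\<bar>) = 0"
        using \<open>\<not> N x > 0\<close> part_norm_nonneg[of J "L x"] unfolding N_def by linarith+
    qed
    have "norm (L x) \<le> 0" using norm_le_part_norm[of "L x" J] J 0(1) by auto
    then have "x \<in> span B" using B(4) by auto
    moreover have "\<forall>b\<in>B. orthogonal x b" using 0(2) finB by (simp add: sum_nonneg_eq_0_iff orthogonal_def)
    ultimately have "orthogonal x x" using orthogonal_to_span by blast
    then show False using that by (simp add: orthogonal_def)
  qed
  ultimately obtain C where "C > 0" "\<And>x. norm x \<le> C * N x"
    using homogeneous_positive_bound[of N] by blast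
  then show ?thesis
    using that[OF finB B(1)] B(3) dim_kernel_range(1)[OF L] unfolding N_def by auto
qed

text \<open>The coordinates outside \<open>J\<close> move by a multiple of the \<open>J\<close>
  coordinates plus a quadratic remainder. As the scale \<eta> of the \<open>J\<close> coordinates is
  free, the first part can be made no larger than the second, and cells of mesh \<delta> give boxes
  of height about \<omega> \<delta>^2. The last clause of \<open>est\<close> says that this height,
  raised to the corank, beats the number of cells.\<close>

lemma negligible_image_quadratic:
  fixes f :: "'a::euclidean_space \<Rightarrow> 'b::euclidean_space"
  assumes J: "J \<subseteq> Basis" and I: "finite I" and S: "bounded S" "bounded (f ` S)" and \<kappa>: "\<kappa> > 0"
    and chart: "\<And>p q. p \<in> S \<Longrightarrow> q \<in> S \<Longrightarrow>
        norm (q - p) \<le> \<kappa> * (part_norm J (f q - f p) + (\<Sum>u\<in>I. \<bar>(q - p) \<bullet> u\<bar>))"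
    and est: "\<And>\<epsilon>. \<epsilon> > 0 \<Longrightarrow> \<exists>\<rho> \<omega> B. \<rho> > 0 \<and> \<omega> > 0 \<and> B > 0 \<and>
        (\<forall>p\<in>S. \<forall>q\<in>S. norm (q - p) \<le> \<rho> \<longrightarrow>
           (\<forall>c\<in>Basis - J. \<bar>(f q - f p) \<bullet> c\<bar> \<le> B * part_norm J (f q - f p) + \<omega> * norm (q - p) ^ 2)) \<and>
        (\<forall>\<delta>. 0 < \<delta> \<and> \<delta> < \<rho> \<longrightarrow> (\<omega> * \<delta> ^ 2) ^ card (Basis - J) \<le> \<epsilon> * \<delta> ^ card I)"
  shows "negligible (f ` S)"
proof -
  obtain M1 where M1: "M1 > 0" "\<And>p. p \<in> S \<Longrightarrow> norm p \<le> M1"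
    using S(1) bounded_pos by metis
  obtain M2 where M2: "M2 > 0" "\<And>p. p \<in> S \<Longrightarrow> norm (f p) \<le> M2"
    using S(2) unfolding bounded_pos by blast
  define U where "U = (\<Sum>u\<in>I. norm u) + 1"
  have U: "norm u \<le> U" if "u \<in> I" for u
    using member_le_sum[of u I norm] I that unfolding U_def by auto
  have U0: "U > 0" unfolding U_def by (simp add: add_nonneg_pos sum_nonneg)
  define M where "M = M1 * U + M2"
  have M: "M > 0" "M1 * U \<le> M" "M2 \<le> M" unfolding M_def using M1 M2 U0 by (auto intro: add_pos_pos)
  have finJ: "finite J" using J finite_Basis finite_subset by blast
  show ?thesis
  proof (rule negligible_image_by_cells[where J = J and I = I and l = "\<lambda>u p. p \<bullet> u" and M = M, OF J I M(1)])
    fix p b assume "p \<in> S" "b \<in> J"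
    then show "\<bar>f p \<bullet> b\<bar> \<le> M" using M2(2)[of p] M(3) Basis_le_norm[of b "f p"] J by force
  next
    fix p u assume *: "p \<in> S" "u \<in> I"
    have "\<bar>p \<bullet> u\<bar> \<le> norm p * norm u" by (rule Cauchy_Schwarz_ineq2)
    also have "\<dots> \<le> M1 * U" using M1 U * by (intro mult_mono) auto
    finally show "\<bar>p \<bullet> u\<bar> \<le> M" using M by simp
  next
    fix \<epsilon> :: real assume \<epsilon>: "\<epsilon> > 0"
    define m' where "m' = card (Basis - J)"
    define \<kappa>' where "\<kappa>' = \<kappa> * (1 + card I)"
    define r where "r = real (card J) + 1"
    have \<kappa>': "\<kappa>' > 0" unfolding \<kappa>'_def using \<kappa> by (simp add: add_pos_nonneg)
    have r: "r > 0" unfolding r_def by simp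
    have k1: "1 + \<kappa>'^2 > 0" by (simp add: add_pos_nonneg)
    \<comment> \<open>The factor \<open>1 + \<kappa>'^2\<close> that \<tau> will carry is paid in
      advance by dividing \<epsilon>.\<close>
    obtain \<rho> \<omega> B where *: "\<rho> > 0" "\<omega> > 0" "B > 0"
      and **: "\<And>p q c. p \<in> S \<Longrightarrow> q \<in> S \<Longrightarrow> norm (q - p) \<le> \<rho> \<Longrightarrow> c \<in> Basis - J \<Longrightarrow>
          \<bar>(f q - f p) \<bullet> c\<bar> \<le> B * part_norm J (f q - f p) + \<omega> * norm (q - p) ^ 2"
      and ***: "\<And>\<delta>. 0 < \<delta> \<Longrightarrow> \<delta> < \<rho> \<Longrightarrow> (\<omega> * \<delta> ^ 2) ^ m' \<le> \<epsilon> / (1 + \<kappa>'^2) ^ m' * \<delta> ^ card I"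
      using est[of "\<epsilon> / (1 + \<kappa>'^2) ^ m'"] \<epsilon> k1 unfolding m'_def by (metis divide_pos_pos zero_less_power)
    define \<delta> where "\<delta> = min 1 (min (\<rho> / 2) (\<rho> / \<kappa>'))"
    have \<delta>: "0 < \<delta>" "\<delta> \<le> 1" "\<delta> < \<rho>" "\<kappa>' * \<delta> \<le> \<rho>"
      unfolding \<delta>_def using * \<kappa>' by (auto simp: min_def field_simps)
    \<comment> \<open>The entry \<open>\<delta> / r\<close> keeps points of one cell within distance
      \<open>\<kappa>' * \<delta>\<close>; the last entry makes the contribution of the
      \<open>J\<close> coordinates at most \<open>\<omega> * \<delta>^2\<close>.\<close>
    define \<eta> where "\<eta> = min 1 (min (\<delta> / r) (\<omega> * \<delta>^2 / (B * r)))"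
    have \<eta>: "0 < \<eta>" "\<eta> \<le> 1" unfolding \<eta>_def using \<delta> * r by auto
    have "r * \<eta> \<le> r * (\<delta> / r)" unfolding \<eta>_def using r by (intro mult_left_mono) auto
    then have \<eta>1: "r * \<eta> \<le> \<delta>" using r by simp
    have "(B * r) * \<eta> \<le> (B * r) * (\<omega> * \<delta>^2 / (B * r))"
      unfolding \<eta>_def using r * by (intro mult_left_mono) auto
    then have \<eta>2: "B * (r * \<eta>) \<le> \<omega> * \<delta>^2" using r * by (simp add: mult.assoc)
    \<comment> \<open>One summand comes from the \<open>J\<close> coordinates, the other from the
      quadratic remainder over the distance \<open>\<kappa>' * \<delta>\<close>.\<close>
    define \<tau> where "\<tau> = (1 + \<kappa>'^2) * (\<omega> * \<delta>^2)"
    have \<tau>: "\<tau> > 0" unfolding \<tau>_def using k1 * \<delta> by simp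
    have \<tau>': "\<tau> ^ m' \<le> \<epsilon> * \<delta> ^ card I"
      using mult_left_mono[OF ***[OF \<delta>(1,3)], of "(1 + \<kappa>'^2) ^ m'"] k1
      unfolding \<tau>_def power_mult_distrib[of "1 + \<kappa>'^2"] by (simp add: less_imp_le)
    have "\<bar>f q \<bullet> c - f p \<bullet> c\<bar> \<le> \<tau>"
      if pq: "p \<in> S" "q \<in> S" "c \<in> Basis - J" and
        cl: "\<And>b. b \<in> J \<Longrightarrow> \<bar>f q \<bullet> b - f p \<bullet> b\<bar> \<le> \<eta>" "\<And>u. u \<in> I \<Longrightarrow> \<bar>q \<bullet> u - p \<bullet> u\<bar> \<le> \<delta>" for p q c
    proof -
      have "part_norm J (f q - f p) \<le> (\<Sum>b\<in>J. \<eta>)"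
        unfolding part_norm_def using cl(1) by (intro sum_mono) (simp add: inner_diff_left)
      also have "\<dots> \<le> r * \<eta>" unfolding r_def using \<eta> by simp
      finally have pn: "part_norm J (f q - f p) \<le> r * \<eta>" .
      have "(\<Sum>u\<in>I. \<bar>(q - p) \<bullet> u\<bar>) \<le> (\<Sum>u\<in>I. \<delta>)"
        using cl(2) by (intro sum_mono) (simp add: inner_diff_left)
      then have su: "(\<Sum>u\<in>I. \<bar>(q - p) \<bullet> u\<bar>) \<le> card I * \<delta>" by simp
      have "norm (q - p) \<le> \<kappa> * (part_norm J (f q - f p) + (\<Sum>u\<in>I. \<bar>(q - p) \<bullet> u\<bar>))"
        using chart pq by blast
      also have "\<dots> \<le> \<kappa> * (\<delta> + card I * \<delta>)"
        using pn \<eta>1 su \<kappa> by (intro mult_left_mono add_mono) auto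
      also have "\<dots> = \<kappa>' * \<delta>" unfolding \<kappa>'_def by (simp add: algebra_simps)
      finally have n: "norm (q - p) \<le> \<kappa>' * \<delta>" .
      have "\<bar>(f q - f p) \<bullet> c\<bar> \<le> B * part_norm J (f q - f p) + \<omega> * norm (q - p) ^ 2"
        using ** pq n \<delta> by (meson order_trans)
      also have "\<dots> \<le> \<omega> * \<delta>^2 + \<omega> * (\<kappa>' * \<delta>)^2"
      proof (intro add_mono mult_left_mono power_mono n)
        show "B * part_norm J (f q - f p) \<le> \<omega> * \<delta>^2"
          using \<eta>2 mult_left_mono[OF pn, of B] * by linarith
      qed (use * in auto)
      also have "\<dots> = \<tau>" unfolding \<tau>_def by (simp add: power_mult_distrib algebra_simps)
      finally show ?thesis by (simp add: inner_diff_left)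
    qed
    then show "\<exists>\<delta> \<eta> \<tau>. 0 < \<delta> \<and> \<delta> \<le> 1 \<and> 0 < \<eta> \<and> \<eta> \<le> 1 \<and> 0 < \<tau> \<and>
        \<tau> ^ card (Basis - J) \<le> \<epsilon> * \<delta> ^ card I \<and>
        (\<forall>p\<in>S. \<forall>q\<in>S. (\<forall>b\<in>J. \<bar>f q \<bullet> b - f p \<bullet> b\<bar> \<le> \<eta>) \<and> (\<forall>i\<in>I. \<bar>q \<bullet> i - p \<bullet> i\<bar> \<le> \<delta>) \<longrightarrow>
           (\<forall>c\<in>Basis - J. \<bar>f q \<bullet> c - f p \<bullet> c\<bar> \<le> \<tau>))"
      using \<delta>(1,2) \<eta> \<tau> \<tau>' unfolding m'_def
      by (intro exI[of _ \<delta>] exI[of _ \<eta>] exI[of _ \<tau>]) simp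
  qed
qed

section \<open>Images of the rank strata of a twice differentiable map\<close>

context C2_map
begin

text \<open>Both points vary, as is needed for comparing two points of one cell; this takes
  continuity of the derivative and not just differentiability at \<open>p0\<close>.\<close>

lemma strict_derivative:
  assumes "p0 \<in> W" "e > 0"
  obtains \<rho> where "\<rho> > 0" "ball p0 \<rho> \<subseteq> W"
    "\<And>p q. p \<in> ball p0 \<rho> \<Longrightarrow> q \<in> ball p0 \<rho> \<Longrightarrow> norm (f q - f p - D p0 (q - p)) \<le> e * norm (q - p)"
proof -
  obtain \<rho> where \<rho>: "\<rho> > 0" "ball p0 \<rho> \<subseteq> W"
    "\<And>p v. p \<in> ball p0 \<rho> \<Longrightarrow> norm (D p v - D p0 v) \<le> e * norm v"
    using D_near[OF assms] by metis
  show ?thesis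
  proof (rule that[OF \<rho>(1,2)])
    fix p q assume pq: "p \<in> ball p0 \<rho>" "q \<in> ball p0 \<rho>"
    have bl: "bounded_linear (D p0)" using D_linear assms(1) linear_conv_bounded_linear by blast
    have "norm ((f q - D p0 q) - (f p - D p0 p)) \<le> e * norm (q - p)"
    proof (rule differentiable_bound[OF convex_ball _ _ pq(2,1)])
      fix x assume x: "x \<in> ball p0 \<rho>"
      show "((\<lambda>q. f q - D p0 q) has_derivative (\<lambda>y. D x y - D p0 y)) (at x within ball p0 \<rho>)"
        using x \<rho>(2) by (intro has_derivative_diff has_derivative_at_withinI[OF D_deriv]
            bounded_linear_imp_has_derivative[OF bl]) auto
      show "onorm (\<lambda>y. D x y - D p0 y) \<le> e" using \<rho>(3)[OF x] by (rule onorm_le)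
    qed
    then show "norm (f q - f p - D p0 (q - p)) \<le> e * norm (q - p)"
      unfolding linear_diff[OF D_linear[OF assms(1)], of q p] by (simp add: algebra_simps)
  qed
qed

text \<open>Near \<open>p0\<close> the map \<open>D p\<close> stays injective on the complement
  \<open>?Q\<close> of the kernel at \<open>p0\<close>. If its rank is also \<open>card J\<close>,
  it maps \<open>?Q\<close> onto its whole range, which is then a graph over \<open>span J\<close>
  of slope at most \<open>e\<close>, with bounded preimages. The bound \<open>A\<close> comes before
  \<open>e\<close>, since callers choose \<open>e\<close> in terms of it.\<close>

lemma graph_estimate:
  assumes p0: "p0 \<in> W" and J: "J \<subseteq> Basis" and R: "range (D p0) = span J"
  obtains A where "A > 0" "\<And>e. e > 0 \<Longrightarrow> \<exists>\<rho>>0. ball p0 \<rho> \<subseteq> W \<and> (\<forall>p\<in>ball p0 \<rho>.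
      (\<forall>v. norm (D p v - D p0 v) \<le> e * norm v) \<and>
      (dim (range (D p)) = card J \<longrightarrow>
         (\<forall>x. \<exists>y. D p y = D p x \<and> norm y \<le> A * part_norm J (D p x)) \<and>
         (\<forall>x. \<forall>c\<in>Basis - J. \<bar>D p x \<bullet> c\<bar> \<le> e * part_norm J (D p x))))"
proof -
  let ?L = "D p0" and ?m = "real DIM('b)"
  let ?Q = "{y. \<forall>x\<in>{x. ?L x = 0}. orthogonal x y}"
  have L: "linear ?L" by (rule D_linear[OF p0])
  have subQ: "subspace ?Q"
    unfolding subspace_def by (auto simp: orthogonal_def inner_add_right)
  have m: "?m > 0" by simp
  obtain B C where B: "B \<subseteq> {x. ?L x = 0}" and C: "C > 0"
    "\<And>x. norm x \<le> C * (part_norm J (?L x) + (\<Sum>b\<in>B. \<bar>x \<bullet> b\<bar>))"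
    using kernel_norm_bound[OF L J] R by (metis order_refl)
  have CQ: "norm y \<le> C * part_norm J (?L y)" if "y \<in> ?Q" for y
  proof -
    have "(\<Sum>b\<in>B. \<bar>y \<bullet> b\<bar>) = 0"
      using that B by (intro sum.neutral) (auto simp: orthogonal_def inner_commute)
    then show ?thesis using C(2)[of y] by simp
  qed
  have dJ: "dim (span J) = card J"
    using independent_mono[OF independent_Basis J] by (rule dim_span_eq_card_independent)
  show ?thesis
  proof
    show "2 * C > 0" using C by simp
    fix e :: real assume e: "e > 0"
    \<comment> \<open>The second entry lets the perturbation be absorbed in half of
      \<open>norm y\<close>; the third turns the bound \<open>2 * C\<close> on preimages into the
      slope \<open>e\<close>.\<close>
    define e' where "e' = min e (min (1 / (2 * C * ?m)) (e / (2 * C)))"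
    have e': "e' > 0" "e' \<le> e" "e' \<le> 1 / (2 * C * ?m)" "e' \<le> e / (2 * C)"
      unfolding e'_def using e C m by auto
    have e'1: "C * (?m * e') \<le> 1/2" "e' * (2 * C) \<le> e"
      using e'(3,4) C m by (simp_all add: field_simps)
    obtain \<rho> where \<rho>: "\<rho> > 0" "ball p0 \<rho> \<subseteq> W"
      "\<And>p v. p \<in> ball p0 \<rho> \<Longrightarrow> norm (D p v - ?L v) \<le> e' * norm v"
      using D_near[OF p0 e'(1)] by metis
    have "(\<forall>x. \<exists>y. D p y = D p x \<and> norm y \<le> 2 * C * part_norm J (D p x)) \<and>
         (\<forall>x. \<forall>c\<in>Basis - J. \<bar>D p x \<bullet> c\<bar> \<le> e * part_norm J (D p x))"
      if p: "p \<in> ball p0 \<rho>" and dp: "dim (range (D p)) = card J" for p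
    proof -
      have lin: "linear (D p)" using D_linear p \<rho> by blast
      \<comment> \<open>As \<open>D p\<close> differs little from \<open>?L\<close>, the lower bound
        on the complement survives with half its strength.\<close>
      have bd: "norm y \<le> 2 * C * part_norm J (D p y)" if y: "y \<in> ?Q" for y
      proof -
        have "part_norm J (?L y) \<le> part_norm J (D p y) + ?m * (e' * norm y)"
          using part_norm_perturb[OF J, of "?L y" "D p y"] \<rho>(3)[OF p, of y] by (simp add: norm_minus_commute)
        then have "norm y \<le> C * (part_norm J (D p y) + ?m * (e' * norm y))"
          using CQ[OF y] C(1) by (meson mult_left_mono less_imp_le order_trans)
        also have "\<dots> = C * part_norm J (D p y) + (C * (?m * e')) * norm y" by (simp add: algebra_simps)
        also have "\<dots> \<le> C * part_norm J (D p y) + (1/2) * norm y"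
          using e'1 by (intro add_left_mono mult_right_mono) auto
        finally show ?thesis by simp
      qed
      have "inj_on (D p) ?Q"
      proof (rule inj_onI)
        fix x y assume xy: "x \<in> ?Q" "y \<in> ?Q" "D p x = D p y"
        have "x - y \<in> ?Q" using subQ xy by (simp only: subspace_diff)
        then have "norm (x - y) \<le> 2 * C * part_norm J (D p (x - y))" by (rule bd)
        then show "x = y" using xy by (simp add: linear_diff[OF lin] part_norm_def)
      qed
      then have "dim (D p ` ?Q) = dim ?Q"
        by (rule dim_image_inj_subspace[OF lin subQ])
      also have "\<dots> = dim (range (D p))"
        using dim_kernel_range(3)[OF L] R dJ dp by simp
      finally have im: "D p ` ?Q = range (D p)"
        using linear_subspace_image[OF lin] subQ subspace_UNIV
        by (intro subspace_dim_equal) auto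
      have ex: "\<exists>y\<in>?Q. D p y = D p x" for x
      proof -
        have "D p x \<in> D p ` ?Q" unfolding im by (rule rangeI)
        then show ?thesis by (rule imageE) (rule bexI, rule sym)
      qed
      have "\<exists>y. D p y = D p x \<and> norm y \<le> 2 * C * part_norm J (D p x)" for x
      proof -
        obtain y where y: "y \<in> ?Q" "D p y = D p x" using ex[of x] by (rule bexE)
        then show ?thesis using bd[OF y(1)] by (intro exI[of _ y]) simp
      qed
      moreover have "\<bar>D p x \<bullet> c\<bar> \<le> e * part_norm J (D p x)" if c: "c \<in> Basis - J" for x c
      proof -
        obtain y where y: "y \<in> ?Q" "D p y = D p x" using ex by blast
        have "?L y \<bullet> c = 0" using inner_span_Basis_zero[OF _ J c] R by blast
        then have "\<bar>D p y \<bullet> c\<bar> = \<bar>(D p y - ?L y) \<bullet> c\<bar>" by (simp add: inner_diff_left)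
        also have "\<dots> \<le> norm (D p y - ?L y)" using c by (intro Basis_le_norm) auto
        also have "\<dots> \<le> e' * norm y" by (rule \<rho>(3)[OF p])
        also have "\<dots> \<le> e' * (2 * C * part_norm J (D p y))"
          using bd[OF y(1)] e' by (intro mult_left_mono) auto
        also have "\<dots> \<le> e * part_norm J (D p y)"
          using mult_right_mono[OF e'1(2), of "part_norm J (D p y)"] by (simp add: mult.assoc)
        finally show ?thesis using y by simp
      qed
      ultimately show ?thesis by blast
    qed
    moreover have "norm (D p v - ?L v) \<le> e * norm v" if "p \<in> ball p0 \<rho>" for p v
      using \<rho>(3)[OF that, of v] e'(2) by (meson mult_right_mono norm_ge_zero order_trans)
    ultimately show "\<exists>\<rho>>0. ball p0 \<rho> \<subseteq> W \<and> (\<forall>p\<in>ball p0 \<rho>.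
      (\<forall>v. norm (D p v - D p0 v) \<le> e * norm v) \<and>
      (dim (range (D p)) = card J \<longrightarrow>
         (\<forall>x. \<exists>y. D p y = D p x \<and> norm y \<le> 2 * C * part_norm J (D p x)) \<and>
         (\<forall>x. \<forall>c\<in>Basis - J. \<bar>D p x \<bullet> c\<bar> \<le> e * part_norm J (D p x))))"
      using \<rho>(1,2) by blast
  qed
qed

text \<open>If the \<open>J\<close> coordinates of the derivative together with \<open>n\<close>
  control the norm, so do the increments of \<open>f\<close> at double the constant: the strict
  derivative error is absorbed in half of \<open>norm (q - p)\<close>.\<close>

lemma chart_estimate:
  assumes p0: "p0 \<in> W" and J: "J \<subseteq> Basis" and C: "C > 0"
    and N: "\<And>x. norm x \<le> C * (part_norm J (D p0 x) + n x)"
  obtains \<rho> where "\<rho> > 0" "ball p0 \<rho> \<subseteq> W"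
    "\<And>p q. p \<in> ball p0 \<rho> \<Longrightarrow> q \<in> ball p0 \<rho> \<Longrightarrow>
       norm (q - p) \<le> 2 * C * (part_norm J (f q - f p) + n (q - p))"
proof -
  let ?m = "real DIM('b)"
  have e: "1 / (2 * C * ?m) > 0" using C by simp
  obtain \<rho> where \<rho>: "\<rho> > 0" "ball p0 \<rho> \<subseteq> W"
    "\<And>p q. p \<in> ball p0 \<rho> \<Longrightarrow> q \<in> ball p0 \<rho> \<Longrightarrow>
       norm (f q - f p - D p0 (q - p)) \<le> 1 / (2 * C * ?m) * norm (q - p)"
    using strict_derivative[OF p0 e] by metis
  show ?thesis
  proof (rule that[OF \<rho>(1,2)])
    fix p q assume pq: "p \<in> ball p0 \<rho>" "q \<in> ball p0 \<rho>"
    have "part_norm J (D p0 (q - p)) \<le> part_norm J (f q - f p) + ?m * (1 / (2 * C * ?m) * norm (q - p))"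
      by (rule part_norm_perturb[OF J]) (use \<rho>(3)[OF pq] in \<open>simp only: norm_minus_commute\<close>)
    then have "norm (q - p) \<le> C * ((part_norm J (f q - f p) + ?m * (1 / (2 * C * ?m) * norm (q - p))) + n (q - p))"
      using N[of "q - p"] C by (smt (verit) mult_left_mono)
    also have "\<dots> = C * (part_norm J (f q - f p) + n (q - p)) + norm (q - p) / 2"
      using C by (simp add: field_simps)
    finally show "norm (q - p) \<le> 2 * C * (part_norm J (f q - f p) + n (q - p))" by simp
  qed
qed

definition rank_stratum where "rank_stratum r = {p \<in> W. dim (range (D p)) = r}"

text \<open>The condition says that the intrinsic quadratic form from the kernel of
  \<open>D p\<close> to its cokernel vanishes. Being stated modulo the range, it survives linear
  isomorphisms of the target.\<close>

definition flat_stratum where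
  "flat_stratum r = {p \<in> rank_stratum r. \<forall>w. D p w = 0 \<longrightarrow> D2 p w w \<in> range (D p)}"

lemma bounded_image_near:
  assumes "cball p0 R \<subseteq> W" "S \<subseteq> cball p0 R"
  shows "bounded S" "bounded (f ` S)"
proof -
  show "bounded S" using assms(2) bounded_cball bounded_subset by blast
  have "continuous_on (cball p0 R) f"
    using Ck_on_continuous[OF C2] assms(1) continuous_on_subset by blast
  then have "bounded (f ` cball p0 R)"
    by (intro compact_imp_bounded compact_continuous_image) auto
  then show "bounded (f ` S)" using assms(2) by (meson bounded_subset image_mono)
qed

text \<open>If the corank is at least two, the second order remainder alone beats the number of cells.\<close>

lemma negligible_low_rank:
  assumes p0: "p0 \<in> W" and J: "J \<subseteq> Basis" and R: "range (D p0) = span J"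
    and dims: "DIM('a) = DIM('b) + 1" "card J + 2 \<le> DIM('b)"
  shows "\<exists>\<rho>>0. negligible (f ` (rank_stratum (card J) \<inter> ball p0 \<rho>))"
proof -
  let ?m = "real DIM('b)"
  have dJ: "dim (range (D p0)) = card J"
    unfolding R using independent_mono[OF independent_Basis J] by (rule dim_span_eq_card_independent)
  obtain R0 where R0: "R0 > 0" "cball p0 R0 \<subseteq> W" using W p0 open_contains_cball by blast
  obtain C where C: "C > 0"
    "\<And>p q. p \<in> cball p0 R0 \<Longrightarrow> q \<in> cball p0 R0 \<Longrightarrow> norm (f q - f p - D p (q - p)) \<le> C * norm (q - p) ^ 2"
    using D_Lipschitz[OF R0(2)] by metis
  obtain K C1 where K: "finite K" "card K + card J = DIM('a)" "C1 > 0"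
    "\<And>x. norm x \<le> C1 * (part_norm J (D p0 x) + (\<Sum>b\<in>K. \<bar>x \<bullet> b\<bar>))"
    using kernel_norm_bound[OF D_linear[OF p0] J] R dJ by (metis order_refl)
  obtain \<rho>1 where \<rho>1: "\<rho>1 > 0"
    "\<And>p q. p \<in> ball p0 \<rho>1 \<Longrightarrow> q \<in> ball p0 \<rho>1 \<Longrightarrow>
       norm (q - p) \<le> 2 * C1 * (part_norm J (f q - f p) + (\<Sum>b\<in>K. \<bar>(q - p) \<bullet> b\<bar>))"
    using chart_estimate[OF p0 J K(3,4)] by metis
  obtain \<rho>2 where \<rho>2: "\<rho>2 > 0"
    "\<And>p x c. p \<in> ball p0 \<rho>2 \<Longrightarrow> dim (range (D p)) = card J \<Longrightarrow> c \<in> Basis - J \<Longrightarrow>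
       \<bar>D p x \<bullet> c\<bar> \<le> 1 * part_norm J (D p x)"
    using graph_estimate[OF p0 J R] by (metis zero_less_one)
  define \<rho> where "\<rho> = min R0 (min \<rho>1 \<rho>2)"
  have \<rho>: "\<rho> > 0" "ball p0 \<rho> \<subseteq> cball p0 R0" "ball p0 \<rho> \<subseteq> ball p0 \<rho>1" "ball p0 \<rho> \<subseteq> ball p0 \<rho>2"
    unfolding \<rho>_def using R0 \<rho>1 \<rho>2 by auto
  let ?S = "rank_stratum (card J) \<inter> ball p0 \<rho>"
  define \<omega> where "\<omega> = (?m + 1) * C"
  have \<omega>: "\<omega> > 0" unfolding \<omega>_def using C by (simp add: add_pos_pos)
  have est: "\<bar>(f q - f p) \<bullet> c\<bar> \<le> 1 * part_norm J (f q - f p) + \<omega> * norm (q - p) ^ 2"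
    if pq: "p \<in> ?S" "q \<in> ?S" "c \<in> Basis - J" for p q c
  proof -
    let ?z = "f q - f p" and ?d = "D p (q - p)"
    have E: "norm (?z - ?d) \<le> C * norm (q - p) ^ 2" using C(2) pq \<rho> by blast
    \<comment> \<open>On the stratum the range of \<open>D p\<close> is a graph of slope at most 1
      over \<open>span J\<close>.\<close>
    have "\<bar>?d \<bullet> c\<bar> \<le> part_norm J ?d"
      using \<rho>2(2)[of p c "q - p"] pq \<rho> unfolding rank_stratum_def by auto
    then show ?thesis using graph_bound_perturb[OF J, of c ?d ?z, OF _ _ E] pq unfolding \<omega>_def by (simp add: mult.assoc)
  qed
  have "negligible (f ` ?S)"
  proof (rule negligible_image_quadratic[where J = J and I = K and \<kappa> = "2 * C1"])
    show "bounded ?S" "bounded (f ` ?S)" using bounded_image_near[OF R0(2), of ?S] \<rho>(2) by blast+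
    show "2 * C1 > 0" using K by simp
    show "norm (q - p) \<le> 2 * C1 * (part_norm J (f q - f p) + (\<Sum>u\<in>K. \<bar>(q - p) \<bullet> u\<bar>))"
      if "p \<in> ?S" "q \<in> ?S" for p q using \<rho>1(2) that \<rho>(3) by blast
    fix \<epsilon> :: real assume \<epsilon>: "\<epsilon> > 0"
    define m' where "m' = card (Basis - J)"
    have m': "m' = DIM('b) - card J"
      unfolding m'_def using J by (simp add: card_Diff_subset finite_subset)
    \<comment> \<open>The corank is \<open>m'\<close> and the kernel has one dimension more. Writing
      \<open>2 * m' = (m' - 1) + (m' + 1)\<close> leaves a spare factor
      \<open>\<delta> ^ (m' - 1)\<close>, which is small because \<open>m' \<ge> 2\<close>.\<close>
    have cK: "card K = m' + 1" "m' \<ge> 2" using K(2) dims m' by auto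
    have "(\<omega> * \<delta> ^ 2) ^ m' \<le> \<epsilon> * \<delta> ^ card K"
      if \<delta>: "0 < \<delta>" "\<delta> < min 1 (\<epsilon> / \<omega> ^ m')" for \<delta>
    proof -
      have "\<omega> ^ m' * \<delta> ^ (m' - 1) \<le> \<omega> ^ m' * \<delta> ^ 1"
        using \<delta> \<omega> cK by (intro mult_left_mono power_decreasing) auto
      also have "\<dots> \<le> \<epsilon>" using \<delta> \<omega> by (simp add: field_simps)
      finally have "\<omega> ^ m' * \<delta> ^ (m' - 1) * \<delta> ^ (m' + 1) \<le> \<epsilon> * \<delta> ^ (m' + 1)"
        using \<delta> by (intro mult_right_mono) auto
      moreover have "(\<omega> * \<delta> ^ 2) ^ m' = \<omega> ^ m' * \<delta> ^ (m' - 1) * \<delta> ^ (m' + 1)"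
      proof -
        have "2 * m' = (m' - 1) + (m' + 1)" using cK(2) by simp
        then have "(\<delta> ^ 2) ^ m' = \<delta> ^ (m' - 1) * \<delta> ^ (m' + 1)"
          by (simp only: power_mult[symmetric] power_add[symmetric])
        then show ?thesis by (simp add: power_mult_distrib mult.assoc)
      qed
      ultimately show ?thesis using cK(1) by simp
    qed
    then show "\<exists>\<rho> \<omega> B. \<rho> > 0 \<and> \<omega> > 0 \<and> B > 0 \<and>
        (\<forall>p\<in>?S. \<forall>q\<in>?S. norm (q - p) \<le> \<rho> \<longrightarrow>
           (\<forall>c\<in>Basis - J. \<bar>(f q - f p) \<bullet> c\<bar> \<le> B * part_norm J (f q - f p) + \<omega> * norm (q - p) ^ 2)) \<and>
        (\<forall>\<delta>. 0 < \<delta> \<and> \<delta> < \<rho> \<longrightarrow> (\<omega> * \<delta> ^ 2) ^ card (Basis - J) \<le> \<epsilon> * \<delta> ^ card K)"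
      using est \<omega> \<epsilon> unfolding m'_def[symmetric]
      by (intro exI[of _ "min 1 (\<epsilon> / \<omega> ^ m')"] exI[of _ \<omega>] exI[of _ 1] conjI ballI allI impI) auto
  qed (use J K in auto)
  then show ?thesis using \<rho>(1) by blast
qed

text \<open>In corank one, a nonzero second derivative on the kernel confines the stratum to
  a hypersurface, which saves one direction of cells.\<close>

lemma negligible_nonflat:
  assumes p0: "p0 \<in> W" and J: "J \<subseteq> Basis" and R: "range (D p0) = span J"
    and dims: "DIM('a) = DIM('b) + 1" "card J + 1 = DIM('b)"
    and w: "D p0 w = 0" "D2 p0 w w \<notin> span J"
  shows "\<exists>\<rho>>0. negligible (f ` (rank_stratum (card J) \<inter> ball p0 \<rho>))"
proof -
  let ?m = "real DIM('b)" and ?L = "D p0"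
  have L: "linear ?L" by (rule D_linear[OF p0])
  have dJ: "dim (range ?L) = card J"
    unfolding R using independent_mono[OF independent_Basis J] by (rule dim_span_eq_card_independent)
  have cc: "card (Basis - J) = 1"
    using J dims(2) by (simp add: card_Diff_subset finite_subset)
  then obtain c where c: "Basis - J = {c}" using card_1_singletonE by blast
  have cB: "c \<in> Basis" using c by blast
  \<comment> \<open>\<open>g\<close> is the differential at \<open>p0\<close> of the coordinate
    \<open>c\<close> of \<open>D p w\<close>. Constant rank will force it to be small on differences
    of points of the stratum, so cells are needed only for the directions in \<open>?K'\<close>, of
    which there is at most one.\<close>
  define g where "g x = D2 p0 x w \<bullet> c" for x
  have ling: "linear g"
    unfolding g_def using linear_compose[OF D2_linear[OF p0] bounded_linear.linear[OF bounded_linear_inner_left]]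
    by (simp add: o_def)
  have gw: "g w \<noteq> 0" using in_span_Basis_if[of J "D2 p0 w w"] w(2) J c unfolding g_def by auto
  have w0: "norm w > 0" using gw linear_0[OF ling] by auto
  let ?K = "{x. ?L x = 0}" and ?K' = "{x. ?L x = 0 \<and> g x = 0}"
  have subK': "subspace ?K'"
    unfolding subspace_def by (auto simp: linear_add[OF L] linear_add[OF ling] linear_cmul[OF L] linear_cmul[OF ling]
        linear_0[OF L] linear_0[OF ling])
  have "?K' \<subset> ?K" using gw w(1) by blast
  then have "dim ?K' < dim ?K"
    using dim_psubset[of ?K' ?K] subK' kernel_subspace[OF L] by (metis span_eq_iff)
  then have dK': "dim ?K' \<le> 1" using dim_kernel_range(1)[OF L] dJ dims by linarith
  obtain B where B: "B \<subseteq> ?K'" "independent B" "card B = dim ?K'" "span B = ?K'"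
    by (rule orthonormal_basis_subspace[OF subK']) (rule that; assumption)
  have finB: "finite B" using B(2) independent_imp_finite by blast
  \<comment> \<open>As in \<open>kernel_norm_bound\<close>, with \<open>g\<close> replacing one
    direction of the kernel.\<close>
  define N where "N x = part_norm J (?L x) + (\<bar>g x\<bar> + (\<Sum>b\<in>B. \<bar>x \<bullet> b\<bar>))" for x
  have "continuous_on UNIV N"
    unfolding N_def
    by (intro continuous_intros continuous_part_norm linear_continuous_on)
      (use L ling linear_conv_bounded_linear in blast)+
  moreover have "N (t *\<^sub>R x) = \<bar>t\<bar> * N x" for t x
    unfolding N_def by (simp add: linear_cmul[OF L] linear_cmul[OF ling] part_norm_scaleR abs_mult
        sum_distrib_left algebra_simps)
  moreover have "N x > 0" if "x \<noteq> 0" for x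
  proof (rule ccontr)
    assume *: "\<not> N x > 0"
    have "(\<Sum>b\<in>B. \<bar>x \<bullet> b\<bar>) \<ge> 0" by (simp add: sum_nonneg)
    then have 0: "part_norm J (?L x) = 0" "g x = 0" "(\<Sum>b\<in>B. \<bar>x \<bullet> b\<bar>) = 0"
      using * part_norm_nonneg[of J "?L x"] abs_ge_zero[of "g x"] unfolding N_def by linarith+
    have "norm (?L x) \<le> 0" using norm_le_part_norm[of "?L x" J] J R 0(1) by auto
    then have "x \<in> span B" using B(4) 0(2) by auto
    moreover have "\<forall>b\<in>B. orthogonal x b" using 0(3) finB by (simp add: sum_nonneg_eq_0_iff orthogonal_def)
    ultimately have "orthogonal x x" using orthogonal_to_span by blast
    then show False using that by (simp add: orthogonal_def)
  qed
  ultimately obtain C1 where C1: "C1 > 0" "\<And>x. norm x \<le> C1 * N x"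
    using homogeneous_positive_bound[of N] by blast
  obtain R0 where R0: "R0 > 0" "cball p0 R0 \<subseteq> W" using W p0 open_contains_cball by blast
  obtain C where C: "C > 0"
    "\<And>p q v. p \<in> cball p0 R0 \<Longrightarrow> q \<in> cball p0 R0 \<Longrightarrow> norm (D q v - D p v) \<le> C * norm (q - p) * norm v"
    "\<And>p q. p \<in> cball p0 R0 \<Longrightarrow> q \<in> cball p0 R0 \<Longrightarrow> norm (f q - f p - D p (q - p)) \<le> C * norm (q - p) ^ 2"
    using D_Lipschitz[OF R0(2)] by metis
  obtain A where A: "A > 0" "\<And>e. e > 0 \<Longrightarrow> \<exists>\<rho>>0. ball p0 \<rho> \<subseteq> W \<and> (\<forall>p\<in>ball p0 \<rho>.
      (\<forall>v. norm (D p v - ?L v) \<le> e * norm v) \<and>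
      (dim (range (D p)) = card J \<longrightarrow>
         (\<forall>x. \<exists>y. D p y = D p x \<and> norm y \<le> A * part_norm J (D p x)) \<and>
         (\<forall>x. \<forall>c\<in>Basis - J. \<bar>D p x \<bullet> c\<bar> \<le> e * part_norm J (D p x))))"
    using graph_estimate[OF p0 J R] by metis
  \<comment> \<open>\<open>H\<close> collects the coefficients of the final bound for
    \<open>g x\<close>; \<open>e\<close> is then so small that this error and that of
    \<open>part_norm\<close> are absorbed in half of \<open>norm x\<close>.\<close>
  define H where "H = norm w * (?m * C * (1 + A * ?m) + C * A * ?m + 2)"
  have H: "H > 0" unfolding H_def using w0 C(1) A(1) by (intro mult_pos_pos add_pos_pos) auto
  define e where "e = min 1 (1 / (4 * C1 * (H + ?m)))"
  have e: "e > 0" "e \<le> 1" "C1 * (e * (H + ?m)) \<le> 1 / 2"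
  proof -
    have pos: "4 * C1 * (H + ?m) > 0" using C1 H by simp
    then show "e > 0" "e \<le> 1" unfolding e_def by auto
    have "e \<le> 1 / (4 * C1 * (H + ?m))" unfolding e_def by simp
    then have "e * (4 * C1 * (H + ?m)) \<le> 1"
      using pos by (simp only: pos_le_divide_eq)
    moreover have "e * (4 * C1 * (H + ?m)) = 4 * (C1 * (e * (H + ?m)))" by (simp add: algebra_simps)
    ultimately show "C1 * (e * (H + ?m)) \<le> 1 / 2" by linarith
  qed
  obtain \<rho>1 where \<rho>1: "\<rho>1 > 0"
    "\<And>p v. p \<in> ball p0 \<rho>1 \<Longrightarrow> norm (D p v - ?L v) \<le> e * norm v"
    "\<And>p x. p \<in> ball p0 \<rho>1 \<Longrightarrow> dim (range (D p)) = card J \<Longrightarrow>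
        \<exists>y. D p y = D p x \<and> norm y \<le> A * part_norm J (D p x)"
    "\<And>p x. p \<in> ball p0 \<rho>1 \<Longrightarrow> dim (range (D p)) = card J \<Longrightarrow>
        \<bar>D p x \<bullet> c\<bar> \<le> e * part_norm J (D p x)"
    using A(2)[OF e(1)] c by blast
  obtain \<rho>2 where \<rho>2: "\<rho>2 > 0"
    "\<And>p q v. p \<in> cball p0 R0 \<Longrightarrow> q \<in> cball p0 R0 \<Longrightarrow> norm (q - p) \<le> \<rho>2 \<Longrightarrow>
      norm (D q v - D p v - D2 p (q - p) v) \<le> e * norm (q - p) * norm v"
    using Taylor_uniform[OF R0(2) e(1)] by metis
  obtain \<rho>3 where \<rho>3: "\<rho>3 > 0"
    "\<And>p q x v. p \<in> cball p0 R0 \<Longrightarrow> q \<in> cball p0 R0 \<Longrightarrow> norm (q - p) \<le> \<rho>3 \<Longrightarrow>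
      norm (D2 q x v - D2 p x v) \<le> e * norm x * norm v"
    using D2_uniform[OF R0(2) e(1)] by metis
  obtain \<rho>4 where \<rho>4: "\<rho>4 > 0"
    "\<And>p q. p \<in> ball p0 \<rho>4 \<Longrightarrow> q \<in> ball p0 \<rho>4 \<Longrightarrow> norm (f q - f p - ?L (q - p)) \<le> e * norm (q - p)"
    using strict_derivative[OF p0 e(1)] by metis
  \<comment> \<open>Half of \<rho>2, since two points of the ball may lie on opposite sides of
    \<open>p0\<close>.\<close>
  define \<rho> where "\<rho> = min (min R0 \<rho>1) (min (min (\<rho>2 / 2) \<rho>3) \<rho>4)"
  have \<rho>: "\<rho> > 0" "\<rho> \<le> R0" "\<rho> \<le> \<rho>1" "\<rho> \<le> \<rho>2 / 2" "\<rho> \<le> \<rho>3" "\<rho> \<le> \<rho>4"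
    unfolding \<rho>_def using R0 \<rho>1 \<rho>2 \<rho>3 \<rho>4 by auto
  let ?S = "rank_stratum (card J) \<inter> ball p0 \<rho>"
  have chart: "norm (q - p) \<le> 2 * C1 * (part_norm J (f q - f p) + (\<Sum>u\<in>B. \<bar>(q - p) \<bullet> u\<bar>))"
    if pq: "p \<in> ?S" "q \<in> ?S" for p q
  proof -
    define x where "x = q - p"
    have rk: "dim (range (D p)) = card J" "dim (range (D q)) = card J"
      using pq unfolding rank_stratum_def by auto
    have b0: "p \<in> cball p0 R0" "q \<in> cball p0 R0" "p0 \<in> cball p0 R0" using pq \<rho> R0 by auto
    have b1: "p \<in> ball p0 \<rho>1" "q \<in> ball p0 \<rho>1" "p \<in> ball p0 \<rho>4" "q \<in> ball p0 \<rho>4" using pq \<rho> by auto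
    have b2: "norm (q - p) \<le> \<rho>2"
      using norm_triangle_ineq4[of "q - p0" "p - p0"] pq \<rho> by (simp add: dist_norm norm_minus_commute)
    have b3: "norm (p - p0) \<le> \<rho>3" using pq \<rho> by (simp add: dist_norm norm_minus_commute)
    have lin: "linear (D p)" "linear (D q)" using D_linear b0 R0 by blast+
    \<comment> \<open>\<open>w\<close> is in the kernel at \<open>p0\<close> only. The correction
      \<open>y\<close>, small because \<open>D q w\<close> is, turns it into the vector
      \<open>k\<close> in the kernel at \<open>q\<close>.\<close>
    obtain y where y: "D q y = D q w" "norm y \<le> A * part_norm J (D q w)" using \<rho>1(3)[OF b1(2) rk(2)] by blast
    have "norm (D q w) \<le> e * norm w" using \<rho>1(2)[OF b1(2), of w] w(1) by simp
    then have "part_norm J (D q w) \<le> ?m * (e * norm w)"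
      using part_norm_le[OF J, of "D q w"] by (meson mult_left_mono of_nat_0_le_iff order_trans)
    then have ny: "norm y \<le> A * (?m * (e * norm w))"
      using y(2) A(1) by (meson mult_left_mono less_imp_le order_trans)
    define k where "k = w - y"
    have "A * (?m * (e * norm w)) \<le> A * (?m * (1 * norm w))"
      using e A(1) by (intro mult_left_mono mult_right_mono) auto
    then have "norm y \<le> A * (?m * (1 * norm w))" using ny by linarith
    then have nk: "norm k \<le> (1 + A * ?m) * norm w"
      using norm_triangle_ineq4[of w y] unfolding k_def by (simp add: algebra_simps)
    have Dqk: "D q k = 0" unfolding k_def using y(1) by (simp add: linear_diff[OF lin(2)])
    \<comment> \<open>\<open>D p k\<close> is of order \<open>norm x\<close> because
      \<open>D q k\<close> vanishes, and its coordinate \<open>c\<close> gains a further factor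
      \<open>e\<close> because the range of \<open>D p\<close> is nearly
      \<open>span J\<close>.\<close>
    have "norm (D p k) \<le> C * norm x * norm k"
      using C(2)[OF b0(1,2), of k] Dqk unfolding x_def by simp
    then have "part_norm J (D p k) \<le> ?m * (C * norm x * norm k)"
      using part_norm_le[OF J, of "D p k"] by (meson mult_left_mono of_nat_0_le_iff order_trans)
    then have pk: "\<bar>D p k \<bullet> c\<bar> \<le> e * (?m * (C * norm x * norm k))"
      using \<rho>1(4)[OF b1(1) rk(1), of k] e by (meson mult_left_mono less_imp_le order_trans)
    have "norm (D q w - D p w - D2 p0 x w) \<le> norm (D q w - D p w - D2 p x w) + norm (D2 p x w - D2 p0 x w)"
      using norm_triangle_ineq[of "D q w - D p w - D2 p x w" "D2 p x w - D2 p0 x w"] by simp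
    also have "\<dots> \<le> e * norm x * norm w + e * norm x * norm w"
      using \<rho>2(2)[OF b0(1,2) b2, of w] \<rho>3(2)[OF b0(3,1) b3, of x w] unfolding x_def by (intro add_mono)
    finally have T: "\<bar>(D q w - D p w - D2 p0 x w) \<bullet> c\<bar> \<le> 2 * (e * norm x * norm w)"
      using Basis_le_norm[OF cB, of "D q w - D p w - D2 p0 x w"] by linarith
    have Y: "\<bar>(D q y - D p y) \<bullet> c\<bar> \<le> C * norm x * norm y"
      using C(2)[OF b0(1,2), of y] Basis_le_norm[OF cB, of "D q y - D p y"] unfolding x_def by simp
    \<comment> \<open>By \<open>D q k = 0\<close> this is an exact identity. Its three terms are the
      Taylor error for \<open>w\<close>, the variation of \<open>D\<close> on the small
      \<open>y\<close>, and the quantity bounded in \<open>pk\<close>.\<close>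
    have "g x = - ((D q w - D p w - D2 p0 x w) \<bullet> c) + (D q y - D p y) \<bullet> c - D p k \<bullet> c"
      using Dqk unfolding g_def k_def
      by (simp add: linear_diff[OF lin(1)] linear_diff[OF lin(2)] inner_diff_left algebra_simps)
    then have "\<bar>g x\<bar> \<le> 2 * (e * norm x * norm w) + C * norm x * norm y + e * (?m * (C * norm x * norm k))"
      using T Y pk unfolding abs_le_iff by linarith
    also have "\<dots> \<le> 2 * (e * norm x * norm w) + C * norm x * (A * (?m * (e * norm w)))
        + e * (?m * (C * norm x * ((1 + A * ?m) * norm w)))"
      using ny nk C(1) e A(1) by (intro add_mono mult_left_mono order_refl) auto
    also have "\<dots> = e * H * norm x" unfolding H_def by (simp add: algebra_simps)
    finally have gx: "\<bar>g x\<bar> \<le> e * H * norm x" .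
    have "part_norm J (?L x) \<le> part_norm J (f q - f p) + ?m * (e * norm x)"
      unfolding x_def
      by (rule part_norm_perturb[OF J]) (use \<rho>4(2)[OF b1(3,4)] in \<open>simp only: norm_minus_commute\<close>)
    then have "N x \<le> part_norm J (f q - f p) + ?m * (e * norm x) + (e * H * norm x + (\<Sum>u\<in>B. \<bar>x \<bullet> u\<bar>))"
      unfolding N_def using gx by linarith
    then have "norm x \<le> C1 * (part_norm J (f q - f p) + ?m * (e * norm x) + (e * H * norm x + (\<Sum>u\<in>B. \<bar>x \<bullet> u\<bar>)))"
      using C1 by (meson mult_left_mono less_imp_le order_trans)
    also have "\<dots> = C1 * (part_norm J (f q - f p) + (\<Sum>u\<in>B. \<bar>x \<bullet> u\<bar>)) + C1 * (e * (H + ?m)) * norm x"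
      by (simp add: algebra_simps)
    also have "\<dots> \<le> C1 * (part_norm J (f q - f p) + (\<Sum>u\<in>B. \<bar>x \<bullet> u\<bar>)) + 1/2 * norm x"
      using e(3) by (intro add_left_mono mult_right_mono) auto
    finally show ?thesis unfolding x_def by simp
  qed
  define \<omega> where "\<omega> = (?m + 1) * C"
  have \<omega>: "\<omega> > 0" unfolding \<omega>_def using C by (simp add: add_pos_pos)
  have est: "\<bar>(f q - f p) \<bullet> c\<bar> \<le> 1 * part_norm J (f q - f p) + \<omega> * norm (q - p) ^ 2"
    if pq: "p \<in> ?S" "q \<in> ?S" for p q
  proof -
    let ?z = "f q - f p" and ?d = "D p (q - p)"
    have b0: "p \<in> cball p0 R0" "q \<in> cball p0 R0" "p \<in> ball p0 \<rho>1" using pq \<rho> R0 by auto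
    have rk: "dim (range (D p)) = card J" using pq unfolding rank_stratum_def by auto
    have E: "norm (?z - ?d) \<le> C * norm (q - p) ^ 2" using C(3) b0 by blast
    have "e * part_norm J ?d \<le> part_norm J ?d"
      using e by (simp add: mult_left_le_one_le)
    then have "\<bar>?d \<bullet> c\<bar> \<le> part_norm J ?d" using \<rho>1(4)[OF b0(3) rk, of "q - p"] by linarith
    then show ?thesis using graph_bound_perturb[OF J cB, of ?d ?z, OF _ E] unfolding \<omega>_def by (simp add: mult.assoc)
  qed
  have "negligible (f ` ?S)"
  proof (rule negligible_image_quadratic[where J = J and I = B and \<kappa> = "2 * C1"])
    have "?S \<subseteq> cball p0 R0" using \<rho> by auto
    then show "bounded ?S" "bounded (f ` ?S)" using bounded_image_near[OF R0(2), of ?S] by blast+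
    fix \<epsilon> :: real assume \<epsilon>: "\<epsilon> > 0"
    have "(\<omega> * \<delta> ^ 2) ^ card (Basis - J) \<le> \<epsilon> * \<delta> ^ card B"
      if \<delta>: "0 < \<delta>" "\<delta> < min 1 (\<epsilon> / \<omega>)" for \<delta>
    proof -
      \<comment> \<open>With at most one direction of cells left, \<delta>^2 has to beat no more
        than \<delta>.\<close>
      have "\<omega> * \<delta> ^ 2 = (\<omega> * \<delta>) * \<delta>" by (simp add: power2_eq_square)
      also have "\<dots> \<le> \<epsilon> * \<delta>" using \<delta> \<omega> by (intro mult_right_mono) (auto simp: field_simps)
      also have "\<dots> \<le> \<epsilon> * \<delta> ^ card B"
        using \<delta> \<epsilon> dK' B(3) power_decreasing[of "card B" 1 \<delta>] by (intro mult_left_mono) auto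
      finally show ?thesis unfolding cc by simp
    qed
    then show "\<exists>\<rho> \<omega> B'. \<rho> > 0 \<and> \<omega> > 0 \<and> B' > 0 \<and>
        (\<forall>p\<in>?S. \<forall>q\<in>?S. norm (q - p) \<le> \<rho> \<longrightarrow>
           (\<forall>c\<in>Basis - J. \<bar>(f q - f p) \<bullet> c\<bar> \<le> B' * part_norm J (f q - f p) + \<omega> * norm (q - p) ^ 2)) \<and>
        (\<forall>\<delta>. 0 < \<delta> \<and> \<delta> < \<rho> \<longrightarrow> (\<omega> * \<delta> ^ 2) ^ card (Basis - J) \<le> \<epsilon> * \<delta> ^ card B)"
      using est \<omega> \<epsilon> unfolding c
      by (intro exI[of _ "min 1 (\<epsilon> / \<omega>)"] exI[of _ \<omega>] exI[of _ 1] conjI ballI allI impI) auto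
  qed (use J finB C1 chart in auto)
  then show ?thesis using \<rho>(1) by blast
qed

text \<open>Here the quadratic Taylor polynomial stays in the range of the derivative up to a small
  error, so that the remainder is of the order of the square of the mesh with a small factor.\<close>

lemma negligible_flat:
  assumes p0: "p0 \<in> W" and J: "J \<subseteq> Basis" and R: "range (D p0) = span J"
    and dims: "DIM('a) = DIM('b) + 1" "card J + 1 = DIM('b)"
  shows "\<exists>\<rho>>0. negligible (f ` (flat_stratum (card J) \<inter> ball p0 \<rho>))"
proof -
  let ?m = "real DIM('b)" and ?L = "D p0"
  have L: "linear ?L" by (rule D_linear[OF p0])
  have dJ: "dim (range ?L) = card J"
    unfolding R using independent_mono[OF independent_Basis J] by (rule dim_span_eq_card_independent)
  have cc: "card (Basis - J) = 1"
    using J dims(2) by (simp add: card_Diff_subset finite_subset)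
  then obtain c where c: "Basis - J = {c}" using card_1_singletonE by blast
  have cB: "c \<in> Basis" using c by blast
  obtain R0 where R0: "R0 > 0" "cball p0 R0 \<subseteq> W" using W p0 open_contains_cball by blast
  obtain C where C: "C > 0"
    "\<And>p q. p \<in> cball p0 R0 \<Longrightarrow> q \<in> cball p0 R0 \<Longrightarrow> norm (f q - f p - D p (q - p)) \<le> C * norm (q - p) ^ 2"
    using D_Lipschitz[OF R0(2)] by metis
  obtain C2 where C2: "C2 > 0"
    "\<And>p x v. p \<in> cball p0 R0 \<Longrightarrow> norm (D2 p x v) \<le> C2 * norm x * norm v"
    using D2_bounded[OF R0(2)] by metis
  obtain K C1 where K: "finite K" "card K + card J = DIM('a)" "C1 > 0"
    "\<And>x. norm x \<le> C1 * (part_norm J (?L x) + (\<Sum>b\<in>K. \<bar>x \<bullet> b\<bar>))"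
    using kernel_norm_bound[OF L J] R dJ by (metis order_refl)
  obtain \<rho>1 where \<rho>1: "\<rho>1 > 0"
    "\<And>p q. p \<in> ball p0 \<rho>1 \<Longrightarrow> q \<in> ball p0 \<rho>1 \<Longrightarrow>
       norm (q - p) \<le> 2 * C1 * (part_norm J (f q - f p) + (\<Sum>b\<in>K. \<bar>(q - p) \<bullet> b\<bar>))"
    using chart_estimate[OF p0 J K(3,4)] by metis
  obtain A where A: "A > 0" "\<And>e. e > 0 \<Longrightarrow> \<exists>\<rho>>0. ball p0 \<rho> \<subseteq> W \<and> (\<forall>p\<in>ball p0 \<rho>.
      (\<forall>v. norm (D p v - ?L v) \<le> e * norm v) \<and>
      (dim (range (D p)) = card J \<longrightarrow>
         (\<forall>x. \<exists>y. D p y = D p x \<and> norm y \<le> A * part_norm J (D p x)) \<and>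
         (\<forall>x. \<forall>c\<in>Basis - J. \<bar>D p x \<bullet> c\<bar> \<le> e * part_norm J (D p x))))"
    using graph_estimate[OF p0 J R] by metis
  obtain \<rho>2 where \<rho>2: "\<rho>2 > 0"
    "\<And>p v. p \<in> ball p0 \<rho>2 \<Longrightarrow> norm (D p v - ?L v) \<le> 1 * norm v"
    "\<And>p x. p \<in> ball p0 \<rho>2 \<Longrightarrow> dim (range (D p)) = card J \<Longrightarrow>
        \<exists>y. D p y = D p x \<and> norm y \<le> A * part_norm J (D p x)"
    "\<And>p x. p \<in> ball p0 \<rho>2 \<Longrightarrow> dim (range (D p)) = card J \<Longrightarrow>
        \<bar>D p x \<bullet> c\<bar> \<le> 1 * part_norm J (D p x)"
    using A(2)[OF zero_less_one] c by blast
  obtain G where G: "G > 0" "\<And>v. norm (?L v) \<le> G * norm v"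
    using linear_bounded_pos[OF L] by (metis mult.commute)
  \<comment> \<open>\<open>H\<close> bounds \<open>2 * norm x + norm y\<close> in units of
    \<open>norm x\<close>, where \<open>y\<close> is a short vector with
    \<open>D p y = D p x\<close>; \<open>P\<close> is the resulting factor of the second derivative
    terms.\<close>
  define H where "H = 2 + A * (?m * (G + 1))"
  have H: "H > 0" unfolding H_def using A G by (intro add_pos_pos mult_pos_pos) auto
  define P where "P = C2 * H * A"
  have P: "P > 0" unfolding P_def using C2 H A by simp
  define \<rho> where "\<rho> = min R0 (min \<rho>1 \<rho>2)"
  have \<rho>: "\<rho> > 0" "\<rho> \<le> R0" "\<rho> \<le> \<rho>1" "\<rho> \<le> \<rho>2"
    unfolding \<rho>_def using R0 \<rho>1 \<rho>2 by auto
  let ?S = "flat_stratum (card J) \<inter> ball p0 \<rho>"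
  have est: "\<exists>r>0. \<forall>p\<in>?S. \<forall>q\<in>?S. norm (q - p) \<le> r \<longrightarrow>
      \<bar>(f q - f p) \<bullet> c\<bar> \<le> (1 + (?m + 1) * P) * part_norm J (f q - f p) + (?m + 1) * (2 * \<epsilon>) * norm (q - p) ^ 2"
    if \<epsilon>: "\<epsilon> > 0" for \<epsilon>
  proof -
    obtain r1 where r1: "r1 > 0"
      "\<And>p q. p \<in> cball p0 R0 \<Longrightarrow> q \<in> cball p0 R0 \<Longrightarrow> norm (q - p) \<le> r1 \<Longrightarrow>
        norm (f q - f p - D p (q - p) - (1/2) *\<^sub>R D2 p (q - p) (q - p)) \<le> \<epsilon> * norm (q - p) ^ 2"
      using Taylor_uniform[OF R0(2) \<epsilon>] by metis
    \<comment> \<open>The last entry makes the cubic term \<open>P * (?m * C) * norm x ^ 3\<close>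
      at most \<open>\<epsilon> * norm x ^ 2\<close>, and \<open>r \<le> 1\<close> removes a factor
      \<open>norm x\<close> in front of \<open>part_norm\<close>.\<close>
    define r where "r = min (min 1 r1) (\<epsilon> / (P * (?m * C)))"
    have PC: "P * (?m * C) > 0" using P C by simp
    have r: "r > 0" "r \<le> 1" "r \<le> r1" "P * (?m * C) * r \<le> \<epsilon>"
    proof -
      show "r > 0" "r \<le> 1" "r \<le> r1" unfolding r_def using r1 \<epsilon> PC by auto
      have "r \<le> \<epsilon> / (P * (?m * C))" unfolding r_def by simp
      then show "P * (?m * C) * r \<le> \<epsilon>" using PC by (simp add: field_simps)
    qed
    have "\<bar>(f q - f p) \<bullet> c\<bar> \<le> (1 + (?m + 1) * P) * part_norm J (f q - f p) + (?m + 1) * (2 * \<epsilon>) * norm (q - p) ^ 2"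
      if pq: "p \<in> ?S" "q \<in> ?S" and nr: "norm (q - p) \<le> r" for p q
    proof -
      define x z where "x = q - p" and "z = f q - f p"
      have rk: "dim (range (D p)) = card J" and flat: "\<And>w. D p w = 0 \<Longrightarrow> D2 p w w \<in> range (D p)"
        using pq unfolding flat_stratum_def rank_stratum_def by auto
      have b0: "p \<in> cball p0 R0" "q \<in> cball p0 R0" "p \<in> ball p0 \<rho>2" using pq \<rho> by auto
      have pW: "p \<in> W" using b0 R0 by blast
      have lin: "linear (D p)" by (rule D_linear[OF pW])
      have E: "norm (z - D p x) \<le> C * norm x ^ 2" unfolding z_def x_def by (rule C(2)[OF b0(1,2)])
      have T: "norm (z - D p x - (1/2) *\<^sub>R D2 p x x) \<le> \<epsilon> * norm x ^ 2"
        unfolding z_def x_def by (rule r1(2)[OF b0(1,2)]) (use nr r in simp)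
      have pd: "part_norm J (D p x) \<le> part_norm J z + ?m * (C * norm x ^ 2)"
        by (rule part_norm_perturb[OF J]) (use E in \<open>simp only: norm_minus_commute\<close>)
      obtain y where y: "D p y = D p x" "norm y \<le> A * part_norm J (D p x)"
        using \<rho>2(3)[OF b0(3) rk] by blast
      have "norm (D p x) \<le> norm (D p x - ?L x) + norm (?L x)" by (metis norm_triangle_sub add.commute)
      also have "\<dots> \<le> (G + 1) * norm x" using \<rho>2(2)[OF b0(3), of x] G(2)[of x] by (simp add: algebra_simps)
      finally have "?m * norm (D p x) \<le> ?m * ((G + 1) * norm x)" by (intro mult_left_mono) auto
      then have "part_norm J (D p x) \<le> ?m * ((G + 1) * norm x)"
        using part_norm_le[OF J, of "D p x"] by linarith
      then have "A * part_norm J (D p x) \<le> A * (?m * ((G + 1) * norm x))"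
        using A by (intro mult_left_mono) auto
      then have "norm y \<le> A * (?m * (G + 1)) * norm x"
        using y(2) by (simp add: mult.assoc)
      then have yH: "2 * norm x + norm y \<le> H * norm x"
        unfolding H_def by (simp add: algebra_simps)
      \<comment> \<open>Splitting \<open>x = w + y\<close> isolates the kernel part
        \<open>w\<close>. Every second derivative term other than \<open>D2 p w w\<close> contains
        \<open>y\<close>, which is controlled by the \<open>J\<close> coordinates of
        \<open>z\<close> up to a quadratic error.\<close>
      define w where "w = x - y"
      have Dw: "D p w = 0" unfolding w_def using y(1) by (simp add: linear_diff[OF lin])
      have xwy: "x = w + y" unfolding w_def by simp
      have "D2 p x x = D2 p w x + D2 p y x"
        unfolding xwy by (rule linear_add[OF D2_linear[OF pW]])
      also have "D2 p w x = D2 p w w + D2 p w y"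
        unfolding xwy by (rule linear_add[OF D2_linear'[OF pW]])
      finally have sp: "D2 p x x - D2 p w w = D2 p w y + D2 p y x" by simp
      have "norm (D2 p w y + D2 p y x) \<le> C2 * norm w * norm y + C2 * norm y * norm x"
        using C2(2)[OF b0(1), of w y] C2(2)[OF b0(1), of y x] norm_triangle_ineq[of "D2 p w y" "D2 p y x"] by linarith
      also have "\<dots> \<le> C2 * (norm x + norm y) * norm y + C2 * norm y * norm x"
        using C2(1) norm_triangle_ineq4[of x y] unfolding w_def
        by (intro add_right_mono mult_right_mono mult_left_mono) auto
      also have "\<dots> = C2 * norm y * (2 * norm x + norm y)" by (simp add: algebra_simps)
      also have "\<dots> \<le> C2 * norm y * (H * norm x)" using yH C2(1) by (intro mult_left_mono) auto
      also have "\<dots> \<le> C2 * (A * (part_norm J z + ?m * (C * norm x ^ 2))) * (H * norm x)"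
        using y(2) pd A C2(1) H
        by (intro mult_right_mono mult_left_mono) (auto intro: order_trans mult_left_mono)
      also have "\<dots> = P * norm x * part_norm J z + (P * (?m * C) * norm x) * norm x ^ 2"
        unfolding P_def by (simp add: algebra_simps)
      also have "\<dots> \<le> P * part_norm J z + \<epsilon> * norm x ^ 2"
      proof (intro add_mono mult_right_mono)
        have nx: "norm x \<le> r" using nr unfolding x_def .
        show "P * norm x \<le> P" using nx r P by (simp add: mult_left_le)
        show "P * (?m * C) * norm x \<le> \<epsilon>"
          using mult_left_mono[OF nx, of "P * (?m * C)"] r(4) PC by linarith
      qed auto
      finally have D2b: "norm (D2 p x x - D2 p w w) \<le> P * part_norm J z + \<epsilon> * norm x ^ 2" unfolding sp .
      \<comment> \<open>This is the Taylor polynomial with its quadratic part evaluated on the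
        kernel part alone. Flatness puts it into the range of \<open>D p\<close>, a graph of slope
        at most 1.\<close>
      define \<sigma> where "\<sigma> = D p x + (1/2) *\<^sub>R D2 p w w"
      obtain u where u: "D2 p w w = D p u" using flat[OF Dw] by blast
      have \<sigma>: "\<sigma> = D p (x + (1/2) *\<^sub>R u)" unfolding \<sigma>_def u by (simp add: linear_add[OF lin] linear_cmul[OF lin])
      define err where "err = P * part_norm J z + 2 * \<epsilon> * norm x ^ 2"
      have "norm (z - \<sigma>) \<le> norm (z - D p x - (1/2) *\<^sub>R D2 p x x) + norm ((1/2) *\<^sub>R (D2 p x x - D2 p w w))"
        using norm_triangle_ineq[of "z - D p x - (1/2) *\<^sub>R D2 p x x" "(1/2) *\<^sub>R (D2 p x x - D2 p w w)"]
        unfolding \<sigma>_def by (simp add: algebra_simps)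
      also have "\<dots> \<le> \<epsilon> * norm x ^ 2 + (P * part_norm J z + \<epsilon> * norm x ^ 2)"
        using T D2b P \<epsilon> norm_ge_zero[of "D2 p x x - D2 p w w"] unfolding norm_scaleR by linarith
      finally have err: "norm (z - \<sigma>) \<le> err" unfolding err_def by (simp add: algebra_simps)
      have "\<bar>\<sigma> \<bullet> c\<bar> \<le> part_norm J \<sigma>" unfolding \<sigma> using \<rho>2(4)[OF b0(3) rk] by simp
      then have "\<bar>z \<bullet> c\<bar> \<le> part_norm J z + (?m + 1) * err" using graph_bound_perturb[OF J cB _ err] by simp
      then show ?thesis unfolding err_def z_def x_def by (simp add: algebra_simps)
    qed
    then show ?thesis using r(1) by blast
  qed
  have "negligible (f ` ?S)"
  proof (rule negligible_image_quadratic[where J = J and I = K and \<kappa> = "2 * C1"])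
    have "?S \<subseteq> cball p0 R0" using \<rho> by auto
    then show "bounded ?S" "bounded (f ` ?S)" using bounded_image_near[OF R0(2), of ?S] by blast+
    show "norm (q - p) \<le> 2 * C1 * (part_norm J (f q - f p) + (\<Sum>u\<in>K. \<bar>(q - p) \<bullet> u\<bar>))"
      if "p \<in> ?S" "q \<in> ?S" for p q using \<rho>1(2) that \<rho>(3) by auto
    fix \<epsilon> :: real assume \<epsilon>: "\<epsilon> > 0"
    define \<epsilon>' where "\<epsilon>' = \<epsilon> / (2 * (?m + 1))"
    have m1: "2 * (?m + 1) > 0" by (simp add: add_pos_pos)
    have \<epsilon>': "\<epsilon>' > 0" "(?m + 1) * (2 * \<epsilon>') = \<epsilon>" unfolding \<epsilon>'_def using \<epsilon> m1 by (auto simp: field_simps)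
    obtain r where r: "r > 0" "\<And>p q. p \<in> ?S \<Longrightarrow> q \<in> ?S \<Longrightarrow> norm (q - p) \<le> r \<Longrightarrow>
      \<bar>(f q - f p) \<bullet> c\<bar> \<le> (1 + (?m + 1) * P) * part_norm J (f q - f p) + \<epsilon> * norm (q - p) ^ 2"
      using est[OF \<epsilon>'(1)] unfolding \<epsilon>'(2) by blast
    \<comment> \<open>Two kernel directions against corank one put \<delta>^2 on both sides. No
      power of \<delta> is to spare, and \<omega> is taken to be \<epsilon> itself.\<close>
    have "card K = 2" using K(2) dims by simp
    moreover have "1 + (?m + 1) * P > 0" using P by (intro add_pos_pos mult_pos_pos) auto
    ultimately show "\<exists>\<rho> \<omega> B'. \<rho> > 0 \<and> \<omega> > 0 \<and> B' > 0 \<and>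
        (\<forall>p\<in>?S. \<forall>q\<in>?S. norm (q - p) \<le> \<rho> \<longrightarrow>
           (\<forall>c\<in>Basis - J. \<bar>(f q - f p) \<bullet> c\<bar> \<le> B' * part_norm J (f q - f p) + \<omega> * norm (q - p) ^ 2)) \<and>
        (\<forall>\<delta>. 0 < \<delta> \<and> \<delta> < \<rho> \<longrightarrow> (\<omega> * \<delta> ^ 2) ^ card (Basis - J) \<le> \<epsilon> * \<delta> ^ card K)"
      using r \<epsilon> unfolding cc c
      by (intro exI[of _ r] exI[of _ \<epsilon>] exI[of _ "1 + (?m + 1) * P"] conjI ballI allI impI) auto
  qed (use J K in auto)
  then show ?thesis using \<rho>(1) by blast
qed

end

text \<open>By Lindelof's theorem countably many of the balls cover \<open>S\<close>.\<close>

lemma negligible_locally_image: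
  fixes f :: "'a::euclidean_space \<Rightarrow> 'b::euclidean_space"
  assumes "\<And>p. p \<in> S \<Longrightarrow> \<exists>\<rho>>0. negligible (f ` (S \<inter> ball p \<rho>))"
  shows "negligible (f ` S)"
proof -
  obtain \<rho> where \<rho>: "\<And>p. p \<in> S \<Longrightarrow> \<rho> p > 0" "\<And>p. p \<in> S \<Longrightarrow> negligible (f ` (S \<inter> ball p (\<rho> p)))"
    using assms by metis
  obtain \<F> where \<F>: "\<F> \<subseteq> (\<lambda>p. ball p (\<rho> p)) ` S" "countable \<F>" "\<Union>\<F> = (\<Union>p\<in>S. ball p (\<rho> p))"
    using Lindelof[of "(\<lambda>p. ball p (\<rho> p)) ` S"] by auto
  have "negligible (\<Union>B\<in>\<F>. f ` (S \<inter> B))"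
    using \<F> \<rho> by (intro negligible_countable_Union) auto
  moreover have "f ` S \<subseteq> (\<Union>B\<in>\<F>. f ` (S \<inter> B))"
  proof clarify
    fix p assume p: "p \<in> S"
    then have "p \<in> \<Union>\<F>" unfolding \<F>(3) using \<rho>(1) by (intro UN_I[of p]) auto
    then show "f p \<in> (\<Union>B\<in>\<F>. f ` (S \<inter> B))" using p by blast
  qed
  ultimately show ?thesis using negligible_subset by blast
qed

text \<open>Cell counting works with boxes along the axes, so the range of a derivative has to be
  made a coordinate subspace; a basis adapted to it is sent to the standard one.\<close>

lemma linear_iso_onto_coordinate_subspace:
  fixes R :: "'b::euclidean_space set"
  assumes R: "subspace R"
  obtains T T' :: "'b \<Rightarrow> 'b" and J where "linear T" "linear T'" "\<And>x. T' (T x) = x" "\<And>x. T (T' x) = x"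
    "J \<subseteq> Basis" "card J = dim R" "T ` R = span J"
proof -
  obtain B1 where B1: "B1 \<subseteq> R" "independent B1" "R \<subseteq> span B1" "card B1 = dim R"
    using basis_exists by metis
  have spB1: "span B1 = R" using B1(1,3) span_minimal[OF B1(1) R] by blast
  obtain B where B: "B1 \<subseteq> B" "independent B" "UNIV \<subseteq> span B"
    using maximal_independent_subset_extend[OF subset_UNIV B1(2)] by metis
  have finB: "finite B" using B(2) independent_imp_finite by blast
  have cB: "card B = card (Basis :: 'b set)"
    using dim_span_eq_card_independent[OF B(2)] B(3) by (metis dim_UNIV top.extremum_uniqueI)
  have "dim R \<le> card (Basis :: 'b set)" using dim_subset_UNIV by auto
  then obtain J :: "'b set" where J: "J \<subseteq> Basis" "card J = dim R"
    using obtain_subset_with_card_n by metis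
  have finJ: "finite J" using J finite_subset finite_Basis by blast
  have finB1: "finite B1" using B(1) finB finite_subset by blast
  obtain h1 where h1: "bij_betw h1 B1 J"
    using finite_same_card_bij[OF finB1 finJ] B1(4) J(2) by auto
  have "card (B - B1) = card (Basis - J)"
    using cB B1(4) J B(1) finB1 finJ by (simp add: card_Diff_subset)
  then obtain h2 where h2: "bij_betw h2 (B - B1) (Basis - J)"
    using finite_same_card_bij[of "B - B1" "Basis - J"] finB by auto
  define h where "h x = (if x \<in> B1 then h1 x else h2 x)" for x
  have hB1: "h ` B1 = J" using h1 unfolding h_def bij_betw_def by (auto simp: image_iff)
  have hB: "h ` B = Basis"
  proof -
    have "h ` B = h ` B1 \<union> h ` (B - B1)" using B(1) by blast
    also have "h ` (B - B1) = Basis - J" using h2 unfolding h_def bij_betw_def by (auto simp: image_iff)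
    finally show ?thesis using hB1 J(1) by blast
  qed
  obtain T where T: "linear T" "\<And>x. x \<in> B \<Longrightarrow> T x = h x"
    using linear_independent_extend[OF B(2), of h] by blast
  have TB: "T ` B = Basis" "T ` B1 = J"
    using T(2) hB hB1 B(1) by (auto simp: image_iff subset_iff)
  have "range T = T ` span B" using B(3) by (simp add: top.extremum_unique)
  also have "\<dots> = span Basis" using linear_span_image[OF T(1), of B] TB by simp
  finally have "surj T" by simp
  then obtain T' where T': "linear T'" "\<forall>x. T' (T x) = x" "\<forall>x. T (T' x) = x"
    using linear_surjective_isomorphism[OF T(1)] by blast
  have "T ` R = span J" using linear_span_image[OF T(1), of B1] TB spB1 by simp
  then show ?thesis using that[OF T(1) T'(1)] T' J by blast
qed

text \<open>Two derivatives are the classical regularity for a drop of one dimension. Corank at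
  least two is settled by the quadratic remainder; corank one splits by whether the second
  derivative on the kernel leaves the range.\<close>

theorem Sard_corank_one:
  fixes f :: "'a::euclidean_space \<Rightarrow> 'b::euclidean_space"
  assumes "open W" "Ck_on 2 f W" and dims: "DIM('a) = DIM('b) + 1"
  shows "negligible (f ` {p \<in> W. range (frechet_derivative f (at p)) \<noteq> UNIV})"
proof -
  interpret C2_map f W by unfold_locales fact+
  \<comment> \<open>Composing with an isomorphism of the target makes the range at \<open>p0\<close>
    a coordinate subspace and leaves both kinds of strata unchanged.\<close>
  have reduce: "\<exists>(T :: 'b \<Rightarrow> 'b) T' J. linear T \<and> linear T' \<and> (\<forall>x. T' (T x) = x) \<and> C2_map (T \<circ> f) W \<and> J \<subseteq> Basis \<and>
      card J = dim (range (D p0)) \<and> range (C2_map.D (T \<circ> f) p0) = span J \<and>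
      (\<forall>r. C2_map.rank_stratum (T \<circ> f) W r = rank_stratum r) \<and>
      (\<forall>r. C2_map.flat_stratum (T \<circ> f) W r = flat_stratum r) \<and>
      (\<forall>w. C2_map.D (T \<circ> f) p0 w = T (D p0 w)) \<and>
      (\<forall>w. C2_map.D2 (T \<circ> f) p0 w w \<in> span J \<longrightarrow> D2 p0 w w \<in> range (D p0))"
    if p0: "p0 \<in> W" for p0
  proof -
    have "subspace (range (D p0))" using linear_subspace_image[OF D_linear[OF p0] subspace_UNIV] .
    then obtain T T' :: "'b \<Rightarrow> 'b" and J where T: "linear T" "linear T'" "\<And>x. T' (T x) = x" "\<And>x. T (T' x) = x"
      "J \<subseteq> Basis" "card J = dim (range (D p0))" "T ` range (D p0) = span J"
      using linear_iso_onto_coordinate_subspace by metis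
    have bl: "bounded_linear T" using T(1) linear_conv_bounded_linear by blast
    have injT: "inj T" using T(3) by (metis injI)
    interpret T: C2_map "T \<circ> f" W
      by unfold_locales (use W C2 Ck_on_linear_compose[OF bl W C2] in \<open>auto simp: o_def\<close>)
    have TD: "T.D p v = T (D p v)" if "p \<in> W" for p v
    proof -
      have "((T \<circ> f) has_derivative (\<lambda>v. T (D p v))) (at p)"
        unfolding o_def by (rule bounded_linear.has_derivative[OF bl D_deriv[OF that]])
      then show ?thesis using has_derivative_unique[OF T.D_deriv[OF that]] by metis
    qed
    have TD2: "T.D2 p x v = T (D2 p x v)" if "p \<in> W" for p x v
    proof -
      have "((\<lambda>q. T (D q v)) has_derivative (\<lambda>x. T (D2 p x v))) (at p)"
        by (rule bounded_linear.has_derivative[OF bl D2_deriv[OF that]])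
      then have "((\<lambda>q. T.D q v) has_derivative (\<lambda>x. T (D2 p x v))) (at p)"
        by (rule has_derivative_transform_within_open[OF _ W that]) (simp add: TD)
      then show ?thesis using has_derivative_unique[OF T.D2_deriv[OF that]] by metis
    qed
    have rg: "range (T.D p) = T ` range (D p)" if "p \<in> W" for p
      using TD[OF that] by auto
    have dimT: "dim (T ` S) = dim S" for S
      by (rule dim_image_eq[OF T(1)]) (use injT in \<open>auto intro: inj_on_subset\<close>)
    have rs: "T.rank_stratum r = rank_stratum r" for r
      unfolding T.rank_stratum_def rank_stratum_def using rg dimT by auto
    have T0: "T z = 0 \<longleftrightarrow> z = 0" for z using T(3) linear_0[OF T(1)] linear_0[OF T(2)] by metis
    have fs: "T.flat_stratum r = flat_stratum r" for r
    proof -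
      have "(T.D p w = 0 \<longrightarrow> T.D2 p w w \<in> range (T.D p)) \<longleftrightarrow> (D p w = 0 \<longrightarrow> D2 p w w \<in> range (D p))"
        if "p \<in> W" for p w
        unfolding TD[OF that] TD2[OF that] T0 rg[OF that] inj_image_mem_iff[OF injT] by (rule refl)
      then have "(\<forall>w. T.D p w = 0 \<longrightarrow> T.D2 p w w \<in> range (T.D p)) \<longleftrightarrow>
          (\<forall>w. D p w = 0 \<longrightarrow> D2 p w w \<in> range (D p))" if "p \<in> rank_stratum r" for p
        using that unfolding rank_stratum_def by simp
      then show ?thesis
        unfolding T.flat_stratum_def flat_stratum_def rs by (intro Collect_cong conj_cong refl)
    qed
    have fl: "D2 p0 w w \<in> range (D p0)" if "T.D2 p0 w w \<in> span J" for w
    proof -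
      have "T (D2 p0 w w) \<in> T ` range (D p0)" using that unfolding TD2[OF p0] T(7) .
      then show ?thesis unfolding inj_image_mem_iff[OF injT] .
    qed
    have rT: "range (T.D p0) = span J" using rg[OF p0] T(7) by simp
    show ?thesis
      by (intro exI[of _ T] exI[of _ T'] exI[of _ J] conjI allI impI T(1-6) rs fs TD[OF p0]
          T.C2_map_axioms rT fl)
  qed
  \<comment> \<open>Negligibility returns from \<open>T \<circ> f\<close> to \<open>f\<close>
    because it is preserved by the linear map \<open>T'\<close>.\<close>
  have pull: "\<exists>\<rho>>0. negligible (f ` (S \<inter> ball p0 \<rho>))"
    if neg: "\<exists>\<rho>>0. negligible ((T \<circ> f) ` (S \<inter> ball p0 \<rho>))" and "linear T'" "\<forall>x. T' (T x) = x"
    for T T' :: "'b \<Rightarrow> 'b" and S p0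
  proof -
    obtain \<rho> where \<rho>: "\<rho> > 0" "negligible ((T \<circ> f) ` (S \<inter> ball p0 \<rho>))" using neg by blast
    have "negligible (T' ` (T \<circ> f) ` (S \<inter> ball p0 \<rho>))"
      by (rule negligible_differentiable_image_negligible[OF order_refl \<rho>(2)])
        (simp add: differentiable_on_def linear_imp_differentiable that(2))
    moreover have "T' ` (T \<circ> f) ` (S \<inter> ball p0 \<rho>) = f ` (S \<inter> ball p0 \<rho>)"
      by (simp add: image_image that(3))
    ultimately show ?thesis using \<rho>(1) by auto
  qed
  have low: "negligible (f ` rank_stratum r)" if r: "r + 2 \<le> DIM('b)" for r
  proof (rule negligible_locally_image)
    fix p0 assume p0: "p0 \<in> rank_stratum r"
    then have p0W: "p0 \<in> W" "dim (range (D p0)) = r" unfolding rank_stratum_def by auto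
    obtain T T' :: "'b \<Rightarrow> 'b" and J where T: "linear T'" "\<forall>x. T' (T x) = x" "C2_map (T \<circ> f) W" "J \<subseteq> Basis"
      "card J = r" "range (C2_map.D (T \<circ> f) p0) = span J"
      "C2_map.rank_stratum (T \<circ> f) W r = rank_stratum r"
      using reduce[OF p0W(1)] p0W(2) by blast
    have "\<exists>\<rho>>0. negligible ((T \<circ> f) ` (rank_stratum r \<inter> ball p0 \<rho>))"
      using C2_map.negligible_low_rank[OF T(3) p0W(1) T(4,6) dims] T(5,7) r by simp
    then show "\<exists>\<rho>>0. negligible (f ` (rank_stratum r \<inter> ball p0 \<rho>))"
      using pull T(1,2) by blast
  qed
  have high: "negligible (f ` (rank_stratum r - flat_stratum r))" if r: "r + 1 = DIM('b)" for r
  proof (rule negligible_locally_image)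
    fix p0 assume p0: "p0 \<in> rank_stratum r - flat_stratum r"
    then have p0W: "p0 \<in> W" "dim (range (D p0)) = r" unfolding rank_stratum_def by auto
    obtain w where w: "D p0 w = 0" "D2 p0 w w \<notin> range (D p0)"
      using p0 unfolding flat_stratum_def by blast
    obtain T T' :: "'b \<Rightarrow> 'b" and J where T: "linear T" "linear T'" "\<forall>x. T' (T x) = x" "C2_map (T \<circ> f) W" "J \<subseteq> Basis"
      "card J = r" "range (C2_map.D (T \<circ> f) p0) = span J"
      "C2_map.rank_stratum (T \<circ> f) W r = rank_stratum r"
      "\<forall>w. C2_map.D (T \<circ> f) p0 w = T (D p0 w)"
      "\<forall>w. C2_map.D2 (T \<circ> f) p0 w w \<in> span J \<longrightarrow> D2 p0 w w \<in> range (D p0)"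
      using reduce[OF p0W(1)] p0W(2) by blast
    have w': "C2_map.D (T \<circ> f) p0 w = 0" "C2_map.D2 (T \<circ> f) p0 w w \<notin> span J"
      using T(9,10) w linear_0[OF T(1)] by auto
    have "\<exists>\<rho>>0. negligible ((T \<circ> f) ` (rank_stratum r \<inter> ball p0 \<rho>))"
      using C2_map.negligible_nonflat[OF T(4) p0W(1) T(5,7) dims _ w'] T(6,8) r by simp
    then have "\<exists>\<rho>>0. negligible (f ` (rank_stratum r \<inter> ball p0 \<rho>))"
      using pull T(2,3) by blast
    then show "\<exists>\<rho>>0. negligible (f ` ((rank_stratum r - flat_stratum r) \<inter> ball p0 \<rho>))"
      by (rule ex_forward) (auto elim!: negligible_subset)
  qed
  have flat: "negligible (f ` flat_stratum r)" if r: "r + 1 = DIM('b)" for r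
  proof (rule negligible_locally_image)
    fix p0 assume p0: "p0 \<in> flat_stratum r"
    then have p0W: "p0 \<in> W" "dim (range (D p0)) = r" unfolding flat_stratum_def rank_stratum_def by auto
    obtain T T' :: "'b \<Rightarrow> 'b" and J where T: "linear T'" "\<forall>x. T' (T x) = x" "C2_map (T \<circ> f) W" "J \<subseteq> Basis"
      "card J = r" "range (C2_map.D (T \<circ> f) p0) = span J"
      "C2_map.flat_stratum (T \<circ> f) W r = flat_stratum r"
      using reduce[OF p0W(1)] p0W(2) by blast
    have "\<exists>\<rho>>0. negligible ((T \<circ> f) ` (flat_stratum r \<inter> ball p0 \<rho>))"
      using C2_map.negligible_flat[OF T(3) p0W(1) T(4,6) dims] T(5,7) r by simp
    then show "\<exists>\<rho>>0. negligible (f ` (flat_stratum r \<inter> ball p0 \<rho>))"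
      using pull T(1,2) by blast
  qed
  let ?m = "DIM('b)"
  have "negligible (\<Union>r\<in>{..<?m}. f ` rank_stratum r)"
  proof (rule negligible_Union)
    fix S assume "S \<in> (\<lambda>r. f ` rank_stratum r) ` {..<?m}"
    then obtain r where r: "r < ?m" "S = f ` rank_stratum r" by blast
    show "negligible S"
    proof (cases "r + 2 \<le> ?m")
      case True
      then show ?thesis using low r by blast
    next
      case False
      then have "r + 1 = ?m" using r by simp
      then have "negligible (f ` (rank_stratum r - flat_stratum r) \<union> f ` flat_stratum r)"
        using high flat by (intro negligible_Un) auto
      then show ?thesis unfolding r(2) by (rule negligible_subset) blast
    qed
  qed auto
  moreover have "f ` {p \<in> W. range (frechet_derivative f (at p)) \<noteq> UNIV} \<subseteq> (\<Union>r\<in>{..<?m}. f ` rank_stratum r)"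
  proof clarify
    fix p assume p: "p \<in> W" "range (frechet_derivative f (at p)) \<noteq> UNIV"
    have eq: "frechet_derivative f (at p) = D p" unfolding D_def by simp
    have "subspace (range (D p))" using linear_subspace_image[OF D_linear[OF p(1)] subspace_UNIV] .
    then have "dim (range (D p)) \<noteq> ?m" using p(2) unfolding eq by (metis dim_eq_full span_eq_iff)
    then have "dim (range (D p)) < ?m" using dim_subset_UNIV[of "range (D p)"] by simp
    then show "f p \<in> (\<Union>r\<in>{..<?m}. f ` rank_stratum r)" using p(1) unfolding rank_stratum_def by auto
  qed
  ultimately show ?thesis using negligible_subset by blast
qed

section \<open>Compact one-manifolds\<close>

text \<open>An open embedding of \<open>I\<close>. Openness is relative to \<open>I\<close>, so the
  half-open \<open>{0..<1}\<close> models a neighbourhood of an end point.\<close>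

definition arc_chart :: "'a topology \<Rightarrow> real set \<Rightarrow> (real \<Rightarrow> 'a) \<Rightarrow> bool" where
  "arc_chart T I \<gamma> \<longleftrightarrow>
     continuous_map (top_of_set I) T \<gamma> \<and> open_map (top_of_set I) T \<gamma> \<and> inj_on \<gamma> I"

lemma arc_chart_open:
  assumes "arc_chart T I \<gamma>" "open U"
  shows "openin T (\<gamma> ` (I \<inter> U))"
  using assms unfolding arc_chart_def open_map_def by (metis openin_open_Int)

lemma arc_chart_subset: "arc_chart T I \<gamma> \<Longrightarrow> S \<subseteq> I \<Longrightarrow> \<gamma> ` S \<subseteq> topspace T"
  unfolding arc_chart_def continuous_map_def by auto

lemma arc_chart_connected:
  assumes "arc_chart T I \<gamma>" "S \<subseteq> I" "connected S"
  shows "connectedin T (\<gamma> ` S)"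
  by (rule connectedin_continuous_map_image[of "top_of_set I"])
    (use assms in \<open>auto simp: arc_chart_def connectedin_subtopology\<close>)

lemma arc_chart_closed:
  assumes "arc_chart T I \<gamma>" "S \<subseteq> I" "compact S" "Hausdorff_space T"
  shows "closedin T (\<gamma> ` S)"
proof (rule compactin_imp_closedin[OF assms(4)])
  show "compactin T (\<gamma> ` S)"
    by (rule image_compactin[of "top_of_set I"])
      (use assms in \<open>auto simp: arc_chart_def compactin_subtopology\<close>)
qed

text \<open>An arc chart is a homeomorphism onto its image, so connectedness can be read back on the
  line. This is how the two sides of a cut point are told apart.\<close>

lemma arc_chart_connected_preimage:
  assumes "arc_chart T I \<gamma>" "S \<subseteq> I" "connectedin T (\<gamma> ` S)"
  shows "connected S"
proof -
  have sub: "\<gamma> ` I \<subseteq> topspace T" using arc_chart_subset[OF assms(1)] by blast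
  have hom: "homeomorphic_map (top_of_set I) (subtopology T (\<gamma> ` I)) \<gamma>"
  proof (rule bijective_open_imp_homeomorphic_map)
    show "continuous_map (top_of_set I) (subtopology T (\<gamma> ` I)) \<gamma>"
      using assms(1) by (simp add: arc_chart_def continuous_map_in_subtopology)
    show "open_map (top_of_set I) (subtopology T (\<gamma> ` I)) \<gamma>"
      using assms(1) by (auto simp: arc_chart_def intro!: open_map_into_subtopology)
    show "\<gamma> ` topspace (top_of_set I) = topspace (subtopology T (\<gamma> ` I))"
      using sub by auto
    show "inj_on \<gamma> (topspace (top_of_set I))" using assms(1) by (simp add: arc_chart_def)
  qed
  have "connectedin (subtopology T (\<gamma> ` I)) (\<gamma> ` S)"
    using assms(2,3) by (auto simp: connectedin_subtopology)
  then have "connectedin (top_of_set I) S"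
    using homeomorphic_map_connectedness[OF hom, of S] assms(2) by simp
  then show ?thesis by (simp add: connectedin_subtopology)
qed

lemma arc_chart_closure:
  assumes "arc_chart T I \<gamma>" "S \<subseteq> I" "t \<in> I" "t \<in> closure S"
  shows "\<gamma> t \<in> T closure_of (\<gamma> ` S)"
proof -
  have "t \<in> top_of_set I closure_of S"
    using assms(2-4) by (simp add: closure_of_subtopology Int_absorb1)
  then show ?thesis
    using continuous_map_image_closure_subset[of "top_of_set I" T \<gamma> S] assms(1)
    unfolding arc_chart_def by blast
qed

lemma finite_avoid_radius:
  fixes Z :: "real set"
  assumes "finite Z"
  obtains \<epsilon> where "0 < \<epsilon>" "\<epsilon> < 1" "\<And>t. t \<in> Z \<Longrightarrow> t \<noteq> 0 \<Longrightarrow> \<epsilon> < \<bar>t\<bar>"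
proof -
  let ?A = "insert 1 (abs ` (Z - {0}))"
  have m: "Min ?A > 0" using assms by (subst Min_gr_iff) auto
  show ?thesis
  proof (rule that[of "Min ?A / 2"])
    show "0 < Min ?A / 2" using m by simp
    have "Min ?A \<le> 1" using assms by (intro Min_le) auto
    then show "Min ?A / 2 < 1" by simp
    fix t assume "t \<in> Z" "t \<noteq> 0"
    then have "Min ?A \<le> \<bar>t\<bar>" using assms by (intro Min_le) auto
    then show "Min ?A / 2 < \<bar>t\<bar>" using m by linarith
  qed
qed

text \<open>Cut the manifold at finitely many points into open arcs. Every cut point is an end of exactly
  two arcs and the boundary point of exactly one, while every arc has two ends.\<close>

theorem no_compact_one_manifold_with_one_end:
  fixes T :: "'a topology"
  assumes cpt: "compact_space T" and haus: "Hausdorff_space T" and y: "y \<in> topspace T"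
    and charts: "\<And>x. x \<in> topspace T \<Longrightarrow>
      \<exists>\<gamma>. \<gamma> 0 = x \<and> arc_chart T (if x = y then {0..<1} else {-1<..<1}) \<gamma>"
  shows False
proof -
  define I :: "'a \<Rightarrow> real set" where "I x = (if x = y then {0..<1} else {-1<..<1})" for x
  obtain \<gamma> where \<gamma>: "\<And>x. x \<in> topspace T \<Longrightarrow> \<gamma> x 0 = x" "\<And>x. x \<in> topspace T \<Longrightarrow> arc_chart T (I x) (\<gamma> x)"
    using charts unfolding I_def by metis
  have inj: "inj_on (\<gamma> x) (I x)" if "x \<in> topspace T" for x
    using \<gamma>(2)[OF that] unfolding arc_chart_def by blast
  have I0: "0 \<in> I x" for x unfolding I_def by simp
  have Iint: "{a..b} \<subseteq> I x" if "a \<in> I x" "b \<in> I x" for a b x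
    using that unfolding I_def by (auto split: if_splits)
  \<comment> \<open>The half-size charts cover, so that the cut points at parameters -1/2 and 1/2
    still lie inside the full charts.\<close>
  define U where "U x = \<gamma> x ` (I x \<inter> {-1/2<..<1/2})" for x
  have U: "openin T (U x)" "x \<in> U x" if "x \<in> topspace T" for x
    unfolding U_def using arc_chart_open[OF \<gamma>(2)[OF that]] I0[of x] \<gamma>(1)[OF that]
    by (auto intro!: image_eqI[of _ _ 0])
  obtain F where F: "finite F" "F \<subseteq> topspace T" "topspace T \<subseteq> (\<Union>x\<in>F. U x)"
  proof -
    have "\<exists>\<F>. finite \<F> \<and> \<F> \<subseteq> U ` topspace T \<and> topspace T \<subseteq> \<Union>\<F>"
      by (rule compactinD[OF cpt[unfolded compact_space_def]]) (use U in auto)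
    then obtain \<F> where \<F>: "finite \<F>" "\<F> \<subseteq> U ` topspace T" "topspace T \<subseteq> \<Union>\<F>" by blast
    obtain F where "F \<subseteq> topspace T" "finite F" "\<F> = U ` F"
      using finite_subset_image[OF \<F>(1,2)] by blast
    then show ?thesis using that \<F>(3) by blast
  qed
  \<comment> \<open>For \<open>x = y\<close> the parameter -1/2 lies outside \<open>I x\<close>, and
    \<open>y\<close> itself takes its place as a cut point.\<close>
  define P where "P = insert y (\<Union>x\<in>F. \<gamma> x ` (I x \<inter> {-1/2, 1/2}))"
  have finP: "finite P" unfolding P_def using F by auto
  have Psub: "P \<subseteq> topspace T"
    unfolding P_def using y F(2) arc_chart_subset[OF \<gamma>(2)] by blast
  have yP: "y \<in> P" unfolding P_def by simp
  define N where "N = topspace T - P"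
  define \<K> where "\<K> = connected_components_of (subtopology T N)"
  have topN: "topspace (subtopology T N) = N" unfolding N_def by auto
  have Kconn: "connectedin T K" "K \<subseteq> N" "K \<noteq> {}" if "K \<in> \<K>" for K
  proof -
    have "connectedin (subtopology T N) K" "K \<noteq> {}"
      using that connectedin_connected_components_of nonempty_connected_components_of
      unfolding \<K>_def by (blast, blast)
    then show "connectedin T K" "K \<subseteq> N" "K \<noteq> {}" by (simp_all add: connectedin_subtopology)
  qed
  have Kmax: "C \<subseteq> K" if "K \<in> \<K>" "connectedin T C" "C \<subseteq> N" "C \<inter> K \<noteq> {}" for C K
  proof (rule connected_components_of_maximal[of K "subtopology T N" C])
    show "K \<in> connected_components_of (subtopology T N)" using that(1) unfolding \<K>_def .
    show "connectedin (subtopology T N) C" using that(2,3) by (simp add: connectedin_subtopology)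
    show "\<not> disjnt K C" using that(4) unfolding disjnt_def by blast
  qed
  have Kex: "\<exists>K\<in>\<K>. C \<subseteq> K" if C: "connectedin T C" "C \<subseteq> N" "C \<noteq> {}" for C
  proof -
    have "C \<subseteq> \<Union>\<K>" unfolding \<K>_def Union_connected_components_of topN by (rule C(2))
    then obtain K where "K \<in> \<K>" "C \<inter> K \<noteq> {}" using C(3) by blast
    then show ?thesis using Kmax[OF _ C(1,2)] by blast
  qed
  have finZ: "finite {t \<in> I x. \<gamma> x t \<in> P}" if "x \<in> topspace T" for x
  proof -
    have "inj_on (\<gamma> x) {t \<in> I x. \<gamma> x t \<in> P}" using inj[OF that] by (rule inj_on_subset) auto
    then show ?thesis by (rule inj_on_finite[OF _ _ finP]) auto
  qed
  \<comment> \<open>Each component is the open arc between two consecutive cut parameters of one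
    chart.\<close>
  have arc: "\<exists>x a b. x \<in> topspace T \<and> a < b \<and> a \<in> I x \<and> b \<in> I x \<and> K = \<gamma> x ` {a<..<b} \<and>
      \<gamma> x a \<in> P \<and> \<gamma> x b \<in> P" if K: "K \<in> \<K>" for K
  proof -
    obtain k where k: "k \<in> K" using Kconn(3)[OF K] by blast
    then have kN: "k \<in> topspace T" "k \<notin> P" using Kconn(2)[OF K] unfolding N_def by auto
    then obtain x where x: "x \<in> F" "k \<in> U x" using F(3) by blast
    have xT: "x \<in> topspace T" using x F by blast
    obtain t0 where t0: "t0 \<in> I x" "-1/2 < t0" "t0 < 1/2" "k = \<gamma> x t0"
      using x(2) unfolding U_def by auto
    define Z where "Z = {t \<in> I x. \<gamma> x t \<in> P}"
    have fZ: "finite Z" unfolding Z_def using finZ[OF xT] .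
    have t0Z: "t0 \<notin> Z" unfolding Z_def using t0 kN by blast
    have "1/2 \<in> I x" unfolding I_def by simp
    then have Z1: "1/2 \<in> Z" unfolding Z_def P_def using x(1) by blast
    have Z2: "\<exists>t\<in>Z. t < t0"
    proof (cases "x = y")
      case True
      then have "0 \<in> Z" unfolding Z_def using I0 \<gamma>(1)[OF xT] yP by simp
      moreover have "0 \<le> t0" using t0(1) True unfolding I_def by simp
      ultimately show ?thesis using t0Z by (metis order_less_le)
    next
      case False
      then have "-1/2 \<in> I x" unfolding I_def by simp
      then have "-1/2 \<in> Z" unfolding Z_def P_def using x(1) by blast
      then show ?thesis using t0(2) by blast
    qed
    define a where "a = Max {t \<in> Z. t < t0}"
    define b where "b = Min {t \<in> Z. t0 < t}"
    have "a \<in> {t \<in> Z. t < t0}" unfolding a_def using fZ Z2 by (intro Max_in) auto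
    moreover have "b \<in> {t \<in> Z. t0 < t}" unfolding b_def using fZ Z1 t0(3) by (intro Min_in) auto
    ultimately have ab: "a \<in> Z" "b \<in> Z" "a < t0" "t0 < b" by auto
    have noZ: "t \<notin> Z" if "a < t" "t < b" for t
    proof
      assume tZ: "t \<in> Z"
      then have "t < t0 \<or> t0 < t" using t0Z by (metis linorder_neqE)
      then show False
      proof
        assume "t < t0"
        then have "t \<le> a" unfolding a_def using fZ tZ by (intro Max_ge) auto
        then show False using that by simp
      next
        assume "t0 < t"
        then have "b \<le> t" unfolding b_def using fZ tZ by (intro Min_le) auto
        then show False using that by simp
      qed
    qed
    have abI: "a \<in> I x" "b \<in> I x" and abP: "\<gamma> x a \<in> P" "\<gamma> x b \<in> P" using ab unfolding Z_def by auto
    have sub: "{a<..<b} \<subseteq> I x" "{a..b} \<subseteq> I x"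
      using Iint[OF abI] greaterThanLessThan_subseteq_atLeastAtMost_iff by (blast, blast)
    have GN: "\<gamma> x ` {a<..<b} \<subseteq> N"
      using noZ sub arc_chart_subset[OF \<gamma>(2)[OF xT] sub(1)] unfolding N_def Z_def by auto
    have conG: "connectedin T (\<gamma> x ` {a<..<b})"
      by (rule arc_chart_connected[OF \<gamma>(2)[OF xT] sub(1)]) simp
    have kG: "k \<in> \<gamma> x ` {a<..<b}" using t0(4) ab by auto
    have 1: "\<gamma> x ` {a<..<b} \<subseteq> K" using Kmax[OF K conG GN] k kG by blast
    have opG: "openin T (\<gamma> x ` {a<..<b})"
      using arc_chart_open[OF \<gamma>(2)[OF xT], of "{a<..<b}"] sub(1) by (simp add: Int_absorb1)
    have clG: "closedin T (\<gamma> x ` {a..b})"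
      by (rule arc_chart_closed[OF \<gamma>(2)[OF xT] sub(2) _ haus]) simp
    \<comment> \<open>Otherwise the connected set \<open>K\<close> would be split by two disjoint
      open sets, the open arc and the complement of the closed arc; its end points are cut points
      and so not in \<open>K\<close>.\<close>
    have 2: "K \<subseteq> \<gamma> x ` {a<..<b}"
    proof (rule ccontr)
      assume "\<not> K \<subseteq> \<gamma> x ` {a<..<b}"
      then obtain k' where k': "k' \<in> K" "k' \<notin> \<gamma> x ` {a<..<b}" by blast
      have sp: "\<gamma> x ` {a..b} \<subseteq> \<gamma> x ` {a<..<b} \<union> P"
        using abP by (force simp: order_less_le)
      have "K \<subseteq> \<gamma> x ` {a<..<b} \<union> (topspace T - \<gamma> x ` {a..b})"
        using sp Kconn(2)[OF K] unfolding N_def by blast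
      moreover have "k' \<in> (topspace T - \<gamma> x ` {a..b}) \<inter> K"
        using k' sp Kconn(2)[OF K] unfolding N_def by blast
      moreover have "openin T (topspace T - \<gamma> x ` {a..b})" using clG by blast
      moreover have "\<gamma> x ` {a<..<b} \<inter> (topspace T - \<gamma> x ` {a..b}) \<inter> K = {}"
        using greaterThanLessThan_subseteq_atLeastAtMost_iff by fastforce
      ultimately show False
        using Kconn(1)[OF K] opG k kG unfolding connectedin by blast
    qed
    show ?thesis using xT ab abI abP 1 2 by (intro exI[of _ x] exI[of _ a] exI[of _ b]) auto
  qed
  have ends: "{p \<in> P. p \<in> T closure_of K} = {\<gamma> x a, \<gamma> x b}"
    if K: "K \<in> \<K>" and x: "x \<in> topspace T" "a < b" "a \<in> I x" "b \<in> I x" "K = \<gamma> x ` {a<..<b}"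
      "\<gamma> x a \<in> P" "\<gamma> x b \<in> P" for K x a b
  proof -
    have sub: "{a<..<b} \<subseteq> I x" "{a..b} \<subseteq> I x"
      using Iint[OF x(3,4)] greaterThanLessThan_subseteq_atLeastAtMost_iff by (blast, blast)
    have "T closure_of K \<subseteq> \<gamma> x ` {a..b}"
      unfolding x(5) by (intro closure_of_minimal arc_chart_closed[OF \<gamma>(2)[OF x(1)] sub(2) _ haus]) auto
    moreover have "\<gamma> x ` {a<..<b} \<inter> P = {}" using Kconn(2)[OF K] unfolding x(5) N_def by blast
    moreover have "\<gamma> x a \<in> T closure_of K" "\<gamma> x b \<in> T closure_of K"
      unfolding x(5) using x sub by (auto intro!: arc_chart_closure[OF \<gamma>(2)[OF x(1)]])
    moreover have "\<gamma> x ` {a..b} \<subseteq> \<gamma> x ` {a<..<b} \<union> {\<gamma> x a, \<gamma> x b}"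
      by (force simp: order_less_le)
    ultimately show ?thesis using x(6,7) by blast
  qed
  have two_ends: "card {p \<in> P. p \<in> T closure_of K} = 2" if K: "K \<in> \<K>" for K
  proof -
    obtain x a b where x: "x \<in> topspace T" "a < b" "a \<in> I x" "b \<in> I x" "K = \<gamma> x ` {a<..<b}"
      "\<gamma> x a \<in> P" "\<gamma> x b \<in> P" using arc[OF K] by blast
    have "\<gamma> x a \<noteq> \<gamma> x b" using inj_onD[OF inj[OF x(1)] _ x(3,4)] x(2) by auto
    then show ?thesis unfolding ends[OF K x] by simp
  qed
  \<comment> \<open>A side of a cut point that avoids the other cut points lies in a single
    component, which accumulates at the point.\<close>
  have side: "\<exists>K\<in>\<K>. \<gamma> p ` S \<subseteq> K \<and> p \<in> T closure_of K"
    if p: "p \<in> P" and S: "S \<subseteq> I p" "connected S" "S \<noteq> {}" "0 \<in> closure S" "\<And>t. t \<in> S \<Longrightarrow> \<gamma> p t \<notin> P" for p S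
  proof -
    have pT: "p \<in> topspace T" using p Psub by blast
    have "\<gamma> p ` S \<subseteq> N" using S(5) arc_chart_subset[OF \<gamma>(2)[OF pT] S(1)] unfolding N_def by blast
    then obtain K where K: "K \<in> \<K>" "\<gamma> p ` S \<subseteq> K"
      using Kex[OF arc_chart_connected[OF \<gamma>(2)[OF pT] S(1,2)]] S(3) by blast
    have "p \<in> T closure_of (\<gamma> p ` S)"
      using arc_chart_closure[OF \<gamma>(2)[OF pT] S(1) I0 S(4)] \<gamma>(1)[OF pT] by simp
    then show ?thesis using K closure_of_mono by blast
  qed
  have radius: "\<exists>\<epsilon>. 0 < \<epsilon> \<and> \<epsilon> < 1 \<and> (\<forall>t\<in>I p. \<bar>t\<bar> < \<epsilon> \<longrightarrow> \<gamma> p t \<in> P \<longrightarrow> t = 0)" if p: "p \<in> P" for p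
  proof -
    have pT: "p \<in> topspace T" using p Psub by blast
    obtain \<epsilon> where "0 < \<epsilon>" "\<epsilon> < 1" "\<And>t. t \<in> {t \<in> I p. \<gamma> p t \<in> P} \<Longrightarrow> t \<noteq> 0 \<Longrightarrow> \<epsilon> < \<bar>t\<bar>"
      using finite_avoid_radius[OF finZ[OF pT]] by metis
    then show ?thesis by (intro exI[of _ \<epsilon>]) fastforce
  qed
  \<comment> \<open>A component accumulating at \<open>p\<close> meets a punctured chart
    neighbourhood of \<open>p\<close>, hence is the component of one of its sides.\<close>
  have near: "K \<inter> \<gamma> p ` (I p \<inter> {-\<epsilon><..<\<epsilon>} - {0}) \<noteq> {}"
    if p: "p \<in> P" and K: "K \<in> \<K>" "p \<in> T closure_of K" and e: "0 < \<epsilon>" for p K \<epsilon>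
  proof -
    have pT: "p \<in> topspace T" using p Psub by blast
    let ?V = "\<gamma> p ` (I p \<inter> {-\<epsilon><..<\<epsilon>})"
    have "openin T ?V" by (rule arc_chart_open[OF \<gamma>(2)[OF pT]]) simp
    moreover have "p \<in> ?V"
      using I0 e \<gamma>(1)[OF pT] by (intro image_eqI[of _ _ 0]) auto
    ultimately have "\<exists>k. k \<in> K \<and> k \<in> ?V"
      using spec[OF conjunct2[OF K(2)[unfolded in_closure_of]], of ?V] by blast
    then obtain k where k: "k \<in> K" "k \<in> ?V" by (elim exE conjE)
    obtain t where t: "t \<in> I p" "-\<epsilon> < t" "t < \<epsilon>" "k = \<gamma> p t" using k(2) by auto
    have "k \<noteq> p" using k Kconn(2)[OF K(1)] p unfolding N_def by blast
    then have "t \<noteq> 0" using t(4) \<gamma>(1)[OF pT] by auto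
    then have "k \<in> \<gamma> p ` (I p \<inter> {-\<epsilon><..<\<epsilon>} - {0})" using t by auto
    then show ?thesis using k(1) by (intro notI) auto
  qed
  have Keq: "K = K'" if "K \<in> \<K>" "K' \<in> \<K>" "K \<inter> K' \<noteq> {}" for K K'
    using Kmax[OF that(1) Kconn(1,2)[OF that(2)]] Kmax[OF that(2) Kconn(1,2)[OF that(1)]] that(3) by blast
  have degree_y: "card {K \<in> \<K>. y \<in> T closure_of K} = 1"
  proof -
    obtain \<epsilon> where \<epsilon>: "0 < \<epsilon>" "\<epsilon> < 1" "\<And>t. t \<in> I y \<Longrightarrow> \<bar>t\<bar> < \<epsilon> \<Longrightarrow> \<gamma> y t \<in> P \<Longrightarrow> t = 0"
      using radius[OF yP] by blast
    have Iy: "I y = {0..<1}" unfolding I_def by simp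
    obtain K where K: "K \<in> \<K>" "\<gamma> y ` {0<..<\<epsilon>} \<subseteq> K" "y \<in> T closure_of K"
    proof -
      have "\<exists>K\<in>\<K>. \<gamma> y ` {0<..<\<epsilon>} \<subseteq> K \<and> y \<in> T closure_of K"
      proof (rule side[OF yP])
        show "{0<..<\<epsilon>} \<subseteq> I y" "{0<..<\<epsilon>} \<noteq> {}" "0 \<in> closure {0<..<\<epsilon>}" using \<epsilon> Iy by auto
        show "\<gamma> y t \<notin> P" if "t \<in> {0<..<\<epsilon>}" for t using \<epsilon>(3)[of t] that \<epsilon>(2) Iy by auto
      qed simp
      then show ?thesis using that by blast
    qed
    have "K' = K" if "K' \<in> \<K>" "y \<in> T closure_of K'" for K'
    proof -
      have "I y \<inter> {-\<epsilon><..<\<epsilon>} - {0} \<subseteq> {0<..<\<epsilon>}" unfolding Iy by auto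
      then have "\<gamma> y ` (I y \<inter> {-\<epsilon><..<\<epsilon>} - {0}) \<subseteq> K" using K(2) by blast
      then show ?thesis using near[OF yP that \<epsilon>(1)] Keq[OF that(1) K(1)] by blast
    qed
    then have "{K \<in> \<K>. y \<in> T closure_of K} = {K}" using K by blast
    then show ?thesis by simp
  qed
  have degree: "card {K \<in> \<K>. p \<in> T closure_of K} = 2" if p: "p \<in> P" "p \<noteq> y" for p
  proof -
    have pT: "p \<in> topspace T" using p Psub by blast
    obtain \<epsilon> where \<epsilon>: "0 < \<epsilon>" "\<epsilon> < 1" "\<And>t. t \<in> I p \<Longrightarrow> \<bar>t\<bar> < \<epsilon> \<Longrightarrow> \<gamma> p t \<in> P \<Longrightarrow> t = 0"
      using radius[OF p(1)] by blast
    have Ip: "I p = {-1<..<1}" unfolding I_def using p by simp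
    obtain K where K: "K \<in> \<K>" "\<gamma> p ` {0<..<\<epsilon>} \<subseteq> K" "p \<in> T closure_of K"
    proof -
      have "\<exists>K\<in>\<K>. \<gamma> p ` {0<..<\<epsilon>} \<subseteq> K \<and> p \<in> T closure_of K"
      proof (rule side[OF p(1)])
        show "{0<..<\<epsilon>} \<subseteq> I p" "{0<..<\<epsilon>} \<noteq> {}" "0 \<in> closure {0<..<\<epsilon>}" using \<epsilon> Ip by auto
        show "\<gamma> p t \<notin> P" if "t \<in> {0<..<\<epsilon>}" for t using \<epsilon>(3)[of t] that \<epsilon>(2) Ip by auto
      qed simp
      then show ?thesis using that by blast
    qed
    obtain K' where K': "K' \<in> \<K>" "\<gamma> p ` {-\<epsilon><..<0} \<subseteq> K'" "p \<in> T closure_of K'"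
    proof -
      have "\<exists>K\<in>\<K>. \<gamma> p ` {-\<epsilon><..<0} \<subseteq> K \<and> p \<in> T closure_of K"
      proof (rule side[OF p(1)])
        show "{-\<epsilon><..<0} \<subseteq> I p" "{-\<epsilon><..<0} \<noteq> {}" "0 \<in> closure {-\<epsilon><..<0}" using \<epsilon> Ip by auto
        show "\<gamma> p t \<notin> P" if "t \<in> {-\<epsilon><..<0}" for t using \<epsilon>(3)[of t] that \<epsilon>(2) Ip by auto
      qed simp
      then show ?thesis using that by blast
    qed
    have split: "I p \<inter> {-\<epsilon><..<\<epsilon>} - {0} = {0<..<\<epsilon>} \<union> {-\<epsilon><..<0}" unfolding Ip using \<epsilon> by auto
    have "K'' = K \<or> K'' = K'" if "K'' \<in> \<K>" "p \<in> T closure_of K''" for K''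
      using near[OF p(1) that \<epsilon>(1)] Keq[OF that(1) K(1)] Keq[OF that(1) K'(1)] K(2) K'(2)
      unfolding split by blast
    then have eq: "{K \<in> \<K>. p \<in> T closure_of K} = {K, K'}" using K K' by blast
    \<comment> \<open>If one component held both sides of \<open>p\<close>, then \<open>p\<close>
      would be an end of the arc \<open>K\<close>. A neighbourhood of \<open>p\<close> without
      \<open>p\<close> would then be, in the chart of the arc, an interval without an end point and
      so connected, while in the chart at \<open>p\<close> it falls into two pieces.\<close>
    have "K \<noteq> K'"
    proof
      assume KK: "K = K'"
      obtain x a b where x: "x \<in> topspace T" "a < b" "a \<in> I x" "b \<in> I x" "K = \<gamma> x ` {a<..<b}"
        "\<gamma> x a \<in> P" "\<gamma> x b \<in> P" using arc[OF K(1)] by blast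
      have "p \<in> {\<gamma> x a, \<gamma> x b}" using ends[OF K(1) x] p(1) K(3) by blast
      then obtain c where c: "p = \<gamma> x c" "c = a \<or> c = b" by blast
      have cI: "c \<in> I x" using c x by blast
      have sub: "{a..b} \<subseteq> I x" by (rule Iint[OF x(3,4)])
      let ?J = "\<gamma> p ` {-\<epsilon><..<\<epsilon>}"
      have Jp: "?J = insert p (\<gamma> p ` ({0<..<\<epsilon>} \<union> {-\<epsilon><..<0}))"
      proof -
        have "{-\<epsilon><..<\<epsilon>} = insert 0 ({0<..<\<epsilon>} \<union> {-\<epsilon><..<0})" using \<epsilon> by auto
        then show ?thesis using \<gamma>(1)[OF pT] by simp
      qed
      have Jsub: "?J \<subseteq> \<gamma> x ` {a..b}"
      proof -
        have "\<gamma> p ` ({0<..<\<epsilon>} \<union> {-\<epsilon><..<0}) \<subseteq> K" using K(2) K'(2) KK by blast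
        moreover have "K \<subseteq> \<gamma> x ` {a..b}" unfolding x(5) by (intro image_mono) auto
        moreover have "p \<in> \<gamma> x ` {a..b}" using c x(2) by auto
        ultimately show ?thesis unfolding Jp by blast
      qed
      define S where "S = {t \<in> {a..b}. \<gamma> x t \<in> ?J}"
      have SJ: "\<gamma> x ` S = ?J"
      proof
        show "\<gamma> x ` S \<subseteq> ?J" unfolding S_def by (rule image_subsetI) simp
        show "?J \<subseteq> \<gamma> x ` S"
        proof
          fix z assume z: "z \<in> ?J"
          then obtain t where "t \<in> {a..b}" "z = \<gamma> x t" using subsetD[OF Jsub] by (metis imageE)
          then show "z \<in> \<gamma> x ` S" unfolding S_def using z by (intro image_eqI[of _ _ t]) simp_all
        qed
      qed
      have SI: "S \<subseteq> I x" unfolding S_def using sub by blast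
      have conJ: "connectedin T ?J"
        by (rule arc_chart_connected[OF \<gamma>(2)[OF pT]]) (use \<epsilon> Ip in auto)
      have "connected S" by (rule arc_chart_connected_preimage[OF \<gamma>(2)[OF x(1)] SI]) (simp add: SJ conJ)
      then have conv: "convex S" by (simp add: is_interval_connected_1[symmetric] is_interval_convex_1)
      have "S \<subseteq> {a..b}" unfolding S_def by (rule Collect_restrict)
      then have Sab: "a \<le> t" "t \<le> b" if "t \<in> S" for t using that by auto
      have "convex (S - {c})"
        using c(2)
      proof
        assume "c = a"
        then have "S - {c} = S \<inter> {a<..}" using Sab(1) by (auto simp: order_less_le)
        then show ?thesis using conv by (simp add: convex_Int)
      next
        assume "c = b"
        then have "S - {c} = S \<inter> {..<b}" using Sab(2) by (auto simp: order_less_le)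
        then show ?thesis using conv by (simp add: convex_Int)
      qed
      then have conS: "connected (S - {c})" by (rule convex_connected)
      have im: "\<gamma> x ` (S - {c}) = ?J - {p}"
        using inj_on_image_set_diff[OF inj[OF x(1)], of S "{c}"] SI SJ c(1) cI by (simp add: Diff_subset[THEN order_trans])
      have sub\<epsilon>: "{-\<epsilon><..<\<epsilon>} - {0} \<subseteq> I p" using \<epsilon> Ip by auto
      have "\<gamma> p ` ({-\<epsilon><..<\<epsilon>} - {0}) = ?J - {p}"
        using inj_on_image_set_diff[OF inj[OF pT] sub\<epsilon>] \<gamma>(1)[OF pT] I0 by simp
      moreover have "connectedin T (\<gamma> x ` (S - {c}))"
        by (rule arc_chart_connected[OF \<gamma>(2)[OF x(1)] _ conS]) (use SI in blast)
      ultimately have "connectedin T (\<gamma> p ` ({-\<epsilon><..<\<epsilon>} - {0}))"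
        unfolding im by simp
      then have con: "connected ({-\<epsilon><..<\<epsilon>} - {0})"
        by (rule arc_chart_connected_preimage[OF \<gamma>(2)[OF pT] sub\<epsilon>])
      have "-\<epsilon>/2 \<in> {-\<epsilon><..<\<epsilon>} - {0}" "\<epsilon>/2 \<in> {-\<epsilon><..<\<epsilon>} - {0}" using \<epsilon> by auto
      then have "0 \<in> {-\<epsilon><..<\<epsilon>} - {0}"
        using connectedD_interval[OF con, of "-\<epsilon>/2" "\<epsilon>/2" 0] \<epsilon> by simp
      then show False by simp
    qed
    then show ?thesis unfolding eq by simp
  qed
  have fin\<K>: "finite \<K>"
  proof -
    have "\<K> \<subseteq> (\<Union>p\<in>P. {K \<in> \<K>. p \<in> T closure_of K})"
    proof
      fix K assume K: "K \<in> \<K>"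
      have "{p \<in> P. p \<in> T closure_of K} \<noteq> {}" using two_ends[OF K] by (metis card.empty zero_neq_numeral)
      then show "K \<in> (\<Union>p\<in>P. {K \<in> \<K>. p \<in> T closure_of K})" using K by blast
    qed
    moreover have "finite {K \<in> \<K>. p \<in> T closure_of K}" if "p \<in> P" for p
      using degree[OF that] degree_y by (cases "p = y") (auto intro: card_ge_0_finite)
    ultimately show ?thesis using finP by (meson finite_UN finite_subset)
  qed
  \<comment> \<open>Incidences of cut points and arcs are counted both ways: the arcs give an even
    number, the cut points an odd one.\<close>
  have "(\<Sum>p\<in>P. card {K \<in> \<K>. p \<in> T closure_of K}) = (\<Sum>K\<in>\<K>. 2)"
    by (rule sum_multicount_gen[OF finP fin\<K>]) (use two_ends in auto)
  moreover have "(\<Sum>p\<in>P. card {K \<in> \<K>. p \<in> T closure_of K}) = 1 + (\<Sum>p\<in>P - {y}. 2)"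
    using degree degree_y by (simp add: sum.remove[OF finP yP])
  ultimately have "2 * card \<K> = 1 + 2 * card (P - {y})" by simp
  then show False by presburger
qed

section \<open>Submersions onto a hyperplane\<close>

definition hyp :: "'v::euclidean_space \<Rightarrow> 'v set" where "hyp e = {z. z \<bullet> e = 0}"

lemma closed_hyp: "closed (hyp e)"
  unfolding hyp_def by (intro closed_Collect_eq continuous_intros)

lemma dim_hyp: "e \<noteq> 0 \<Longrightarrow> dim (hyp (e::'v::euclidean_space)) = DIM('v) - 1"
  unfolding hyp_def using dim_hyperplane[of e] by (simp add: inner_commute)

lemma derivative_into_hyp:
  assumes "open W" "p \<in> W" "\<And>p. p \<in> W \<Longrightarrow> g p \<bullet> e = 0" "(g has_derivative g') (at p)"
  shows "g' v \<bullet> e = 0"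
proof -
  have "((\<lambda>q. g q \<bullet> e) has_derivative (\<lambda>v. g' v \<bullet> e)) (at p)"
    by (rule bounded_linear.has_derivative[OF bounded_linear_inner_left assms(4)])
  moreover have "((\<lambda>q. g q \<bullet> e) has_derivative (\<lambda>v. 0)) (at p)"
    by (rule has_derivative_transform_within_open[OF has_derivative_const[of 0] assms(1,2)])
      (simp add: assms(3))
  ultimately show ?thesis using has_derivative_unique by metis
qed

lemma Ck_on_2_has_derivative:
  "Ck_on 2 f W \<Longrightarrow> p \<in> W \<Longrightarrow> (f has_derivative frechet_derivative f (at p)) (at p)"
  by (rule Ck_on_has_derivative[of 1]) (simp_all only: numeral_2_eq_2 One_nat_def)

lemma Sard_hyperplane:
  fixes g :: "'v::euclidean_space \<Rightarrow> 'v"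
  assumes W: "open W" and g: "Ck_on 2 g W" and e: "e \<noteq> 0" and ge: "\<And>p. p \<in> W \<Longrightarrow> g p \<bullet> e = 0"
    and P: "openin (top_of_set (hyp e)) P"
      "P \<subseteq> g ` {p \<in> W. range (frechet_derivative g (at p)) \<noteq> hyp e}"
  shows "P = {}"
proof -
  \<comment> \<open>Adding the normal direction gives a map onto the whole space, critical exactly over the critical points of \<open>g\<close>.\<close>
  define f where "f x = g (fst x) + snd x *\<^sub>R e" for x :: "'v \<times> real"
  let ?S = "{p \<in> W. range (frechet_derivative g (at p)) \<noteq> hyp e}"
  have oW: "open (W \<times> (UNIV :: real set))" using W by (intro open_Times) auto
  have "Ck_on 2 (\<lambda>x :: 'v \<times> real. snd x *\<^sub>R e) (W \<times> UNIV)"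
    by (rule Ck_on_bounded_linear[OF bounded_linear_compose[OF bounded_linear_scaleR_left
            bounded_linear_snd] oW])
  moreover have "Ck_on 2 (\<lambda>x :: 'v \<times> real. g (fst x)) (W \<times> UNIV)"
    by (rule Ck_on_compose[OF oW W _ Ck_on_bounded_linear[OF bounded_linear_fst oW] g]) auto
  ultimately have f: "Ck_on 2 f (W \<times> UNIV)"
    unfolding f_def by (intro Ck_on_add oW)
  let ?C = "{x \<in> W \<times> UNIV. range (frechet_derivative f (at x)) \<noteq> UNIV}"
  have neg: "negligible (f ` ?C)"
    by (rule Sard_corank_one[OF oW f]) simp
  have sub: "?S \<times> UNIV \<subseteq> ?C"
  proof
    fix x :: "'v \<times> real" assume "x \<in> ?S \<times> UNIV"
    then obtain p t where x: "x = (p, t)" and p: "p \<in> W"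
      and ne: "range (frechet_derivative g (at p)) \<noteq> hyp e" by blast
    let ?D = "frechet_derivative g (at p)"
    have D: "(g has_derivative ?D) (at p)" by (rule Ck_on_2_has_derivative[OF g p])
    have De: "?D v \<bullet> e = 0" for v by (rule derivative_into_hyp[OF W p ge D])
    have "(f has_derivative (\<lambda>h. ?D (fst h) + snd h *\<^sub>R e)) (at (p, t))"
      unfolding f_def
      by (intro has_derivative_add has_derivative_scaleR_left has_derivative_snd has_derivative_ident
          has_derivative_compose[where f = fst and g = g and f' = fst])
        (auto intro: D has_derivative_fst)
    then have fd: "frechet_derivative f (at (p, t)) = (\<lambda>h. ?D (fst h) + snd h *\<^sub>R e)"
      by (rule frechet_derivative_at[symmetric])
    have "range (frechet_derivative f (at (p, t))) \<noteq> UNIV"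
    proof
      assume all: "range (frechet_derivative f (at (p, t))) = UNIV"
      have "z \<in> range ?D" if "z \<in> hyp e" for z
      proof -
        have "z \<in> range (frechet_derivative f (at (p, t)))" unfolding all by (rule UNIV_I)
        then obtain h where h: "z = ?D (fst h) + snd h *\<^sub>R e" unfolding fd by (rule rangeE)
        then have "snd h * (e \<bullet> e) = 0" using De[of "fst h"] \<open>z \<in> hyp e\<close> unfolding hyp_def
          by (simp add: inner_add_left)
        then show ?thesis using h e by auto
      qed
      moreover have "range ?D \<subseteq> hyp e" using De unfolding hyp_def by auto
      ultimately show False using ne by blast
    qed
    then show "x \<in> ?C" using p x by simp
  qed
  \<comment> \<open>The orthogonal projection turns the relatively open set \<open>P\<close> into an
    open cylinder, which lies in a negligible set only if it is empty.\<close>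
  define pr where "pr z = z - ((z \<bullet> e) / (e \<bullet> e)) *\<^sub>R e" for z
  have pr: "pr z \<in> hyp e" for z unfolding pr_def hyp_def using e by (simp add: inner_diff_left)
  have "continuous_on UNIV pr" unfolding pr_def by (intro continuous_intros) (use e in auto)
  then have "openin (top_of_set UNIV) (UNIV \<inter> pr -` P)"
    by (rule continuous_openin_preimage[OF _ _ P(1)]) (use pr in auto)
  then have oP: "open (pr -` P)" by simp
  have "pr -` P \<subseteq> f ` (?S \<times> UNIV)"
  proof
    fix z assume "z \<in> pr -` P"
    then have "pr z \<in> g ` ?S" using P(2) by (simp only: vimage_eq) (rule subsetD)
    then obtain p where p: "p \<in> ?S" "pr z = g p" by (rule imageE) (rule that)
    have "z = pr z + ((z \<bullet> e) / (e \<bullet> e)) *\<^sub>R e" unfolding pr_def by simp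
    then have "z = f (p, (z \<bullet> e) / (e \<bullet> e))" unfolding f_def using p by simp
    then show "z \<in> f ` (?S \<times> UNIV)" using p by blast
  qed
  then have "negligible (pr -` P)"
    using negligible_subset[OF neg] image_mono[OF sub, of f] by (meson order_trans)
  then have "pr -` P = {}" using open_not_negligible[OF oP] by blast
  moreover have "pr z = z" if "z \<in> P" for z
    using openin_subset[OF P(1)] that unfolding pr_def hyp_def by auto
  ultimately show "P = {}" by blast
qed

lemma kernel_of_submersion:
  fixes L :: "'v::euclidean_space \<Rightarrow> 'v"
  assumes L: "linear L" and e: "e \<noteq> 0" and R: "range L = hyp e"
  obtains k where "k \<noteq> 0" "\<And>v. L v = 0 \<longleftrightarrow> v \<in> span {k}"
proof -
  have "dim {x. L x = 0} = 1"
    using dim_kernel_range(1)[OF L] dim_hyp[OF e] DIM_positive[where 'a = 'v] unfolding R by linarith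
  then obtain B where B: "independent B" "card B = 1" "span B = {x. L x = 0}"
    using orthonormal_basis_subspace[OF kernel_subspace[OF L]] by metis
  then obtain k where "B = {k}" using card_1_singletonE by blast
  then show ?thesis using that[of k] B by auto
qed

section \<open>Finite groups of linear maps\<close>

text \<open>Averaging over the group preserves the value of \<open>L\<close>, so a vector and its
  average differ by a multiple of \<open>k\<close>: the fixed space and \<open>k\<close> span
  everything. If \<omega> is positive on \<open>k\<close> and nonnegative on its orbit, the average
  of \<open>k\<close> is a nonzero multiple of \<open>k\<close>, so \<open>k\<close> is fixed as
  well. For a half-space \<omega> is the inward normal coordinate, up to the orientation of
  \<open>k\<close>.\<close>

lemma finite_group_invariant_submersion:
  fixes G (structure) and \<rho> :: "'g \<Rightarrow> 'v::euclidean_space \<Rightarrow> 'v"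
  assumes G: "group G" "finite (carrier G)"
    and lin: "\<And>g. g \<in> carrier G \<Longrightarrow> linear (\<rho> g)"
    and mult: "\<And>g h v. g \<in> carrier G \<Longrightarrow> h \<in> carrier G \<Longrightarrow> \<rho> (g \<otimes> h) v = \<rho> g (\<rho> h v)"
    and one: "\<And>v. \<rho> \<one> v = v"
    and L: "linear L" "\<And>g v. g \<in> carrier G \<Longrightarrow> L (\<rho> g v) = L v"
    and k: "k \<noteq> 0" "\<And>v. L v = 0 \<longleftrightarrow> v \<in> span {k}"
  defines "F \<equiv> {v. \<forall>g\<in>carrier G. \<rho> g v = v}"
  shows "F = UNIV \<or> dim F = DIM('v) - 1"
    and "\<lbrakk>linear \<omega>; \<omega> k > (0::real); \<And>g. g \<in> carrier G \<Longrightarrow> \<omega> (\<rho> g k) \<ge> 0\<rbrakk> \<Longrightarrow> F = UNIV"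
proof -
  interpret group G by (rule G)
  define N where "N = real (card (carrier G))"
  have N: "N > 0" unfolding N_def using G(2) one_closed by (auto simp: card_gt_0_iff)
  define avg where "avg v = (1 / N) *\<^sub>R (\<Sum>g\<in>carrier G. \<rho> g v)" for v
  have avgF: "avg v \<in> F" for v
  proof -
    have "\<rho> h (avg v) = avg v" if h: "h \<in> carrier G" for h
    proof -
      have "\<rho> h (avg v) = (1 / N) *\<^sub>R (\<Sum>g\<in>carrier G. \<rho> (h \<otimes> g) v)"
        unfolding avg_def using h by (simp add: linear_cmul[OF lin] linear_sum[OF lin] mult)
      also have "(\<Sum>g\<in>carrier G. \<rho> (h \<otimes> g) v) = (\<Sum>g\<in>carrier G. \<rho> g v)"
        by (rule sum.reindex_bij_betw[of "\<lambda>g. h \<otimes> g"]) (use h in \<open>auto simp: bij_betw_def inj_on_cmult surj_const_mult\<close>)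
      finally show ?thesis unfolding avg_def .
    qed
    then show ?thesis unfolding F_def by blast
  qed
  have Lavg: "L (avg v) = L v" for v
  proof -
    have "L (avg v) = (1 / N) *\<^sub>R (\<Sum>g\<in>carrier G. L v)"
      unfolding avg_def by (simp add: linear_cmul[OF L(1)] linear_sum[OF L(1)] L(2))
    also have "\<dots> = L v" unfolding sum_constant_scaleR using N unfolding N_def by simp
    finally show ?thesis .
  qed
  have subF: "subspace F"
    unfolding F_def subspace_def by (auto simp: linear_0[OF lin] linear_add[OF lin] linear_cmul[OF lin])
  have span: "v \<in> span (insert k F)" for v
  proof -
    have "L (v - avg v) = 0" by (simp add: linear_diff[OF L(1)] Lavg)
    then have "v - avg v \<in> span (insert k F)" using k(2) span_mono[of "{k}" "insert k F"] by blast
    moreover have "avg v \<in> span (insert k F)" using avgF by (simp add: span_base)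
    ultimately have "(v - avg v) + avg v \<in> span (insert k F)" by (rule span_add)
    then show ?thesis by simp
  qed
  then have full: "span (insert k F) = UNIV" by blast
  show "F = UNIV \<or> dim F = DIM('v) - 1"
  proof -
    have "DIM('v) \<le> dim (insert k F)" using full by (metis dim_UNIV dim_span order_refl)
    then have "DIM('v) - 1 \<le> dim F" by (simp add: dim_insert split: if_splits)
    moreover have "dim F \<le> DIM('v)" by (rule dim_subset_UNIV)
    moreover have "F = UNIV" if "dim F = DIM('v)" using that subF by (metis dim_eq_full span_eq_iff)
    ultimately show ?thesis by linarith
  qed
  assume \<omega>: "linear \<omega>" "\<omega> k > (0::real)" "\<And>g. g \<in> carrier G \<Longrightarrow> \<omega> (\<rho> g k) \<ge> 0"
  have "L (avg k) = 0" using Lavg[of k] k(2)[of k] by (simp add: span_base)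
  then obtain c where c: "avg k = c *\<^sub>R k" using k(2) by (auto simp: span_singleton)
  have "(\<Sum>g\<in>carrier G. \<omega> (\<rho> g k)) \<ge> \<omega> (\<rho> \<one> k)"
    using \<omega>(3) by (intro member_le_sum G(2)) auto
  then have "\<omega> (avg k) > 0"
    unfolding avg_def using N \<omega>(2) by (simp add: linear_cmul[OF \<omega>(1)] linear_sum[OF \<omega>(1)] one)
  then have "c \<noteq> 0" unfolding c by (auto simp: linear_cmul[OF \<omega>(1)] linear_0[OF \<omega>(1)])
  then have "k = (1 / c) *\<^sub>R avg k" unfolding c by simp
  then have "k \<in> F" using avgF[of k] subF subspace_scale by metis
  then have "insert k F = F" by blast
  then show "F = UNIV" using full subF by (metis span_eq_iff)
qed

text \<open>The sum \<open>A\<close> over the group is invariant and close to a positive multiple of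
  the identity near \<open>z0\<close>, hence injective there. As \<open>A\<close> agrees at
  \<open>u\<close> and \<open>\<alpha> g u\<close>, these points coincide. Derivatives are taken of
  extensions because \<open>Z\<close> may be a half-space.\<close>

lemma finite_action_trivial_near:
  fixes G (structure) and \<alpha> :: "'g \<Rightarrow> 'v::euclidean_space \<Rightarrow> 'v"
  assumes G: "group G" "finite (carrier G)" and z0: "z0 \<in> Z"
    and maps: "\<And>g u. g \<in> carrier G \<Longrightarrow> u \<in> Z \<Longrightarrow> \<alpha> g u \<in> Z"
    and mult: "\<And>g h u. g \<in> carrier G \<Longrightarrow> h \<in> carrier G \<Longrightarrow> u \<in> Z \<Longrightarrow> \<alpha> (g \<otimes> h) u = \<alpha> g (\<alpha> h u)"
    and fixp: "\<And>g. g \<in> carrier G \<Longrightarrow> \<alpha> g z0 = z0"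
    and smooth: "\<And>g. g \<in> carrier G \<Longrightarrow> \<exists>W f. open W \<and> z0 \<in> W \<and> Ck_on 2 f W \<and>
        (\<forall>u\<in>W \<inter> Z. f u = \<alpha> g u) \<and> (\<forall>v. frechet_derivative f (at z0) v = v)"
  obtains V where "open V" "z0 \<in> V" "\<And>g u. g \<in> carrier G \<Longrightarrow> u \<in> V \<inter> Z \<Longrightarrow> \<alpha> g u = u"
proof -
  interpret group G by (rule G)
  have "\<exists>r>0. \<forall>p\<in>ball z0 r \<inter> Z. \<forall>q\<in>ball z0 r \<inter> Z.
      norm (\<alpha> g q - \<alpha> g p - (q - p)) \<le> (1/2) * norm (q - p)" if g: "g \<in> carrier G" for g
  proof -
    obtain W f where Wf: "open W" "z0 \<in> W" "Ck_on 2 f W" "\<And>u. u \<in> W \<Longrightarrow> u \<in> Z \<Longrightarrow> f u = \<alpha> g u"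
      "\<And>v. frechet_derivative f (at z0) v = v" using smooth[OF g] by blast
    interpret C2_map f W by unfold_locales fact+
    have D: "D z0 v = v" for v unfolding D_def by (rule Wf(5))
    obtain r where "r > 0" "ball z0 r \<subseteq> W"
      "\<And>p q. p \<in> ball z0 r \<Longrightarrow> q \<in> ball z0 r \<Longrightarrow> norm (f q - f p - D z0 (q - p)) \<le> (1/2) * norm (q - p)"
      using strict_derivative[OF Wf(2), of "1/2"] by (metis half_gt_zero_iff zero_less_one)
    note r = this
    have "norm (\<alpha> g q - \<alpha> g p - (q - p)) \<le> (1/2) * norm (q - p)"
      if "p \<in> ball z0 r \<inter> Z" "q \<in> ball z0 r \<inter> Z" for p q
      using r(3)[of p q] r(2) that Wf(4)[of p] Wf(4)[of q] unfolding D by (auto simp: subset_iff)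
    then show ?thesis using r(1) by blast
  qed
  then obtain r where r: "\<And>g. g \<in> carrier G \<Longrightarrow> r g > 0"
    "\<And>g p q. g \<in> carrier G \<Longrightarrow> p \<in> ball z0 (r g) \<inter> Z \<Longrightarrow> q \<in> ball z0 (r g) \<inter> Z \<Longrightarrow>
      norm (\<alpha> g q - \<alpha> g p - (q - p)) \<le> (1/2) * norm (q - p)" by metis
  define R where "R = Min (r ` carrier G)"
  have ne: "carrier G \<noteq> {}" using one_closed by blast
  have R: "R > 0" "\<And>g. g \<in> carrier G \<Longrightarrow> R \<le> r g"
    unfolding R_def using r(1) G(2) ne by (auto simp: Min_gr_iff)
  have est: "norm (\<alpha> g q - \<alpha> g p - (q - p)) \<le> (1/2) * norm (q - p)"
    if "g \<in> carrier G" "p \<in> ball z0 R" "p \<in> Z" "q \<in> ball z0 R" "q \<in> Z" for g p q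
    using r(2)[of g p q] R(2)[of g] that by auto
  have z0R: "z0 \<in> ball z0 R" using R by simp
  define A where "A u = (\<Sum>g\<in>carrier G. \<alpha> g u)" for u
  have Ainv: "A (\<alpha> h u) = A u" if "h \<in> carrier G" "u \<in> Z" for h u
  proof -
    have "A (\<alpha> h u) = (\<Sum>g\<in>carrier G. \<alpha> (g \<otimes> h) u)"
      unfolding A_def using that by (intro sum.cong) (auto simp: mult)
    also have "\<dots> = A u" unfolding A_def
    proof (rule sum.reindex_bij_betw[of "\<lambda>g. g \<otimes> h"])
      show "bij_betw (\<lambda>g. g \<otimes> h) (carrier G) (carrier G)"
        by (rule bij_betw_byWitness[where f' = "\<lambda>g. g \<otimes> inv h"])
          (use that(1) in \<open>auto simp: m_assoc\<close>)
    qed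
    finally show ?thesis .
  qed
  have Ainj: "p = q" if "p \<in> ball z0 R" "p \<in> Z" "q \<in> ball z0 R" "q \<in> Z" "A p = A q" for p q
  proof -
    have N: "real (card (carrier G)) > 0" using G(2) ne by (simp add: card_gt_0_iff)
    have "norm (\<Sum>g\<in>carrier G. \<alpha> g q - \<alpha> g p - (q - p)) \<le> (\<Sum>g\<in>carrier G. (1/2) * norm (q - p))"
      using est that by (intro order_trans[OF norm_sum sum_mono]) auto
    moreover have "(\<Sum>g\<in>carrier G. \<alpha> g q - \<alpha> g p - (q - p)) = - (real (card (carrier G)) *\<^sub>R (q - p))"
      using that(5) unfolding A_def sum_subtractf by (simp add: sum_constant_scaleR algebra_simps)
    ultimately have "card (carrier G) * norm (q - p) \<le> card (carrier G) * ((1/2) * norm (q - p))" by simp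
    then have "norm (q - p) \<le> (1/2) * norm (q - p)" using N by (simp only: mult_le_cancel_left_pos)
    then show ?thesis by simp
  qed
  show ?thesis
  \<comment> \<open>Near \<open>z0\<close> the action at most doubles the distance to
    \<open>z0\<close>, so half the radius keeps \<open>\<alpha> g u\<close> where \<open>A\<close>
    is injective.\<close>
  proof (rule that[of "ball z0 (R / 2)"])
    show "z0 \<in> ball z0 (R / 2)" using R by simp
    fix g u assume g: "g \<in> carrier G" and u: "u \<in> ball z0 (R / 2) \<inter> Z"
    have uR: "u \<in> ball z0 R" "u \<in> Z" using u R by auto
    have "norm (\<alpha> g u - z0 - (u - z0)) \<le> (1/2) * norm (u - z0)"
      using est[OF g z0R z0 uR] by (simp add: fixp[OF g])
    then have "norm (\<alpha> g u - z0) \<le> 2 * norm (u - z0)"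
      using norm_triangle_ineq[of "\<alpha> g u - z0 - (u - z0)" "u - z0"] norm_ge_zero[of "u - z0"]
      unfolding diff_add_cancel by linarith
    then have "\<alpha> g u \<in> ball z0 R" using u by (simp add: dist_norm norm_minus_commute)
    then show "\<alpha> g u = u" using Ainj[of "\<alpha> g u" u] uR Ainv[OF g uR(2)] maps[OF g uR(2)] by blast
  qed simp
qed

section \<open>Level sets of submersions\<close>

text \<open>Placing the linear coordinate along \<open>a\<close> into the missing direction
  \<open>e\<close> completes \<open>F\<close> to a local homeomorphism \<Phi>, by invariance of
  domain. The level set is the preimage of a line parallel to \<open>e\<close>, and \<sigma>
  parametrizes it by that coordinate.\<close>

lemma level_arc:
  fixes F :: "'v::euclidean_space \<Rightarrow> 'v"
  assumes W0: "open W" "z0 \<in> W" and F: "Ck_on 2 F W" and e: "e \<noteq> 0" and Fe: "\<And>u. u \<in> W \<Longrightarrow> F u \<bullet> e = 0"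
    and inj: "\<And>v. frechet_derivative F (at z0) v = 0 \<Longrightarrow> v \<bullet> a = 0 \<Longrightarrow> v = 0"
  obtains V \<sigma> c where "open V" "z0 \<in> V" "V \<subseteq> W" "c > 0" "continuous_on {-1<..<1} \<sigma>" "\<sigma> 0 = z0"
    "\<And>t. t \<in> {-1<..<1} \<Longrightarrow> \<sigma> t \<in> V \<and> F (\<sigma> t) = F z0 \<and> (\<sigma> t - z0) \<bullet> a = c * t"
    "\<And>u. u \<in> V \<Longrightarrow> F u = F z0 \<Longrightarrow> (u - z0) \<bullet> a / c \<in> {-1<..<1} \<and> u = \<sigma> ((u - z0) \<bullet> a / c)"
proof -
  define \<Phi> where "\<Phi> u = F u + ((u - z0) \<bullet> a) *\<^sub>R e" for u
  have bl: "bounded_linear (\<lambda>u. (u \<bullet> a) *\<^sub>R e)"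
    by (rule bounded_linear_compose[OF bounded_linear_scaleR_left bounded_linear_inner_left])
  have "Ck_on 2 (\<lambda>u. (u \<bullet> a) *\<^sub>R e + - ((z0 \<bullet> a) *\<^sub>R e)) W"
    by (rule Ck_on_add[OF W0(1) Ck_on_bounded_linear[OF bl W0(1)] Ck_on_const[OF W0(1)]])
  then have "Ck_on 2 (\<lambda>u. F u + ((u \<bullet> a) *\<^sub>R e + - ((z0 \<bullet> a) *\<^sub>R e))) W"
    by (rule Ck_on_add[OF W0(1) F])
  moreover have "\<Phi> = (\<lambda>u. F u + ((u \<bullet> a) *\<^sub>R e + - ((z0 \<bullet> a) *\<^sub>R e)))"
    unfolding \<Phi>_def by (auto simp: inner_diff_left scaleR_diff_left)
  ultimately have C: "Ck_on 2 \<Phi> W" by simp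
  interpret C2_map \<Phi> W by unfold_locales fact+
  let ?L = "frechet_derivative F (at z0)"
  have DF: "(F has_derivative ?L) (at z0)"
    by (rule Ck_on_2_has_derivative[OF F W0(2)])
  have Le: "?L v \<bullet> e = 0" for v by (rule derivative_into_hyp[OF W0 Fe DF])
  have "(\<Phi> has_derivative (\<lambda>v. ?L v + (v \<bullet> a) *\<^sub>R e)) (at z0)"
    unfolding \<Phi>_def by (intro has_derivative_add DF) (auto intro!: derivative_eq_intros)
  then have D: "D z0 v = ?L v + (v \<bullet> a) *\<^sub>R e" for v
    using has_derivative_unique[OF D_deriv[OF W0(2)]] by metis
  have Dinj: "v = 0" if "D z0 v = 0" for v
  proof -
    have "(?L v + (v \<bullet> a) *\<^sub>R e) \<bullet> e = 0" using that unfolding D by simp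
    then have "v \<bullet> a = 0" using Le[of v] e by (simp add: inner_add_left)
    then show ?thesis using that inj unfolding D by simp
  qed
  have lin: "linear (D z0)" by (rule D_linear[OF W0(2)])
  have "inj (D z0)" using Dinj linear_injective_0[OF lin] by blast
  then obtain B where B: "B > 0" "\<And>v. B * norm v \<le> norm (D z0 v)"
    using linear_inj_bounded_below_pos[OF lin] by metis
  obtain \<rho> where \<rho>: "\<rho> > 0" "ball z0 \<rho> \<subseteq> W"
    "\<And>p q. p \<in> ball z0 \<rho> \<Longrightarrow> q \<in> ball z0 \<rho> \<Longrightarrow> norm (\<Phi> q - \<Phi> p - D z0 (q - p)) \<le> (B / 2) * norm (q - p)"
    using strict_derivative[OF W0(2), of "B / 2"] B(1) by (metis half_gt_zero)
  have injP: "inj_on \<Phi> (ball z0 \<rho>)"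
  proof (rule inj_onI)
    fix p q assume pq: "p \<in> ball z0 \<rho>" "q \<in> ball z0 \<rho>" "\<Phi> p = \<Phi> q"
    have "B * norm (q - p) \<le> (B / 2) * norm (q - p)" using \<rho>(3)[OF pq(1,2)] pq(3) B(2)[of "q - p"] by simp
    then have "norm (q - p) \<le> 0" using B(1) by (simp add: mult_le_cancel_right)
    then show "p = q" by simp
  qed
  have cont: "continuous_on (ball z0 \<rho>) \<Phi>" using Ck_on_continuous[OF C] \<rho>(2) continuous_on_subset by blast
  obtain \<Psi> where hom: "homeomorphism (ball z0 \<rho>) (\<Phi> ` ball z0 \<rho>) \<Phi> \<Psi>"
    using invariance_of_domain_homeomorphism[OF open_ball cont order_refl injP] by blast
  have "open (\<Phi> ` ball z0 \<rho>)" by (rule invariance_of_domain[OF cont open_ball injP])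
  moreover have "\<Phi> z0 \<in> \<Phi> ` ball z0 \<rho>" using \<rho>(1) by simp
  ultimately obtain s where s: "s > 0" "ball (\<Phi> z0) s \<subseteq> \<Phi> ` ball z0 \<rho>" using open_contains_ball by metis
  define V where "V = ball z0 \<rho> \<inter> \<Phi> -` ball (\<Phi> z0) s"
  \<comment> \<open>This scale makes \<open>{-1<..<1}\<close> exactly the parameters of the points
    of the line inside the ball of radius \<open>s\<close>.\<close>
  define c where "c = s / norm e"
  have ne: "norm e > 0" using e by simp
  have c: "c > 0" unfolding c_def using s ne by simp
  define \<sigma> where "\<sigma> t = \<Psi> (\<Phi> z0 + (c * t) *\<^sub>R e)" for t
  have inb: "\<Phi> z0 + (c * t) *\<^sub>R e \<in> ball (\<Phi> z0) s \<longleftrightarrow> t \<in> {-1<..<1}" for t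
  proof -
    have "norm ((c * t) *\<^sub>R e) = s * \<bar>t\<bar>" using s ne unfolding c_def by (simp add: abs_mult)
    then have "\<Phi> z0 + (c * t) *\<^sub>R e \<in> ball (\<Phi> z0) s \<longleftrightarrow> s * \<bar>t\<bar> < s * 1" by (simp add: dist_norm)
    also have "\<dots> \<longleftrightarrow> \<bar>t\<bar> < 1" using s(1) by (simp only: mult_less_cancel_left_pos)
    finally show ?thesis by auto
  qed
  have \<Phi>e: "\<Phi> u \<bullet> e = ((u - z0) \<bullet> a) * (e \<bullet> e)" if "u \<in> W" for u
    unfolding \<Phi>_def using Fe[OF that] by (simp add: inner_add_left)
  have \<Phi>z0: "\<Phi> z0 = F z0" unfolding \<Phi>_def by simp
  have \<sigma>1: "\<sigma> t \<in> ball z0 \<rho>" "\<Phi> (\<sigma> t) = \<Phi> z0 + (c * t) *\<^sub>R e" if "t \<in> {-1<..<1}" for t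
  proof -
    have "\<Phi> z0 + (c * t) *\<^sub>R e \<in> \<Phi> ` ball z0 \<rho>" using inb that s(2) by blast
    then show "\<sigma> t \<in> ball z0 \<rho>" "\<Phi> (\<sigma> t) = \<Phi> z0 + (c * t) *\<^sub>R e"
      unfolding \<sigma>_def using hom by (auto simp: homeomorphism_def)
  qed
  show ?thesis
  proof (rule that[of V c \<sigma>])
    show "open V" unfolding V_def using cont continuous_open_preimage open_ball by blast
    show "z0 \<in> V" unfolding V_def using \<rho> s by simp
    show "V \<subseteq> W" unfolding V_def using \<rho> by blast
    show "c > 0" by (rule c)
    have "continuous_on (\<Phi> ` ball z0 \<rho>) \<Psi>" using hom by (simp add: homeomorphism_def)
    then show "continuous_on {-1<..<1} \<sigma>"
      unfolding \<sigma>_def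
      by (rule continuous_on_compose2) (use inb s(2) in \<open>auto intro!: continuous_intros\<close>)
    show "\<sigma> 0 = z0" unfolding \<sigma>_def using hom \<rho>(1) by (simp add: homeomorphism_def)
  next
    fix t :: real assume t: "t \<in> {-1<..<1}"
    have tW: "\<sigma> t \<in> W" using \<sigma>1(1)[OF t] \<rho> by blast
    have "((\<sigma> t - z0) \<bullet> a) * (e \<bullet> e) = (c * t) * (e \<bullet> e)"
      unfolding \<Phi>e[OF tW, symmetric] \<sigma>1(2)[OF t] using \<Phi>e[OF W0(2)] by (simp add: inner_add_left)
    then have a: "(\<sigma> t - z0) \<bullet> a = c * t" using e by auto
    have "F (\<sigma> t) = F z0" using \<sigma>1(2)[OF t] a unfolding \<Phi>z0 unfolding \<Phi>_def by simp
    moreover have "\<sigma> t \<in> V" unfolding V_def using \<sigma>1[OF t] inb t by simp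
    ultimately show "\<sigma> t \<in> V \<and> F (\<sigma> t) = F z0 \<and> (\<sigma> t - z0) \<bullet> a = c * t" using a by blast
  next
    fix u assume u: "u \<in> V" "F u = F z0"
    let ?t = "(u - z0) \<bullet> a / c"
    have "\<Phi> u = \<Phi> z0 + (c * ?t) *\<^sub>R e" using u(2) c unfolding \<Phi>z0 unfolding \<Phi>_def by simp
    moreover have "u \<in> ball z0 \<rho>" "\<Phi> u \<in> ball (\<Phi> z0) s" using u(1) unfolding V_def by auto
    ultimately show "?t \<in> {-1<..<1} \<and> u = \<sigma> ?t"
      using inb[of ?t] hom unfolding \<sigma>_def by (metis homeomorphism_apply1)
  qed
qed

text \<open>On the level set the linear coordinate \<open>(u - z0) \<bullet> a / c\<close> inverts
  \<sigma>. Images of open parameter sets are therefore traces on \<open>N\<close> of images under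
  \<pi> of open sets of \<open>Z\<close>, and \<pi> is open.\<close>

lemma arc_chart_of_level:
  fixes X :: "'a topology" and \<pi> :: "'v::euclidean_space \<Rightarrow> 'a"
  assumes \<pi>: "continuous_map (top_of_set Z) X \<pi>" "\<And>U. openin (top_of_set Z) U \<Longrightarrow> openin X (\<pi> ` U)"
      "inj_on \<pi> (V \<inter> Z)"
    and V: "open V" and c: "c > 0" and I: "I = {t \<in> {-1<..<1}. \<sigma> t \<in> Z}"
    and \<sigma>: "continuous_on {-1<..<1} \<sigma>"
      "\<And>t. t \<in> {-1<..<1} \<Longrightarrow> \<sigma> t \<in> V \<and> F (\<sigma> t) = w \<and> (\<sigma> t - z0) \<bullet> a = c * t"
      "\<And>u. u \<in> V \<Longrightarrow> F u = w \<Longrightarrow> (u - z0) \<bullet> a / c \<in> {-1<..<1} \<and> u = \<sigma> ((u - z0) \<bullet> a / c)"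
    and N: "\<And>u. u \<in> V \<Longrightarrow> u \<in> Z \<Longrightarrow> \<pi> u \<in> N \<longleftrightarrow> F u = w"
  shows "arc_chart (subtopology X N) I (\<lambda>t. \<pi> (\<sigma> t))"
  unfolding arc_chart_def
proof (intro conjI)
  have IN: "\<pi> (\<sigma> t) \<in> N" if "t \<in> I" for t using \<sigma>(2)[of t] N[of "\<sigma> t"] that I by blast
  have "continuous_on I \<sigma>" using \<sigma>(1) by (rule continuous_on_subset) (use I in auto)
  then have "continuous_map (top_of_set I) (top_of_set Z) \<sigma>" using I by (auto simp: continuous_map_iff_continuous)
  then have "continuous_map (top_of_set I) X (\<pi> \<circ> \<sigma>)"
    by (rule continuous_map_compose[OF _ \<pi>(1)])
  then have "continuous_map (top_of_set I) X (\<lambda>t. \<pi> (\<sigma> t))"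
    unfolding o_def .
  then show "continuous_map (top_of_set I) (subtopology X N) (\<lambda>t. \<pi> (\<sigma> t))"
    using IN by (auto simp: continuous_map_in_subtopology)
  have \<sigma>eq: "t = t'" if "t \<in> I" "t' \<in> I" "\<sigma> t = \<sigma> t'" for t t'
  proof -
    have "c * t = c * t'" using \<sigma>(2)[of t] \<sigma>(2)[of t'] that I by (metis (no_types, lifting) mem_Collect_eq)
    then show ?thesis using c by simp
  qed
  show "inj_on (\<lambda>t. \<pi> (\<sigma> t)) I"
  proof (rule inj_onI)
    fix t t' assume *: "t \<in> I" "t' \<in> I" "\<pi> (\<sigma> t) = \<pi> (\<sigma> t')"
    then have "\<sigma> t = \<sigma> t'" using inj_onD[OF \<pi>(3) *(3)] \<sigma>(2)[of t] \<sigma>(2)[of t'] I by blast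
    then show "t = t'" using \<sigma>eq * by blast
  qed
  show "open_map (top_of_set I) (subtopology X N) (\<lambda>t. \<pi> (\<sigma> t))"
    unfolding open_map_def
  proof (intro allI impI)
    fix P assume "openin (top_of_set I) P"
    then obtain P' where P': "open P'" "P = I \<inter> P'" unfolding openin_open by blast
    define U where "U = {u \<in> V \<inter> Z. (u - z0) \<bullet> a / c \<in> P'}"
    have "open (V \<inter> (\<lambda>u. (u - z0) \<bullet> a / c) -` P')"
      by (rule continuous_open_preimage[OF _ V P'(1)]) (use c in \<open>auto intro!: continuous_intros\<close>)
    moreover have "U = Z \<inter> (V \<inter> (\<lambda>u. (u - z0) \<bullet> a / c) -` P')" unfolding U_def by auto
    ultimately have "openin (top_of_set Z) U" by (simp add: openin_open_Int)
    then have "openin X (\<pi> ` U)" by (rule \<pi>(2))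
    moreover have "(\<lambda>t. \<pi> (\<sigma> t)) ` P = \<pi> ` U \<inter> N"
    proof
      show "(\<lambda>t. \<pi> (\<sigma> t)) ` P \<subseteq> \<pi> ` U \<inter> N"
      proof clarify
        fix t assume t: "t \<in> P"
        then have tI: "t \<in> I" "t \<in> P'" unfolding P'(2) by auto
        then have "(\<sigma> t - z0) \<bullet> a / c = t" using \<sigma>(2)[of t] I c by simp
        then have "\<sigma> t \<in> U" unfolding U_def using \<sigma>(2)[of t] tI I by simp
        then show "\<pi> (\<sigma> t) \<in> \<pi> ` U \<inter> N" using IN[OF tI(1)] by blast
      qed
      show "\<pi> ` U \<inter> N \<subseteq> (\<lambda>t. \<pi> (\<sigma> t)) ` P"
      proof clarify
        fix u assume u: "u \<in> U" "\<pi> u \<in> N"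
        let ?t = "(u - z0) \<bullet> a / c"
        have uV: "u \<in> V" "u \<in> Z" "?t \<in> P'" using u(1) unfolding U_def by auto
        then have "F u = w" using N u(2) by blast
        then have t: "?t \<in> {-1<..<1}" "u = \<sigma> ?t" using \<sigma>(3)[OF uV(1)] by auto
        then have "?t \<in> I" using I uV(2) by simp
        then show "\<pi> u \<in> (\<lambda>t. \<pi> (\<sigma> t)) ` P" unfolding P'(2)
          using uV(3) t(2) by (intro image_eqI[of _ _ ?t]) auto
      qed
    qed
    ultimately show "openin (subtopology X N) ((\<lambda>t. \<pi> (\<sigma> t)) ` P)"
      by (simp add: openin_subtopology_Int)
  qed
qed

section \<open>The local model of a fibre\<close>

text \<open>Both an open set and a closed half-space satisfy this condition at the relevant points;
  it makes derivatives within the set unique.\<close>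

definition axis_accessible :: "'v::euclidean_space set \<Rightarrow> 'v \<Rightarrow> bool" where
  "axis_accessible Z z0 \<longleftrightarrow> (\<forall>i\<in>Basis. \<forall>\<epsilon>>0. \<exists>d. 0 < \<bar>d\<bar> \<and> \<bar>d\<bar> < \<epsilon> \<and> z0 + d *\<^sub>R i \<in> Z)"

lemma axis_accessible_open:
  assumes "open Z" "z0 \<in> Z"
  shows "axis_accessible Z z0"
  unfolding axis_accessible_def
proof (intro ballI allI impI)
  fix i :: 'a and \<epsilon> :: real assume i: "i \<in> Basis" and e: "\<epsilon> > 0"
  obtain r where r: "r > 0" "ball z0 r \<subseteq> Z" using assms openE by blast
  let ?d = "min \<epsilon> r / 2"
  have "z0 + ?d *\<^sub>R i \<in> ball z0 r" using i r e by (auto simp: dist_norm min_def)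
  then show "\<exists>d. 0 < \<bar>d\<bar> \<and> \<bar>d\<bar> < \<epsilon> \<and> z0 + d *\<^sub>R i \<in> Z"
    using r e by (intro exI[of _ ?d]) (auto simp: min_def)
qed

lemma axis_accessible_half_space:
  assumes "z0 \<bullet> e = 0"
  shows "axis_accessible {v. 0 \<le> v \<bullet> e} z0"
  unfolding axis_accessible_def
proof (intro ballI allI impI)
  fix i :: 'a and \<epsilon> :: real assume e: "\<epsilon> > 0"
  define d where "d = (if 0 \<le> i \<bullet> e then \<epsilon> / 2 else - (\<epsilon> / 2))"
  have "0 \<le> d * (i \<bullet> e)" unfolding d_def using e by (auto simp: mult_nonneg_nonpos2 mult_le_0_iff)
  then show "\<exists>d. 0 < \<bar>d\<bar> \<and> \<bar>d\<bar> < \<epsilon> \<and> z0 + d *\<^sub>R i \<in> {v. 0 \<le> v \<bullet> e}"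
    using e assms by (intro exI[of _ d]) (auto simp: d_def inner_add_left)
qed

lemma derivative_unique_accessible:
  assumes "axis_accessible Z z0" "(f has_derivative f') (at z0 within Z)" "(f has_derivative f'') (at z0 within Z)"
  shows "f' = f''"
  by (rule frechet_derivative_unique_within[OF assms(2,3)]) (use assms(1) in \<open>auto simp: axis_accessible_def\<close>)

lemma smooth_extension:
  assumes "smooth_map Z f" "z0 \<in> Z"
  obtains W g where "open W" "z0 \<in> W" "\<And>k. Ck_on k g W" "\<And>u. u \<in> W \<Longrightarrow> u \<in> Z \<Longrightarrow> g u = f u"
    "(f has_derivative frechet_derivative g (at z0)) (at z0 within Z)"
proof -
  obtain W g where W: "open W" "z0 \<in> W" "\<And>k. Ck_on k g W" "\<And>u. u \<in> W \<Longrightarrow> u \<in> Z \<Longrightarrow> g u = f u"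
    using smooth_mapE[OF assms] by metis
  obtain d where d: "d > 0" "ball z0 d \<subseteq> W" using W(1,2) openE by blast
  have "(g has_derivative frechet_derivative g (at z0)) (at z0 within Z)"
    by (rule has_derivative_at_withinI[OF Ck_on_2_has_derivative[OF W(3) W(2)]])
  then have "(f has_derivative frechet_derivative g (at z0)) (at z0 within Z)"
    by (rule has_derivative_transform_within[OF _ d(1) assms(2)])
      (use d W(4) in \<open>auto simp: subset_iff dist_commute\<close>)
  then show ?thesis using that W by blast
qed

text \<open>One locale serves both kinds of points of a fibre. \<open>Z\<close> is a chart domain,
  open or flattened to a half-space; \<open>P\<close> extends the lift of \<open>f\<close> in flat
  boundary coordinates, and \<tau> is the projection of the boundary chart in these coordinates. As
  \<tau> is injective near \<open>P z0\<close>, membership in the fibre is near \<open>z0\<close>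
  the equation \<open>P u = P z0\<close>. The point \<open>z0\<close> is not normalized to 0 because
  flattening may move the origin.\<close>

locale fibre_model =
  fixes G :: "('g, 'm) monoid_scheme" (structure)
    and Z :: "'v::euclidean_space set" and z0 :: 'v and \<alpha> :: "'g \<Rightarrow> 'v \<Rightarrow> 'v"
    and T :: "'a topology" and \<pi> :: "'v \<Rightarrow> 'a" and f :: "'a \<Rightarrow> 'a"
    and \<tau> :: "'v \<Rightarrow> 'a" and P :: "'v \<Rightarrow> 'v" and W Q :: "'v set" and e :: 'v
  assumes G: "group G" "finite (carrier G)"
    and z0: "z0 \<in> Z" and acc: "axis_accessible Z z0"
    and maps: "\<And>g u. g \<in> carrier G \<Longrightarrow> u \<in> Z \<Longrightarrow> \<alpha> g u \<in> Z"
    and mult: "\<And>g h u. g \<in> carrier G \<Longrightarrow> h \<in> carrier G \<Longrightarrow> u \<in> Z \<Longrightarrow> \<alpha> (g \<otimes> h) u = \<alpha> g (\<alpha> h u)"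
    and one: "\<And>u. u \<in> Z \<Longrightarrow> \<alpha> \<one> u = u"
    and fixp: "\<And>g. g \<in> carrier G \<Longrightarrow> \<alpha> g z0 = z0"
    and smooth: "\<And>g. g \<in> carrier G \<Longrightarrow> smooth_map Z (\<alpha> g)"
    and \<pi>: "continuous_map (top_of_set Z) T \<pi>" "\<And>U. openin (top_of_set Z) U \<Longrightarrow> openin T (\<pi> ` U)"
    and \<pi>_eq: "\<And>u u'. u \<in> Z \<Longrightarrow> u' \<in> Z \<Longrightarrow> \<pi> u = \<pi> u' \<longleftrightarrow> (\<exists>g\<in>carrier G. u' = \<alpha> g u)"
    and W: "open W" "z0 \<in> W" and P: "Ck_on 2 P W" "\<And>u. u \<in> W \<Longrightarrow> P u \<bullet> e = 0"
    and \<tau>P: "\<And>u. u \<in> W \<Longrightarrow> u \<in> Z \<Longrightarrow> \<tau> (P u) = f (\<pi> u)"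
    and e: "e \<noteq> 0" and onto: "range (frechet_derivative P (at z0)) = hyp e"
    and Q: "open Q" "P z0 \<in> Q" "inj_on \<tau> (Q \<inter> hyp e)"
begin

text \<open>At a boundary point of \<open>Z\<close> the action has no two-sided derivative. Thus
  \<rho> is taken from a chosen smooth extension; \<open>derivative_unique_accessible\<close> makes
  it independent of the choice.\<close>

definition ext where
  "ext g = (SOME a. \<exists>U. open U \<and> z0 \<in> U \<and> Ck_on 2 a U \<and> (\<forall>u\<in>U \<inter> Z. a u = \<alpha> g u))"

definition \<rho> where "\<rho> g = frechet_derivative (ext g) (at z0)"

lemma ext:
  assumes "g \<in> carrier G"
  obtains U where "open U" "z0 \<in> U" "Ck_on 2 (ext g) U" "\<And>u. u \<in> U \<Longrightarrow> u \<in> Z \<Longrightarrow> ext g u = \<alpha> g u"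
proof -
  have "\<exists>a U. open U \<and> z0 \<in> U \<and> Ck_on 2 a U \<and> (\<forall>u\<in>U \<inter> Z. a u = \<alpha> g u)"
    by (rule smooth_mapE[OF smooth[OF assms] z0]) blast
  then have "\<exists>U. open U \<and> z0 \<in> U \<and> Ck_on 2 (ext g) U \<and> (\<forall>u\<in>U \<inter> Z. ext g u = \<alpha> g u)"
    unfolding ext_def by (rule someI_ex)
  then show ?thesis using that by blast
qed

lemma \<rho>_deriv:
  assumes g: "g \<in> carrier G"
  shows "(ext g has_derivative \<rho> g) (at z0)" "(\<alpha> g has_derivative \<rho> g) (at z0 within Z)"
proof -
  obtain U where U: "open U" "z0 \<in> U" "Ck_on 2 (ext g) U" "\<And>u. u \<in> U \<Longrightarrow> u \<in> Z \<Longrightarrow> ext g u = \<alpha> g u"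
    using ext[OF g] by metis
  show 1: "(ext g has_derivative \<rho> g) (at z0)" unfolding \<rho>_def by (rule Ck_on_2_has_derivative[OF U(3,2)])
  obtain d where d: "d > 0" "ball z0 d \<subseteq> U" using U(1,2) openE by blast
  show "(\<alpha> g has_derivative \<rho> g) (at z0 within Z)"
    by (rule has_derivative_transform_within[OF has_derivative_at_withinI[OF 1] d(1) z0])
      (use d U(4) in \<open>auto simp: subset_iff dist_commute\<close>)
qed

lemma \<rho>_linear: "g \<in> carrier G \<Longrightarrow> linear (\<rho> g)"
  using \<rho>_deriv(1) has_derivative_linear by blast

lemma \<rho>_mult:
  assumes g: "g \<in> carrier G" and h: "h \<in> carrier G"
  shows "\<rho> (g \<otimes> h) v = \<rho> g (\<rho> h v)"
proof -
  interpret group G by (rule G)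
  have "((\<lambda>u. \<alpha> g (\<alpha> h u)) has_derivative (\<lambda>v. \<rho> g (\<rho> h v))) (at z0 within Z)"
  proof (rule has_derivative_in_compose[OF \<rho>_deriv(2)[OF h]])
    have "\<alpha> h ` Z \<subseteq> Z" using maps[OF h] by blast
    then show "(\<alpha> g has_derivative \<rho> g) (at (\<alpha> h z0) within \<alpha> h ` Z)"
      unfolding fixp[OF h] by (rule has_derivative_subset[OF \<rho>_deriv(2)[OF g]])
  qed
  then have "(\<alpha> (g \<otimes> h) has_derivative (\<lambda>v. \<rho> g (\<rho> h v))) (at z0 within Z)"
    by (rule has_derivative_transform_within[OF _ zero_less_one z0]) (use mult[OF g h] in auto)
  then show ?thesis
    using derivative_unique_accessible[OF acc \<rho>_deriv(2)[of "g \<otimes> h"]] g h by (metis m_closed)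
qed

lemma \<rho>_one: "\<rho> \<one> v = v"
proof -
  interpret group G by (rule G)
  have "(\<alpha> \<one> has_derivative (\<lambda>v. v)) (at z0 within Z)"
    by (rule has_derivative_transform_within[OF has_derivative_ident zero_less_one z0]) (simp add: one)
  then show ?thesis using derivative_unique_accessible[OF acc \<rho>_deriv(2)[OF one_closed]] by metis
qed

abbreviation L where "L \<equiv> frechet_derivative P (at z0)"

lemma L_deriv: "(P has_derivative L) (at z0)"
  by (rule Ck_on_2_has_derivative[OF P(1) W(2)])

lemma L_linear: "linear L"
  using L_deriv has_derivative_linear by blast

lemma P_hyp: "u \<in> W \<Longrightarrow> P u \<in> hyp e"
  unfolding hyp_def using P(2) by simp

lemma near_Q: obtains V where "open V" "z0 \<in> V" "V \<subseteq> W" "\<And>u. u \<in> V \<Longrightarrow> P u \<in> Q"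
proof (rule that[of "W \<inter> P -` Q"])
  show "open (W \<inter> P -` Q)"
    by (rule continuous_open_preimage[OF Ck_on_continuous[OF P(1)] W(1) Q(1)])
qed (use W Q in auto)

text \<open>\<open>f (\<pi> u)\<close> is invariant under the action and \<tau> is injective near
  \<open>P z0\<close>, so \<open>P\<close> is invariant on \<open>Z\<close> near \<open>z0\<close>;
  differentiate this within \<open>Z\<close>.\<close>

lemma L_\<rho>:
  assumes g: "g \<in> carrier G"
  shows "L (\<rho> g v) = L v"
proof -
  obtain V where V: "open V" "z0 \<in> V" "V \<subseteq> W" "\<And>u. u \<in> V \<Longrightarrow> P u \<in> Q" using near_Q by metis
  have "continuous (at z0 within Z) (\<alpha> g)"
    using \<rho>_deriv(2)[OF g] has_derivative_continuous by blast
  then have "(\<alpha> g \<longlongrightarrow> z0) (at z0 within Z)" using fixp[OF g] by (simp add: continuous_within)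
  then have "\<forall>\<^sub>F u in at z0 within Z. \<alpha> g u \<in> V" using V(1,2) by (rule topological_tendstoD)
  moreover have "\<forall>\<^sub>F u in at z0 within Z. u \<in> V"
    using eventually_nhds_in_open[OF V(1,2)] unfolding eventually_at_filter by (rule eventually_mono) simp
  ultimately have "\<forall>\<^sub>F u in at z0 within Z. \<alpha> g u \<in> V \<and> u \<in> V" by (rule eventually_conj)
  then obtain d where d: "d > 0" "\<And>u. u \<in> Z \<Longrightarrow> u \<noteq> z0 \<Longrightarrow> dist u z0 < d \<Longrightarrow> \<alpha> g u \<in> V \<and> u \<in> V"
    unfolding eventually_at by blast
  have eq: "P (\<alpha> g u) = P u" if u: "u \<in> Z" "dist u z0 < d" for u
  proof (cases "u = z0")
    case True
    then show ?thesis using fixp[OF g] by simp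
  next
    case False
    then have uV: "\<alpha> g u \<in> V" "u \<in> V" using d(2) u by auto
    have "\<pi> (\<alpha> g u) = \<pi> u" using \<pi>_eq[OF u(1) maps[OF g u(1)]] g by force
    then have "\<tau> (P (\<alpha> g u)) = \<tau> (P u)"
      using \<tau>P uV V(3) u(1) maps[OF g u(1)] by (metis subsetD)
    then show ?thesis
      using inj_onD[OF Q(3)] V(4)[OF uV(1)] V(4)[OF uV(2)] P_hyp uV V(3) by (meson IntI subsetD)
  qed
  have "((\<lambda>u. P (\<alpha> g u)) has_derivative (\<lambda>v. L (\<rho> g v))) (at z0 within Z)"
    by (rule has_derivative_compose[OF \<rho>_deriv(2)[OF g]]) (simp add: fixp[OF g] L_deriv)
  then have "(P has_derivative (\<lambda>v. L (\<rho> g v))) (at z0 within Z)"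
    by (rule has_derivative_transform_within[OF _ d(1) z0]) (rule eq)
  then show ?thesis
    using derivative_unique_accessible[OF acc has_derivative_at_withinI[OF L_deriv]] by metis
qed

lemma inj_near:
  assumes "\<And>g v. g \<in> carrier G \<Longrightarrow> \<rho> g v = v"
  obtains V where "open V" "z0 \<in> V" "inj_on \<pi> (V \<inter> Z)"
proof -
  obtain V where V: "open V" "z0 \<in> V" "\<And>g u. g \<in> carrier G \<Longrightarrow> u \<in> V \<inter> Z \<Longrightarrow> \<alpha> g u = u"
  proof (rule finite_action_trivial_near[OF G z0 maps mult fixp])
    fix g assume g: "g \<in> carrier G"
    show "\<exists>W f. open W \<and> z0 \<in> W \<and> Ck_on 2 f W \<and>
        (\<forall>u\<in>W \<inter> Z. f u = \<alpha> g u) \<and> (\<forall>v. frechet_derivative f (at z0) v = v)"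
      using assms[OF g] unfolding \<rho>_def by (rule_tac ext[OF g]) blast
  qed (use that in blast)+
  have "inj_on \<pi> (V \<inter> Z)"
    by (rule inj_onI) (use V(3) \<pi>_eq in \<open>metis IntE\<close>)
  then show ?thesis using that V by blast
qed

text \<open>\<open>J\<close> records the shape of \<open>Z\<close> along the curve: the whole line
  at interior points, \<open>{0..}\<close> on the boundary. It must be invariant under positive
  factors because \<open>level_arc\<close> rescales the parameter by an unknown
  \<open>c\<close>.\<close>

lemma arc:
  assumes triv: "\<And>g v. g \<in> carrier G \<Longrightarrow> \<rho> g v = v"
    and a: "\<And>v. L v = 0 \<Longrightarrow> v \<bullet> a = 0 \<Longrightarrow> v = 0"
    and U: "open U" "z0 \<in> U"
    and I: "\<And>u. u \<in> U \<Longrightarrow> u \<in> Z \<longleftrightarrow> (u - z0) \<bullet> a \<in> J" "\<And>c t. c > 0 \<Longrightarrow> c * t \<in> J \<longleftrightarrow> t \<in> (J :: real set)"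
  shows "\<exists>\<gamma>. \<gamma> 0 = \<pi> z0 \<and> arc_chart (subtopology T {x. f x = f (\<pi> z0)}) ({-1<..<1} \<inter> J) \<gamma>"
proof -
  obtain V1 where V1: "open V1" "z0 \<in> V1" "inj_on \<pi> (V1 \<inter> Z)" using inj_near[OF triv] by metis
  obtain V2 where V2: "open V2" "z0 \<in> V2" "V2 \<subseteq> W" "\<And>u. u \<in> V2 \<Longrightarrow> P u \<in> Q" using near_Q by metis
  let ?W = "U \<inter> V1 \<inter> V2"
  have oW: "open ?W" "z0 \<in> ?W" using U V1 V2 by auto
  have CW: "Ck_on 2 P ?W" using P(1) by (rule Ck_on_subset) (use V2 in blast)
  have eW: "P u \<bullet> e = 0" if "u \<in> ?W" for u using that V2 P(2) by blast
  obtain V \<sigma> c where V: "open V" "z0 \<in> V" "V \<subseteq> ?W" and c: "c > 0"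
    and \<sigma>: "continuous_on {-1<..<1} \<sigma>" "\<sigma> 0 = z0"
      "\<And>t. t \<in> {-1<..<1} \<Longrightarrow> \<sigma> t \<in> V \<and> P (\<sigma> t) = P z0 \<and> (\<sigma> t - z0) \<bullet> a = c * t"
      "\<And>u. u \<in> V \<Longrightarrow> P u = P z0 \<Longrightarrow> (u - z0) \<bullet> a / c \<in> {-1<..<1} \<and> u = \<sigma> ((u - z0) \<bullet> a / c)"
  proof (rule level_arc[OF oW CW e, where a = a])
    show "P u \<bullet> e = 0" if "u \<in> ?W" for u using that by (rule eW)
    show "v = 0" if "L v = 0" "v \<bullet> a = 0" for v using that by (rule a)
  qed (rule that; assumption)
  have "arc_chart (subtopology T {x. f x = f (\<pi> z0)}) ({-1<..<1} \<inter> J) (\<lambda>t. \<pi> (\<sigma> t))"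
  proof (rule arc_chart_of_level[OF \<pi> _ V(1) c _ \<sigma>(1) \<sigma>(3,4)])
    show "inj_on \<pi> (V \<inter> Z)" using V1(3) by (rule inj_on_subset) (use V in blast)
    have "\<sigma> t \<in> Z \<longleftrightarrow> t \<in> J" if "t \<in> {-1<..<1}" for t
      using I(1)[of "\<sigma> t"] I(2)[OF c, of t] \<sigma>(3)[OF that] V(3) by auto
    then show "{-1<..<1} \<inter> J = {t \<in> {-1<..<1}. \<sigma> t \<in> Z}" by blast
    fix u assume u: "u \<in> V" "u \<in> Z"
    have uW: "u \<in> V2" "u \<in> W" using u V V2 by auto
    have "f (\<pi> u) = f (\<pi> z0) \<longleftrightarrow> \<tau> (P u) = \<tau> (P z0)" using \<tau>P uW u W(2) z0 by metis
    also have "\<dots> \<longleftrightarrow> P u = P z0"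
      using inj_on_eq_iff[OF Q(3), of "P u" "P z0"] V2(4)[OF uW(1)] Q(2) P_hyp uW W(2) by blast
    finally show "\<pi> u \<in> {x. f x = f (\<pi> z0)} \<longleftrightarrow> P u = P z0" by simp
  qed
  then show ?thesis using \<sigma>(2) by (intro exI[of _ "\<lambda>t. \<pi> (\<sigma> t)"]) simp
qed

lemma interior_arc:
  assumes Z: "open Z"
    and dimF: "dim {v. \<forall>g\<in>carrier G. frechet_derivative (\<alpha> g) (at z0) v = v} \<noteq> DIM('v) - 1"
  shows "\<exists>\<gamma>. \<gamma> 0 = \<pi> z0 \<and> arc_chart (subtopology T {x. f x = f (\<pi> z0)}) {-1<..<1} \<gamma>"
proof -
  obtain k where k: "k \<noteq> 0" "\<And>v. L v = 0 \<longleftrightarrow> v \<in> span {k}"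
    using kernel_of_submersion[OF L_linear e onto] by metis
  have fr: "frechet_derivative (\<alpha> g) (at z0) = \<rho> g" if "g \<in> carrier G" for g
    using \<rho>_deriv(2)[OF that] Z z0 by (metis at_within_open frechet_derivative_at)
  have eq: "{v. \<forall>g\<in>carrier G. frechet_derivative (\<alpha> g) (at z0) v = v} = {v. \<forall>g\<in>carrier G. \<rho> g v = v}"
    using fr by auto
  have "{v. \<forall>g\<in>carrier G. \<rho> g v = v} = UNIV"
    using finite_group_invariant_submersion(1)[OF G \<rho>_linear \<rho>_mult \<rho>_one L_linear L_\<rho> k] dimF
    unfolding eq by blast
  then have triv: "\<rho> g v = v" if "g \<in> carrier G" for g v using that by blast
  have a: "v = 0" if "L v = 0" "v \<bullet> k = 0" for v
  proof -
    have "v \<in> range (\<lambda>c. c *\<^sub>R k)" using k(2) that(1) by (simp add: span_singleton)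
    then have "\<exists>c. v = c *\<^sub>R k" by (simp add: image_iff)
    then show ?thesis using that(2) k(1) by auto
  qed
  have "\<exists>\<gamma>. \<gamma> 0 = \<pi> z0 \<and> arc_chart (subtopology T {x. f x = f (\<pi> z0)}) ({-1<..<1} \<inter> UNIV) \<gamma>"
    by (rule arc[OF triv a Z z0]) auto
  then show ?thesis by simp
qed

lemma boundary_arc:
  assumes Z: "Z = {v. 0 \<le> v \<bullet> n}" "z0 \<bullet> n = 0"
    and transversal: "\<And>v. L v = 0 \<Longrightarrow> v \<bullet> n = 0 \<Longrightarrow> v = 0"
  shows "\<exists>\<gamma>. \<gamma> 0 = \<pi> z0 \<and> arc_chart (subtopology T {x. f x = f (\<pi> z0)}) {0..<1} \<gamma>"
proof -
  obtain k0 where k0: "k0 \<noteq> 0" "\<And>v. L v = 0 \<longleftrightarrow> v \<in> span {k0}"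
    using kernel_of_submersion[OF L_linear e onto] by metis
  have "k0 \<bullet> n \<noteq> 0" using transversal[of k0] k0 by (auto simp: span_base)
  \<comment> \<open>The kernel is a line transversal to the wall; its generator is turned to point
    into the half-space.\<close>
  define k where "k = (if k0 \<bullet> n > 0 then k0 else - k0)"
  have kn: "k \<bullet> n > 0" unfolding k_def using \<open>k0 \<bullet> n \<noteq> 0\<close> by auto
  \<comment> \<open>The ray from \<open>z0\<close> in direction \<open>k\<close> runs in the
    half-space, and so does its image under the action; a negative derivative would make the image
    leave at once.\<close>
  have nonneg: "\<rho> g k \<bullet> n \<ge> 0" if g: "g \<in> carrier G" for g
  proof -
    obtain U where U: "open U" "z0 \<in> U" "Ck_on 2 (ext g) U" "\<And>u. u \<in> U \<Longrightarrow> u \<in> Z \<Longrightarrow> ext g u = \<alpha> g u"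
      using ext[OF g] by metis
    have "((\<lambda>t. ext g (z0 + t *\<^sub>R k) \<bullet> n) has_derivative (\<lambda>t. \<rho> g (t *\<^sub>R k) \<bullet> n)) (at (0::real))"
      by (intro bounded_linear.has_derivative[OF bounded_linear_inner_left]
          has_derivative_compose[where f = "\<lambda>t. z0 + t *\<^sub>R k" and g = "ext g" and f' = "\<lambda>t. t *\<^sub>R k"])
        (use \<rho>_deriv(1)[OF g] in \<open>auto intro!: derivative_eq_intros\<close>)
    then have d0: "((\<lambda>t. ext g (z0 + t *\<^sub>R k) \<bullet> n) has_derivative (\<lambda>t. t * (\<rho> g k \<bullet> n))) (at 0)"
      by (simp add: linear_cmul[OF \<rho>_linear[OF g]])
    have der: "((\<lambda>t. ext g (z0 + t *\<^sub>R k) \<bullet> n) has_real_derivative (\<rho> g k \<bullet> n)) (at 0)"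
    proof -
      have "(\<lambda>t. t * (\<rho> g k \<bullet> n)) = (*) (\<rho> g k \<bullet> n)" by (auto simp: mult.commute)
      then show ?thesis using d0 unfolding has_field_derivative_def by simp
    qed
    show ?thesis
    proof (rule ccontr)
      assume "\<not> \<rho> g k \<bullet> n \<ge> 0"
      then obtain d where d: "d > 0" "\<And>h. h > 0 \<Longrightarrow> h < d \<Longrightarrow>
          ext g (z0 + (0 + h) *\<^sub>R k) \<bullet> n < ext g (z0 + 0 *\<^sub>R k) \<bullet> n"
        using DERIV_neg_dec_right[OF der] by force
      have "continuous_on UNIV (\<lambda>t. z0 + t *\<^sub>R k)" by (intro continuous_intros)
      then have "open ((\<lambda>t. z0 + t *\<^sub>R k) -` U)" using U(1) by (simp add: open_vimage)
      moreover have "0 \<in> (\<lambda>t. z0 + t *\<^sub>R k) -` U" using U(2) by simp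
      ultimately obtain s where s: "s > 0" "ball 0 s \<subseteq> (\<lambda>t. z0 + t *\<^sub>R k) -` U" using openE by blast
      define h where "h = min d s / 2"
      have h: "h > 0" "h < d" "h \<in> ball 0 s" unfolding h_def using d s by (auto simp: min_def)
      have uZ: "z0 + h *\<^sub>R k \<in> Z" unfolding Z(1) using Z(2) kn h(1) by (simp add: inner_add_left)
      have "ext g (z0 + h *\<^sub>R k) = \<alpha> g (z0 + h *\<^sub>R k)" using U(4) uZ s(2) h(3) by blast
      moreover have "\<alpha> g (z0 + h *\<^sub>R k) \<bullet> n \<ge> 0" using maps[OF g uZ] unfolding Z(1) by simp
      moreover have "ext g z0 \<bullet> n = 0" using U(4)[OF U(2) z0] fixp[OF g] Z(2) by simp
      ultimately show False using d(2)[OF h(1,2)] by simp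
    qed
  qed
  \<comment> \<open>The averaging lemma is applied to the original generator \<open>k0\<close>, so
    the sign goes into the functional.\<close>
  define s where "s = sgn (k0 \<bullet> n)"
  have sk: "k = s *\<^sub>R k0" unfolding k_def s_def using \<open>k0 \<bullet> n \<noteq> 0\<close> by auto
  have "linear (\<lambda>v. v \<bullet> n)" by (intro bounded_linear.linear bounded_linear_inner_left)
  then have lin: "linear (\<lambda>v. s * (v \<bullet> n))"
    by (intro linearI) (simp_all add: inner_add_left algebra_simps)
  have "s * (\<rho> g k0 \<bullet> n) \<ge> 0" if g: "g \<in> carrier G" for g
    using nonneg[OF g] unfolding sk by (simp add: linear_cmul[OF \<rho>_linear[OF g]])
  moreover have "s * (k0 \<bullet> n) > 0" using kn unfolding sk by simp
  ultimately have "{v. \<forall>g\<in>carrier G. \<rho> g v = v} = UNIV"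
    using finite_group_invariant_submersion(2)[OF G \<rho>_linear \<rho>_mult \<rho>_one L_linear L_\<rho> k0 lin]
    by blast
  then have triv: "\<rho> g v = v" if "g \<in> carrier G" for g v using that by blast
  \<comment> \<open>Here the wall normal \<open>n\<close> is the coordinate along the fibre, so that
    the half-space cuts the parameter interval at 0.\<close>
  have "\<exists>\<gamma>. \<gamma> 0 = \<pi> z0 \<and> arc_chart (subtopology T {x. f x = f (\<pi> z0)}) ({-1<..<1} \<inter> {0..}) \<gamma>"
    by (rule arc[OF triv transversal open_UNIV UNIV_I])
      (use Z in \<open>auto simp: inner_diff_left zero_le_mult_iff\<close>)
  moreover have "{-1<..<1} \<inter> {0..} = {0..<1::real}" by auto
  ultimately show ?thesis by simp
qed

end

section \<open>Charts\<close>

locale half_coords =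
  fixes A :: "'v::euclidean_space set" and e h
  assumes coords: "half_space_coords DIM('v) A UNIV e h"
begin

abbreviation H where "H \<equiv> {v. 0 \<le> v \<bullet> e}"

definition hi where "hi = inv_into A h"

lemma e_nonzero: "e \<noteq> 0" and bij: "bij_betw h A H" and h_smooth: "smooth_map A h"
  and hi_smooth: "smooth_map H hi"
  using coords unfolding half_space_coords_def diffeomorphism_def hi_def by auto

lemma h_hi [simp]: "0 \<le> z \<bullet> e \<Longrightarrow> h (hi z) = z"
  unfolding hi_def using bij_betw_inv_into_right[OF bij] by simp

lemma hi_h [simp]: "p \<in> A \<Longrightarrow> hi (h p) = p"
  unfolding hi_def using bij_betw_inv_into_left[OF bij] by simp

lemma hi_in: "0 \<le> z \<bullet> e \<Longrightarrow> hi z \<in> A"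
  unfolding hi_def using bij_betw_inv_into[OF bij] by (auto simp: bij_betw_def)

lemma h_in: "p \<in> A \<Longrightarrow> 0 \<le> h p \<bullet> e"
  using bij by (auto simp: bij_betw_def)

text \<open>By invariance of domain, a point off the wall in one coordinate system has
  neighbourhoods with open image in the other, which is impossible for a wall point of a half-space.
  Hence a single choice of coordinates decides the boundary.\<close>

lemma boundary_eq: "half_space_boundary DIM('v) A = {p \<in> A. h p \<bullet> e = 0}"
proof
  show "{p \<in> A. h p \<bullet> e = 0} \<subseteq> half_space_boundary DIM('v) A"
    unfolding half_space_boundary_def using coords by blast
  show "half_space_boundary DIM('v) A \<subseteq> {p \<in> A. h p \<bullet> e = 0}"
  proof
    fix p assume "p \<in> half_space_boundary DIM('v) A"
    then obtain S e' h' where p: "p \<in> A" and c': "half_space_coords DIM('v) A S e' h'" "h' p \<bullet> e' = 0"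
      unfolding half_space_boundary_def by blast
    have S: "S = UNIV" "e' \<noteq> 0"
      using c'(1) unfolding half_space_coords_def by (metis dim_eq_full span_eq_iff, blast)
    interpret B: half_coords A e' h' by unfold_locales (use c'(1) S in simp)
    show "p \<in> {p \<in> A. h p \<bullet> e = 0}"
    proof (rule ccontr)
      assume "p \<notin> {p \<in> A. h p \<bullet> e = 0}"
      then have pos: "h p \<bullet> e > 0" using p h_in[OF p] by auto
      define U where "U = {z. 0 < z \<bullet> e}"
      have oU: "open U" unfolding U_def by (intro open_Collect_less continuous_intros)
      define \<phi> where "\<phi> z = h' (hi z)" for z
      have UH: "U \<subseteq> H" unfolding U_def by auto
      have "smooth_map H \<phi>"
        unfolding \<phi>_def by (rule smooth_map_compose[OF hi_smooth _ B.h_smooth]) (use hi_in in auto)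
      then have cont: "continuous_on U \<phi>" using smooth_map_continuous_on UH continuous_on_subset by blast
      have inj: "inj_on \<phi> U"
      proof (rule inj_onI)
        fix x y assume xy: "x \<in> U" "y \<in> U" "\<phi> x = \<phi> y"
        have "hi x = hi y"
          using arg_cong[OF xy(3), of B.hi] xy(1,2) hi_in unfolding \<phi>_def U_def by simp
        then show "x = y" using h_hi[of x] h_hi[of y] xy(1,2) unfolding U_def by simp
      qed
      have "open (\<phi> ` U)" by (rule invariance_of_domain[OF cont oU inj])
      moreover have "h' p \<in> \<phi> ` U" unfolding \<phi>_def U_def using pos p by (intro image_eqI[of _ _ "h p"]) auto
      ultimately obtain r where r: "r > 0" "ball (h' p) r \<subseteq> \<phi> ` U" using openE by blast
      have ne: "norm e' > 0" using S by simp
      \<comment> \<open>A point slightly beyond the wall and still in the ball covered by the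
        image.\<close>
      define q where "q = h' p - (r / (2 * norm e')) *\<^sub>R e'"
      have "q \<in> ball (h' p) r" unfolding q_def using r ne by (simp add: dist_norm)
      then obtain z where "z \<in> U" "q = \<phi> z" using r(2) by blast
      then have "0 \<le> q \<bullet> e'" unfolding \<phi>_def U_def using hi_in B.h_in by simp
      moreover have "q \<bullet> e' = - (r / (2 * norm e')) * (e' \<bullet> e')"
        unfolding q_def using c'(2) by (simp add: inner_diff_left)
      moreover have "(r / (2 * norm e')) * (e' \<bullet> e') > 0" using r ne S by simp
      ultimately show False by simp
    qed
  qed
qed

lemma hyp_H: "hyp e \<subseteq> H"
  unfolding hyp_def by auto

lemma hi_boundary: "z \<in> hyp e \<Longrightarrow> hi z \<in> half_space_boundary DIM('v) A"
  unfolding boundary_eq hyp_def using hi_in by auto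

lemma h_boundary: "p \<in> half_space_boundary DIM('v) A \<Longrightarrow> h p \<in> hyp e"
  unfolding boundary_eq hyp_def by auto

end

lemma half_space_boundary_coords:
  assumes "p \<in> half_space_boundary DIM('v) (A :: 'v::euclidean_space set)"
  obtains e h where "half_coords A e h"
proof -
  obtain S e h where c: "half_space_coords DIM('v) A S e h"
    using assms unfolding half_space_boundary_def by blast
  then have "S = UNIV" unfolding half_space_coords_def by (metis dim_eq_full span_eq_iff)
  then show ?thesis using that c half_coords.intro by blast
qed

lemma euclidean_domain_open:
  assumes "euclidean_domain DIM('v) (A :: 'v::euclidean_space set)"
  shows "open A"
proof -
  obtain S k where S: "subspace (S :: 'v set)" "dim S = DIM('v)" "diffeomorphism A S k"
    using assms unfolding euclidean_domain_def by blast
  have U: "S = UNIV" using S(1,2) by (metis dim_eq_full span_eq_iff)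
  have bij: "bij_betw (inv_into A k) UNIV A"
    using S(3) bij_betw_inv_into unfolding U diffeomorphism_def by blast
  have "continuous_on UNIV (inv_into A k)"
    using S(3) smooth_map_continuous_on unfolding U diffeomorphism_def by blast
  then have "open (inv_into A k ` UNIV)"
    by (rule invariance_of_domain[OF _ open_UNIV]) (use bij in \<open>simp add: bij_betw_def\<close>)
  then show ?thesis using bij by (simp add: bij_betw_def)
qed

section \<open>The projection of an orbifold chart\<close>

locale chart =
  fixes T :: "'a topology" and C :: "('a, 'v::euclidean_space, 'g) orbifold_chart"
  assumes is_chart: "is_chart DIM('v) T C"
begin

abbreviation "G \<equiv> ch_grp C"
abbreviation "A \<equiv> ch_dom C"
abbreviation "\<alpha> \<equiv> ch_act C"
abbreviation "\<pi> \<equiv> ch_proj C"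

lemma action: "group_action G A \<alpha>"
  using is_chart unfolding is_chart_def faithful_action_def by blast

lemma group_G: "group G"
  using action unfolding group_action_def group_hom_def by blast

lemma finite_G: "finite (carrier G)" and zero_in: "0 \<in> A"
  and act_smooth: "g \<in> carrier G \<Longrightarrow> smooth_map A (\<alpha> g)"
  and act_zero: "g \<in> carrier G \<Longrightarrow> \<alpha> g 0 = 0"
  and nbhd_open: "openin T (ch_nbhd C)"
  and phi_homeo: "homeomorphic_map (orbit_topology G A \<alpha>) (subtopology T (ch_nbhd C)) (ch_phi C)"
  using is_chart unfolding is_chart_def by auto

lemma act_in: "g \<in> carrier G \<Longrightarrow> u \<in> A \<Longrightarrow> \<alpha> g u \<in> A"
  using group_action.element_image[OF action] by blast

lemma act_mult: "g \<in> carrier G \<Longrightarrow> h \<in> carrier G \<Longrightarrow> u \<in> A \<Longrightarrow> \<alpha> (g \<otimes>\<^bsub>G\<^esub> h) u = \<alpha> g (\<alpha> h u)"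
  using group_action.composition_rule[OF action] by blast

lemma act_one: "u \<in> A \<Longrightarrow> \<alpha> \<one>\<^bsub>G\<^esub> u = u"
  using group_action.id_eq_one[OF action] by (metis restrict_apply')

lemma act_inv: "g \<in> carrier G \<Longrightarrow> u \<in> A \<Longrightarrow> \<alpha> (inv\<^bsub>G\<^esub> g) (\<alpha> g u) = u"
  using group_action.orbit_sym_aux[OF action] by blast

lemma act_inv': assumes "g \<in> carrier G" "u \<in> A" shows "\<alpha> g (\<alpha> (inv\<^bsub>G\<^esub> g) u) = u"
proof -
  interpret group G by (rule group_G)
  show ?thesis using act_inv[of "inv\<^bsub>G\<^esub> g" u] assms by simp
qed

lemma inv_in: "g \<in> carrier G \<Longrightarrow> inv\<^bsub>G\<^esub> g \<in> carrier G"
  using group_G by (simp add: group.inv_closed)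

lemma act_image: "g \<in> carrier G \<Longrightarrow> U \<subseteq> A \<Longrightarrow> \<alpha> g ` U = A \<inter> \<alpha> (inv\<^bsub>G\<^esub> g) -` U"
  using act_in act_inv act_inv' by (auto simp: image_iff subset_iff) metis

lemma act_open:
  assumes "g \<in> carrier G" "openin (top_of_set A) U"
  shows "openin (top_of_set A) (\<alpha> g ` U)"
proof -
  have U: "U \<subseteq> A" using openin_subset[OF assms(2)] by simp
  have i: "inv\<^bsub>G\<^esub> g \<in> carrier G" by (rule inv_in[OF assms(1)])
  have "continuous_on A (\<alpha> (inv\<^bsub>G\<^esub> g))" using act_smooth[OF i] smooth_map_continuous_on by blast
  then have "openin (top_of_set A) (A \<inter> \<alpha> (inv\<^bsub>G\<^esub> g) -` U)"
    by (rule continuous_openin_preimage[OF _ _ assms(2)]) (use act_in[OF i] in auto)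
  then show ?thesis unfolding act_image[OF assms(1) U] .
qed

lemma orbit_eq_iff:
  assumes "u \<in> A" "v \<in> A"
  shows "orbit G \<alpha> u = orbit G \<alpha> v \<longleftrightarrow> (\<exists>g\<in>carrier G. v = \<alpha> g u)"
proof
  assume "orbit G \<alpha> u = orbit G \<alpha> v"
  then have "v \<in> orbit G \<alpha> u" using group_action.orbit_refl[OF action assms(2)] by simp
  then show "\<exists>g\<in>carrier G. v = \<alpha> g u" unfolding orbit_def by blast
next
  assume "\<exists>g\<in>carrier G. v = \<alpha> g u"
  then obtain g where g: "g \<in> carrier G" "v = \<alpha> g u" by blast
  interpret group G by (rule group_G)
  have 1: "orbit G \<alpha> v \<subseteq> orbit G \<alpha> u"
    unfolding orbit_def g(2) using g(1) act_mult[OF _ g(1) assms(1), symmetric] by auto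
  have "\<alpha> h u \<in> orbit G \<alpha> v" if h: "h \<in> carrier G" for h
  proof -
    have "\<alpha> h u = \<alpha> (h \<otimes>\<^bsub>G\<^esub> inv\<^bsub>G\<^esub> g) v"
      unfolding g(2) using g(1) h assms(1) by (simp add: act_mult act_in act_inv)
    then show ?thesis unfolding orbit_def using g(1) h by blast
  qed
  then show "orbit G \<alpha> u = orbit G \<alpha> v" using 1 unfolding orbit_def by blast
qed

lemma topspace_orbit: "topspace (orbit_topology G A \<alpha>) = orbits G A \<alpha>"
proof
  show "topspace (orbit_topology G A \<alpha>) \<subseteq> orbits G A \<alpha>"
    using openin_topspace[of "orbit_topology G A \<alpha>"] unfolding openin_orbit_topology by blast
  have "{p \<in> A. orbit G \<alpha> p \<in> orbits G A \<alpha>} = A" unfolding orbits_def by blast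
  then have "openin (orbit_topology G A \<alpha>) (orbits G A \<alpha>)"
    unfolding openin_orbit_topology by simp
  then show "orbits G A \<alpha> \<subseteq> topspace (orbit_topology G A \<alpha>)" by (rule openin_subset)
qed

lemma nbhd_eq: "ch_nbhd C = \<pi> ` A"
  unfolding ch_nbhd_def ch_proj_def orbits_def by auto

lemma proj_eq_iff:
  assumes "u \<in> A" "v \<in> A"
  shows "\<pi> u = \<pi> v \<longleftrightarrow> (\<exists>g\<in>carrier G. v = \<alpha> g u)"
proof -
  have "inj_on (ch_phi C) (orbits G A \<alpha>)"
    using phi_homeo homeomorphic_imp_injective_map topspace_orbit by metis
  then have "\<pi> u = \<pi> v \<longleftrightarrow> orbit G \<alpha> u = orbit G \<alpha> v"
    unfolding ch_proj_def using assms by (intro inj_on_eq_iff) (auto simp: orbits_def)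
  then show ?thesis using orbit_eq_iff[OF assms] by simp
qed

lemma proj_act: "g \<in> carrier G \<Longrightarrow> u \<in> A \<Longrightarrow> \<pi> (\<alpha> g u) = \<pi> u"
  using proj_eq_iff[of u "\<alpha> g u"] act_in by force

lemma proj_continuous: "continuous_map (top_of_set A) T \<pi>"
proof -
  have "continuous_map (top_of_set A) (orbit_topology G A \<alpha>) (orbit G \<alpha>)"
    unfolding continuous_map topspace_orbit openin_orbit_topology by (auto simp: orbits_def)
  moreover have "continuous_map (orbit_topology G A \<alpha>) T (ch_phi C)"
    using homeomorphic_imp_continuous_map[OF phi_homeo] by (simp add: continuous_map_in_subtopology)
  ultimately have "continuous_map (top_of_set A) T (ch_phi C \<circ> orbit G \<alpha>)"
    by (rule continuous_map_compose)
  then show ?thesis unfolding ch_proj_def[abs_def] o_def .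
qed

text \<open>The saturation of an open set is the union of its translates, each open because the
  inverse group element acts continuously.\<close>

lemma proj_open:
  assumes U: "openin (top_of_set A) U"
  shows "openin T (\<pi> ` U)"
proof -
  have UA: "U \<subseteq> A" using openin_subset[OF U] by simp
  have "{p \<in> A. orbit G \<alpha> p \<in> orbit G \<alpha> ` U} = (\<Union>g\<in>carrier G. \<alpha> g ` U)"
  proof
    show "{p \<in> A. orbit G \<alpha> p \<in> orbit G \<alpha> ` U} \<subseteq> (\<Union>g\<in>carrier G. \<alpha> g ` U)"
    proof clarify
      fix p u assume p: "p \<in> A" "u \<in> U" "orbit G \<alpha> p = orbit G \<alpha> u"
      then have "\<exists>g\<in>carrier G. p = \<alpha> g u" using orbit_eq_iff[of u p] UA by auto
      then show "p \<in> (\<Union>g\<in>carrier G. \<alpha> g ` U)" using p(2) by blast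
    qed
    show "(\<Union>g\<in>carrier G. \<alpha> g ` U) \<subseteq> {p \<in> A. orbit G \<alpha> p \<in> orbit G \<alpha> ` U}"
    proof clarify
      fix g u assume g: "g \<in> carrier G" "u \<in> U"
      have u: "u \<in> A" "\<alpha> g u \<in> A" using g UA act_in by auto
      have "orbit G \<alpha> u = orbit G \<alpha> (\<alpha> g u)" using orbit_eq_iff[OF u] g by blast
      then have "orbit G \<alpha> (\<alpha> g u) \<in> orbit G \<alpha> ` U" using g(2) by (metis imageI)
      then show "\<alpha> g u \<in> A \<and> orbit G \<alpha> (\<alpha> g u) \<in> orbit G \<alpha> ` U" using u by blast
    qed
  qed
  moreover have "openin (top_of_set A) (\<Union>g\<in>carrier G. \<alpha> g ` U)"
    using act_open[OF _ U] by blast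
  moreover have "orbit G \<alpha> ` U \<subseteq> orbits G A \<alpha>" using UA unfolding orbits_def by blast
  ultimately have "openin (orbit_topology G A \<alpha>) (orbit G \<alpha> ` U)"
    unfolding openin_orbit_topology by simp
  then have "openin (subtopology T (ch_nbhd C)) (ch_phi C ` orbit G \<alpha> ` U)"
    using homeomorphic_imp_open_map[OF phi_homeo] unfolding open_map_def by blast
  then have "openin T (ch_phi C ` orbit G \<alpha> ` U)"
    using nbhd_open openin_open_subtopology by blast
  then show ?thesis unfolding ch_proj_def[abs_def] image_image .
qed

lemma proj_in: "u \<in> A \<Longrightarrow> \<pi> u \<in> topspace T"
  using proj_continuous unfolding continuous_map_def by auto

end

section \<open>Orbifolds\<close>

locale orbifold_with_boundary =
  fixes X :: "('a, 'v::euclidean_space, 'g) orbifold"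
  assumes smooth_orbifold: "smooth_orbifold DIM('v) X"
begin

abbreviation "T \<equiv> orb_space X"
abbreviation "bd \<equiv> orb_boundary DIM('v) X"
abbreviation hsb :: "'v set \<Rightarrow> 'v set" where "hsb \<equiv> half_space_boundary DIM('v)"

lemma Hausdorff: "Hausdorff_space T"
  using smooth_orbifold unfolding smooth_orbifold_def by blast

lemma chart: "C \<in> orb_charts X \<Longrightarrow> chart T C"
  using smooth_orbifold unfolding smooth_orbifold_def by (auto intro: chart.intro)

lemma chart_at:
  assumes "openin T U" "x \<in> U"
  obtains C where "C \<in> orb_charts X" "ch_proj C 0 = x" "ch_nbhd C \<subseteq> U"
  using smooth_orbifold assms unfolding smooth_orbifold_def ch_center_def by blast

lemma boundary_iff:
  "C \<in> orb_charts X \<Longrightarrow> v \<in> ch_dom C \<Longrightarrow> ch_proj C v \<in> bd \<longleftrightarrow> v \<in> hsb (ch_dom C)"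
  using smooth_orbifold unfolding smooth_orbifold_def by blast

lemma boundary_subset: "bd \<subseteq> topspace T"
proof
  fix x assume "x \<in> bd"
  then obtain C where C: "C \<in> orb_charts X" "x = ch_center C" unfolding orb_boundary_def by blast
  show "x \<in> topspace T"
    unfolding C(2) ch_center_def using chart.proj_in[OF chart[OF C(1)]] chart.zero_in[OF chart[OF C(1)]] by blast
qed

text \<open>A chart embedding covers the inclusion but may send 0 to any point of the orbit of
  \<open>v\<close>; a group element corrects this. The smooth left inverse \<rho> is what later
  makes derivatives injective.\<close>

lemma centered_embedding:
  assumes E: "E \<in> orb_charts X" and D: "D \<in> orb_charts X" and sub: "ch_nbhd E \<subseteq> ch_nbhd D"
    and v: "v \<in> ch_dom D" "ch_proj D v = ch_proj E 0"
  obtains \<psi> \<rho> where "smooth_map (ch_dom E) \<psi>" "\<psi> ` ch_dom E \<subseteq> ch_dom D" "\<psi> 0 = v"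
    "\<And>u. u \<in> ch_dom E \<Longrightarrow> ch_proj D (\<psi> u) = ch_proj E u"
    "smooth_map (\<psi> ` ch_dom E) \<rho>" "\<And>u. u \<in> ch_dom E \<Longrightarrow> \<rho> (\<psi> u) = u"
proof -
  interpret E: chart T E by (rule chart[OF E])
  interpret D: chart T D by (rule chart[OF D])
  obtain \<psi> \<theta> where "chart_embedding E D \<psi> \<theta>"
    using smooth_orbifold E D sub unfolding smooth_orbifold_def by blast
  then have im: "\<psi> ` E.A \<subseteq> D.A" and bij: "bij_betw \<psi> E.A (\<psi> ` E.A)" and sm: "smooth_map E.A \<psi>"
    and smi: "smooth_map (\<psi> ` E.A) (inv_into E.A \<psi>)" and pr: "\<And>u. u \<in> E.A \<Longrightarrow> D.\<pi> (\<psi> u) = E.\<pi> u"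
    unfolding chart_embedding_def smooth_embedding_def diffeomorphism_def by auto
  have "D.\<pi> (\<psi> 0) = D.\<pi> v" using pr[OF E.zero_in] v(2) by simp
  then obtain g where g: "g \<in> carrier D.G" "v = D.\<alpha> g (\<psi> 0)"
    using D.proj_eq_iff[of "\<psi> 0" v] im E.zero_in v(1) by blast
  have gi: "inv\<^bsub>D.G\<^esub> g \<in> carrier D.G" by (rule D.inv_in[OF g(1)])
  have psi_in: "\<psi> u \<in> D.A" if "u \<in> E.A" for u using im that by blast
  show ?thesis
  proof (rule that[of "\<lambda>u. D.\<alpha> g (\<psi> u)" "\<lambda>w. inv_into E.A \<psi> (D.\<alpha> (inv\<^bsub>D.G\<^esub> g) w)"])
    show "smooth_map E.A (\<lambda>u. D.\<alpha> g (\<psi> u))"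
      by (rule smooth_map_compose[OF sm im D.act_smooth[OF g(1)]])
    show "(\<lambda>u. D.\<alpha> g (\<psi> u)) ` E.A \<subseteq> D.A" using psi_in D.act_in[OF g(1)] by blast
    show "D.\<alpha> g (\<psi> 0) = v" using g(2) by simp
    show "D.\<pi> (D.\<alpha> g (\<psi> u)) = E.\<pi> u" if "u \<in> E.A" for u
      using D.proj_act[OF g(1) psi_in[OF that]] pr[OF that] by simp
    have sub': "(\<lambda>u. D.\<alpha> g (\<psi> u)) ` E.A \<subseteq> D.A" using psi_in D.act_in[OF g(1)] by blast
    show "smooth_map ((\<lambda>u. D.\<alpha> g (\<psi> u)) ` E.A) (\<lambda>w. inv_into E.A \<psi> (D.\<alpha> (inv\<^bsub>D.G\<^esub> g) w))"
    proof (rule smooth_map_compose[OF smooth_map_subset[OF D.act_smooth[OF gi] sub'] _ smi])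
      show "D.\<alpha> (inv\<^bsub>D.G\<^esub> g) ` (\<lambda>u. D.\<alpha> g (\<psi> u)) ` E.A \<subseteq> \<psi> ` E.A"
        using D.act_inv[OF g(1) psi_in] by (auto simp: image_iff)
    qed
    show "inv_into E.A \<psi> (D.\<alpha> (inv\<^bsub>D.G\<^esub> g) (D.\<alpha> g (\<psi> u))) = u" if "u \<in> E.A" for u
      unfolding D.act_inv[OF g(1) psi_in[OF that]] using bij_betw_inv_into_left[OF bij that] .
  qed
qed

end

section \<open>Generic boundary points\<close>

text \<open>Closedness is essential: two sets with empty interior can together be
  everything.\<close>

lemma interior_of_UN_empty:
  assumes "finite I" "\<And>i. i \<in> I \<Longrightarrow> closedin Y (S i)" "\<And>i. i \<in> I \<Longrightarrow> Y interior_of S i = {}"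
  shows "Y interior_of (\<Union>i\<in>I. S i) = {}"
  using assms
proof (induction I)
  case (insert i I)
  then have "Y interior_of (S i \<union> (\<Union>i\<in>I. S i)) = {}"
    by (subst interior_of_union_eq_empty) auto
  then show ?case by simp
qed simp

text \<open>Adding the kernel coordinate in the direction \<open>e\<close> makes the derivative at a
  regular point invertible, and invertibility persists nearby. Openness will make the critical
  points in a closed ball a compact set.\<close>

lemma open_regular_points:
  fixes P :: "'v::euclidean_space \<Rightarrow> 'v"
  assumes W: "open W" and P: "Ck_on 2 P W" and Pe: "\<And>p. p \<in> W \<Longrightarrow> P p \<bullet> e = 0" and e: "e \<noteq> 0"
  shows "open {p \<in> W. range (frechet_derivative P (at p)) = hyp e}"
proof -
  interpret C2_map P W by unfold_locales fact+
  have fD: "frechet_derivative P (at p) = D p" for p unfolding D_def by simp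
  have De: "D p v \<bullet> e = 0" if "p \<in> W" for p v
    by (rule derivative_into_hyp[OF assms(1) that Pe D_deriv[OF that]])
  have "\<exists>\<rho>>0. ball p \<rho> \<subseteq> {p \<in> W. range (D p) = hyp e}" if p: "p \<in> W" "range (D p) = hyp e" for p
  proof -
    have lin: "linear (D p)" by (rule D_linear[OF p(1)])
    obtain k where k: "k \<noteq> 0" "\<And>v. D p v = 0 \<longleftrightarrow> v \<in> span {k}"
      using kernel_of_submersion[OF lin e p(2)] by metis
    define M where "M q v = D q v + (v \<bullet> k) *\<^sub>R e" for q v
    have linM: "linear (M q)" if "q \<in> W" for q
      unfolding M_def using D_linear[OF that]
      by (intro linearI) (simp_all add: linear_add linear_cmul inner_add_left algebra_simps)
    have Me: "M q v \<bullet> e = (v \<bullet> k) * (e \<bullet> e)" if "q \<in> W" for q v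
      unfolding M_def using De[OF that] by (simp add: inner_add_left)
    have "v = 0" if "M p v = 0" for v
    proof -
      have vk: "v \<bullet> k = 0" using Me[OF p(1), of v] that e by simp
      then have "D p v = 0" using that unfolding M_def by simp
      then have "v \<in> range (\<lambda>c. c *\<^sub>R k)" using k(2) by (simp add: span_singleton)
      then show ?thesis using vk k(1) by auto
    qed
    then have "inj (M p)" using linear_injective_0[OF linM[OF p(1)]] by blast
    then obtain B where B: "B > 0" "\<And>v. B * norm v \<le> norm (M p v)"
      using linear_inj_bounded_below_pos[OF linM[OF p(1)]] by metis
    obtain \<rho> where \<rho>: "\<rho> > 0" "ball p \<rho> \<subseteq> W"
      "\<And>q v. q \<in> ball p \<rho> \<Longrightarrow> norm (D q v - D p v) \<le> (B / 2) * norm v"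
      using D_near[OF p(1), of "B / 2"] B(1) by (metis half_gt_zero)
    have "range (D q) = hyp e" if q: "q \<in> ball p \<rho>" for q
    proof
      have qW: "q \<in> W" using q \<rho> by blast
      show "range (D q) \<subseteq> hyp e" using De[OF qW] unfolding hyp_def by auto
      have "v = 0" if "M q v = 0" for v
      proof -
        have "B * norm v \<le> norm (M p v - M q v)" using B(2)[of v] that by simp
        also have "\<dots> \<le> (B / 2) * norm v"
          using \<rho>(3)[OF q, of v] unfolding M_def by (simp add: norm_minus_commute)
        finally have "norm v \<le> 0" using B(1) by (simp add: mult_le_cancel_right)
        then show ?thesis by simp
      qed
      then have "inj (M q)" using linear_injective_0[OF linM[OF qW]] by blast
      then have sur: "surj (M q)" using linear_injective_imp_surjective[OF linM[OF qW]] by blast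
      show "hyp e \<subseteq> range (D q)"
      proof
        fix z assume z: "z \<in> hyp e"
        have "z \<in> range (M q)" unfolding sur by (rule UNIV_I)
        then obtain v where v: "z = M q v" by (rule rangeE)
        then have "v \<bullet> k = 0" using Me[OF qW, of v] z e unfolding hyp_def by simp
        then show "z \<in> range (D q)" using v unfolding M_def by simp
      qed
    qed
    then show ?thesis using \<rho>(1,2) by blast
  qed
  then show ?thesis unfolding open_contains_ball fD by blast
qed

text \<open>The boundary chart of \<open>C\<close> transported to the hyperplane by the flattening
  map; \<tau> becomes its projection and \<beta> its action.\<close>

locale boundary_flat = orbifold_with_boundary X
  for X :: "('a, 'v::euclidean_space, 'g) orbifold" +
  fixes C e h
  assumes C: "C \<in> orb_charts X" and hc: "half_coords (ch_dom C) e h"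
begin

sublocale C: chart T C by (rule chart[OF C])
sublocale hc: half_coords "ch_dom C" e h by (rule hc)

definition \<tau> where "\<tau> z = ch_proj C (hc.hi z)"
definition \<beta> where "\<beta> g z = h (ch_act C g (hc.hi z))"
text \<open>Local injectivity of the orbit projection is the form in which the stabilizer of
  \<open>z\<close> acts trivially on the boundary near \<open>z\<close>.\<close>

definition locinj where "locinj z \<longleftrightarrow> (\<exists>Q. open Q \<and> z \<in> Q \<and> inj_on \<tau> (Q \<inter> hyp e))"

lemma hi_dom: "z \<in> hyp e \<Longrightarrow> hc.hi z \<in> ch_dom C"
  using hc.hi_in hc.hyp_H by blast

lemma \<tau>_h: "p \<in> ch_dom C \<Longrightarrow> \<tau> (h p) = ch_proj C p"
  unfolding \<tau>_def by simp

lemma \<tau>_bd: "z \<in> hyp e \<Longrightarrow> \<tau> z \<in> bd"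
  unfolding \<tau>_def using boundary_iff[OF C hi_dom] hc.hi_boundary by blast

lemma hi_cont: "continuous_on (hyp e) hc.hi"
  using smooth_map_continuous_on[OF hc.hi_smooth] hc.hyp_H continuous_on_subset by blast

lemma \<tau>_continuous: "continuous_map (top_of_set (hyp e)) (subtopology T bd) \<tau>"
proof -
  have "continuous_map (top_of_set (hyp e)) (top_of_set (ch_dom C)) hc.hi"
    using hi_cont hi_dom by (auto simp: continuous_map_iff_continuous)
  then have "continuous_map (top_of_set (hyp e)) T (ch_proj C \<circ> hc.hi)"
    by (rule continuous_map_compose[OF _ C.proj_continuous])
  then have "continuous_map (top_of_set (hyp e)) T \<tau>" unfolding \<tau>_def[abs_def] o_def .
  then show ?thesis using \<tau>_bd by (auto simp: continuous_map_in_subtopology)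
qed

lemma \<beta>_in:
  assumes "g \<in> carrier (ch_grp C)" "z \<in> hyp e"
  shows "ch_act C g (hc.hi z) \<in> half_space_boundary DIM('v) (ch_dom C)" "\<beta> g z \<in> hyp e"
proof -
  have "ch_proj C (ch_act C g (hc.hi z)) \<in> bd"
    using C.proj_act[OF assms(1) hi_dom[OF assms(2)]] \<tau>_bd[OF assms(2)] unfolding \<tau>_def by simp
  then show 1: "ch_act C g (hc.hi z) \<in> half_space_boundary DIM('v) (ch_dom C)"
    using boundary_iff[OF C C.act_in[OF assms(1) hi_dom[OF assms(2)]]] by blast
  show "\<beta> g z \<in> hyp e" unfolding \<beta>_def by (rule hc.h_boundary[OF 1])
qed

lemma \<tau>_eq_iff:
  assumes z: "z \<in> hyp e" "z' \<in> hyp e"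
  shows "\<tau> z = \<tau> z' \<longleftrightarrow> (\<exists>g\<in>carrier (ch_grp C). z' = \<beta> g z)"
proof -
  have "hc.hi z' = ch_act C g (hc.hi z) \<longleftrightarrow> z' = \<beta> g z" if "g \<in> carrier (ch_grp C)" for g
  proof -
    have "h (hc.hi z') = z'" using z(2) by (intro hc.h_hi) (simp add: hyp_def)
    then show ?thesis
      unfolding \<beta>_def using hc.hi_h[OF C.act_in[OF that hi_dom[OF z(1)]]] by metis
  qed
  then show ?thesis unfolding \<tau>_def using C.proj_eq_iff[OF hi_dom[OF z(1)] hi_dom[OF z(2)]] by auto
qed

lemma \<beta>_cont: "g \<in> carrier (ch_grp C) \<Longrightarrow> continuous_on (hyp e) (\<beta> g)"
proof -
  assume g: "g \<in> carrier (ch_grp C)"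
  have 1: "continuous_on (hyp e) (\<lambda>z. ch_act C g (hc.hi z))"
    by (rule continuous_on_compose2[OF smooth_map_continuous_on[OF C.act_smooth[OF g]] hi_cont])
      (use hi_dom in blast)
  show ?thesis unfolding \<beta>_def[abs_def]
    by (rule continuous_on_compose2[OF smooth_map_continuous_on[OF hc.h_smooth] 1])
      (use C.act_in[OF g] hi_dom in blast)
qed

lemma \<beta>_inv:
  assumes g: "g \<in> carrier (ch_grp C)" and z: "z \<in> hyp e"
  shows "\<beta> (inv\<^bsub>ch_grp C\<^esub> g) (\<beta> g z) = z" "\<beta> g (\<beta> (inv\<^bsub>ch_grp C\<^esub> g) z) = z"
proof -
  have "0 \<le> z \<bullet> e" using z unfolding hyp_def by simp
  then show "\<beta> (inv\<^bsub>ch_grp C\<^esub> g) (\<beta> g z) = z" "\<beta> g (\<beta> (inv\<^bsub>ch_grp C\<^esub> g) z) = z"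
    unfolding \<beta>_def using C.act_in C.inv_in[OF g] g hi_dom[OF z] C.act_inv C.act_inv' by simp_all
qed

lemma \<beta>_open:
  assumes g: "g \<in> carrier (ch_grp C)" and P: "openin (top_of_set (hyp e)) P"
  shows "openin (top_of_set (hyp e)) (\<beta> g ` P)"
proof -
  have i: "inv\<^bsub>ch_grp C\<^esub> g \<in> carrier (ch_grp C)" by (rule C.inv_in[OF g])
  have PH: "P \<subseteq> hyp e" using openin_subset[OF P] by simp
  have "\<beta> g ` P = hyp e \<inter> \<beta> (inv\<^bsub>ch_grp C\<^esub> g) -` P"
  proof
    show "\<beta> g ` P \<subseteq> hyp e \<inter> \<beta> (inv\<^bsub>ch_grp C\<^esub> g) -` P"
      using \<beta>_in(2)[OF g] \<beta>_inv(1)[OF g] PH by (auto simp: subset_iff)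
    show "hyp e \<inter> \<beta> (inv\<^bsub>ch_grp C\<^esub> g) -` P \<subseteq> \<beta> g ` P"
      using \<beta>_inv(2)[OF g] by (auto simp: image_iff) metis
  qed
  moreover have "openin (top_of_set (hyp e)) (hyp e \<inter> \<beta> (inv\<^bsub>ch_grp C\<^esub> g) -` P)"
    by (rule continuous_openin_preimage[OF \<beta>_cont[OF i] _ P]) (use \<beta>_in(2)[OF i] in auto)
  ultimately show ?thesis by simp
qed

lemma closed_not_locinj: "closed {z \<in> hyp e. \<not> locinj z}"
proof -
  have "{z. locinj z} = \<Union>{Q. open Q \<and> inj_on \<tau> (Q \<inter> hyp e)}"
    unfolding locinj_def by blast
  then have "open {z. locinj z}" by auto
  moreover have "{z \<in> hyp e. \<not> locinj z} = hyp e \<inter> - {z. locinj z}" by auto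
  ultimately show ?thesis using closed_hyp by (auto intro: closed_Int)
qed

text \<open>A point whose stabilizer is minimal in a neighbourhood has a stabilizer acting trivially near it.\<close>

lemma not_locinj_nowhere_dense:
  assumes P: "openin (top_of_set (hyp e)) P" "P \<subseteq> {z \<in> hyp e. \<not> locinj z}"
  shows "P = {}"
proof (rule ccontr)
  assume ne: "P \<noteq> {}"
  let ?\<Gamma> = "carrier (ch_grp C)"
  define s where "s z = card {g \<in> ?\<Gamma>. \<beta> g z = z}" for z
  obtain z where z: "z \<in> P" "\<And>z'. z' \<in> P \<Longrightarrow> s z \<le> s z'"
    using ne arg_min_nat_lemma[of "\<lambda>z. z \<in> P" _ s] by (metis all_not_in_conv)
  have zH: "z \<in> hyp e" using z P by blast
  obtain P' where P': "open P'" "P = hyp e \<inter> P'" using P(1) unfolding openin_open by blast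
  have "\<exists>V. open V \<and> z \<in> V \<and> (\<forall>z'\<in>V \<inter> hyp e. \<beta> g z' \<notin> V)" if g: "g \<in> ?\<Gamma>" "\<beta> g z \<noteq> z" for g
  proof -
    obtain U1 U2 where U: "open U1" "open U2" "z \<in> U1" "\<beta> g z \<in> U2" "U1 \<inter> U2 = {}"
      using hausdorff[of z "\<beta> g z"] g(2) by metis
    have "openin (top_of_set (hyp e)) (hyp e \<inter> \<beta> g -` U2)"
      using continuous_openin_preimage_gen[OF \<beta>_cont[OF g(1)] U(2)] .
    then obtain V where V: "open V" "hyp e \<inter> \<beta> g -` U2 = hyp e \<inter> V" unfolding openin_open by blast
    have "z \<in> V" using V(2) zH U(4) by blast
    then show ?thesis using U V by (intro exI[of _ "U1 \<inter> V"]) blast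
  qed
  then obtain V where V: "\<And>g. g \<in> ?\<Gamma> \<Longrightarrow> \<beta> g z \<noteq> z \<Longrightarrow> open (V g) \<and> z \<in> V g \<and> (\<forall>z'\<in>V g \<inter> hyp e. \<beta> g z' \<notin> V g)"
    by metis
  \<comment> \<open>An element that moves a point of \<open>Q\<close> on the hyperplane to another
    one must fix \<open>z\<close>. Stabilizers in \<open>Q\<close> lie in that of \<open>z\<close>
    and are no smaller by minimality, so such an element fixes all these points.\<close>
  define Q where "Q = P' \<inter> (\<Inter>g\<in>{g \<in> ?\<Gamma>. \<beta> g z \<noteq> z}. V g)"
  have Q: "open Q" "z \<in> Q"
    unfolding Q_def using V P' z(1) C.finite_G by (auto intro!: open_Int open_INT)
  have QV: "Q \<subseteq> V g" if "g \<in> ?\<Gamma>" "\<beta> g z \<noteq> z" for g unfolding Q_def using that by blast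
  have stab: "{g \<in> ?\<Gamma>. \<beta> g z' = z'} = {g \<in> ?\<Gamma>. \<beta> g z = z}" if z': "z' \<in> Q" "z' \<in> hyp e" for z'
  proof (rule card_seteq)
    show "finite {g \<in> ?\<Gamma>. \<beta> g z = z}" using C.finite_G by simp
    show "{g \<in> ?\<Gamma>. \<beta> g z' = z'} \<subseteq> {g \<in> ?\<Gamma>. \<beta> g z = z}"
      using V QV z' by (auto, metis IntI subsetD)
    have "z' \<in> P" using z' P'(2) unfolding Q_def by blast
    then show "card {g \<in> ?\<Gamma>. \<beta> g z = z} \<le> card {g \<in> ?\<Gamma>. \<beta> g z' = z'}" using z(2) unfolding s_def by blast
  qed
  have "inj_on \<tau> (Q \<inter> hyp e)"
  proof (rule inj_onI)
    fix x y assume xy: "x \<in> Q \<inter> hyp e" "y \<in> Q \<inter> hyp e" "\<tau> x = \<tau> y"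
    then obtain g where g: "g \<in> ?\<Gamma>" "y = \<beta> g x" using \<tau>_eq_iff by blast
    have "\<beta> g z = z"
    proof (rule ccontr)
      assume ng: "\<beta> g z \<noteq> z"
      then have "x \<in> V g \<inter> hyp e" "\<beta> g x \<in> V g" using QV[OF g(1) ng] xy g(2) by auto
      then show False using V[OF g(1) ng] by blast
    qed
    then have "\<beta> g x = x" using stab[of x] xy(1) g(1) by blast
    then show "x = y" using g by simp
  qed
  then have "locinj z" unfolding locinj_def using Q by blast
  then show False using z(1) P(2) by blast
qed

text \<open>\<tau> identifies the points of an orbit, so the preimage of the image of
  \<open>Q\<close> is the union of finitely many translates of \<open>Q\<close>. Each is closed with
  empty interior, as \<beta> acts by homeomorphisms.\<close>

lemma image_nowhere_dense:
  assumes Q: "compact Q" "Q \<subseteq> hyp e"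
    and int: "top_of_set (hyp e) interior_of Q = {}"
  shows "closedin (subtopology T bd) (\<tau> ` Q)" "subtopology T bd interior_of (\<tau> ` Q) = {}"
proof -
  have "compactin (subtopology T bd) (\<tau> ` Q)"
    by (rule image_compactin[OF _ \<tau>_continuous]) (use Q in \<open>simp add: compactin_subtopology\<close>)
  then show "closedin (subtopology T bd) (\<tau> ` Q)"
    by (rule compactin_imp_closedin[OF Hausdorff_space_subtopology[OF Hausdorff]])
  let ?O = "subtopology T bd interior_of (\<tau> ` Q)"
  let ?\<Gamma> = "carrier (ch_grp C)"
  define P where "P = {z \<in> hyp e. \<tau> z \<in> ?O}"
  have oP: "openin (top_of_set (hyp e)) P"
    using openin_continuous_map_preimage[OF \<tau>_continuous openin_interior_of, of "\<tau> ` Q"]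
    unfolding P_def by simp
  have clQ: "closed (\<beta> g ` Q)" if "g \<in> ?\<Gamma>" for g
    by (intro compact_imp_closed compact_continuous_image continuous_on_subset[OF \<beta>_cont[OF that] Q(2)] Q(1))
  have "P \<subseteq> (\<Union>g\<in>?\<Gamma>. \<beta> g ` Q)"
  proof
    fix z assume "z \<in> P"
    then have z: "z \<in> hyp e" "\<tau> z \<in> \<tau> ` Q"
      unfolding P_def using interior_of_subset[of "subtopology T bd" "\<tau> ` Q"] by auto
    then obtain q where "q \<in> Q" "\<tau> q = \<tau> z" by auto
    then show "z \<in> (\<Union>g\<in>?\<Gamma>. \<beta> g ` Q)" using \<tau>_eq_iff[of q z] z Q(2) by blast
  qed
  then have "P \<subseteq> top_of_set (hyp e) interior_of (\<Union>g\<in>?\<Gamma>. \<beta> g ` Q)"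
    using oP by (simp add: interior_of_maximal)
  also have "\<dots> = {}"
  proof (rule interior_of_UN_empty[OF C.finite_G])
    fix g assume g: "g \<in> ?\<Gamma>"
    have sub: "\<beta> g ` Q \<subseteq> hyp e" using \<beta>_in(2)[OF g] Q(2) by blast
    then show "closedin (top_of_set (hyp e)) (\<beta> g ` Q)" using clQ[OF g] by (simp add: closed_subset)
    let ?R = "top_of_set (hyp e) interior_of \<beta> g ` Q"
    have i: "inv\<^bsub>ch_grp C\<^esub> g \<in> ?\<Gamma>" by (rule C.inv_in[OF g])
    have "\<beta> (inv\<^bsub>ch_grp C\<^esub> g) ` ?R \<subseteq> \<beta> (inv\<^bsub>ch_grp C\<^esub> g) ` \<beta> g ` Q"
      by (rule image_mono[OF interior_of_subset])
    also have "\<dots> \<subseteq> Q" using \<beta>_inv(1)[OF g] Q(2) by auto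
    finally have "\<beta> (inv\<^bsub>ch_grp C\<^esub> g) ` ?R \<subseteq> top_of_set (hyp e) interior_of Q"
      using \<beta>_open[OF i openin_interior_of] by (simp add: interior_of_maximal)
    then show "?R = {}" unfolding int by simp
  qed
  finally have "P = {}" by blast
  show "?O = {}"
  proof (rule ccontr)
    assume "?O \<noteq> {}"
    then obtain x where x: "x \<in> ?O" by blast
    then obtain q where "q \<in> Q" "x = \<tau> q" using interior_of_subset[of "subtopology T bd" "\<tau> ` Q"] by blast
    then have "q \<in> P" unfolding P_def using x Q(2) by blast
    then show False using \<open>P = {}\<close> by blast
  qed
qed

end

text \<open>Differentiate \<open>R (M u) = u\<close> within \<open>Z\<close>, the derivative of
  \<open>R\<close> being supplied by a smooth extension. This is how chart embeddings get injective
  derivatives.\<close>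

lemma left_inverse_derivative_inj:
  assumes acc: "axis_accessible Z z0" and z0: "z0 \<in> Z"
    and M: "(M has_derivative M') (at z0 within Z)"
    and R: "smooth_map (M ` Z) R" "\<And>u. u \<in> Z \<Longrightarrow> R (M u) = u"
    and v: "M' v = 0"
  shows "v = 0"
proof -
  have M0: "M z0 \<in> M ` Z" using z0 by blast
  obtain W g where "(R has_derivative frechet_derivative g (at (M z0))) (at (M z0) within M ` Z)"
    using smooth_extension[OF R(1) M0] by metis
  then have "((\<lambda>u. R (M u)) has_derivative (\<lambda>u. frechet_derivative g (at (M z0)) (M' u))) (at z0 within Z)"
    by (rule has_derivative_in_compose[OF M])
  then have d: "((\<lambda>u. u) has_derivative (\<lambda>u. frechet_derivative g (at (M z0)) (M' u))) (at z0 within Z)"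
    by (rule has_derivative_transform_within[OF _ zero_less_one z0]) (use R(2) in auto)
  have eq: "(\<lambda>u. frechet_derivative g (at (M z0)) (M' u)) = (\<lambda>u. u)"
    by (rule derivative_unique_accessible[OF acc d has_derivative_ident])
  have "linear (frechet_derivative g (at (M z0)))"
    using \<open>(R has_derivative _) _\<close> has_derivative_linear by blast
  then show ?thesis using fun_cong[OF eq, of v] v by (simp add: linear_0)
qed

section \<open>The retraction and its generic values\<close>

locale retraction = orbifold_with_boundary X
  for X :: "('a, 'v::euclidean_space, 'g) orbifold" +
  fixes F
  assumes compact: "compact_space (orb_space X)"
    and codim: "no_interior_codim1_strata X"
    and F: "smooth_complete_map X (boundary_orbifold DIM('v) X) F"
    and F_id: "is_identity_on_boundary DIM('v) X F"
begin

abbreviation "f \<equiv> cm_fun F"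

lemma f_continuous: "continuous_map T (subtopology T bd) f"
  using F unfolding smooth_complete_map_def boundary_orbifold_def by simp

lemma f_id: "x \<in> bd \<Longrightarrow> f x = x"
  using F_id boundary_subset
  unfolding is_identity_on_boundary_def same_complete_map_def boundary_orbifold_def
    restrict_to_boundary_def identity_complete_map_def by auto

text \<open>The target chart of the lift is a boundary chart. It is traded for the chart
  \<open>C\<close> of \<open>X\<close> that it restricts, whose projection agrees with it on the
  boundary of the domain.\<close>

lemma lift:
  assumes x: "x \<in> topspace T"
  obtains E C l where "E \<in> orb_charts X" "ch_proj E 0 = x" "C \<in> orb_charts X" "0 \<in> hsb (ch_dom C)"
    "smooth_map (ch_dom E) l" "\<And>v. v \<in> ch_dom E \<Longrightarrow> l v \<in> hsb (ch_dom C)"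
    "\<And>v. v \<in> ch_dom E \<Longrightarrow> ch_proj C (l v) = f (ch_proj E v)"
proof -
  define E D l where "E = cm_src F x" and "D = cm_tgt F x" and "l = cm_lift F x"
  have *: "E \<in> orb_charts X" "ch_center E = x" "D \<in> orb_charts (boundary_orbifold DIM('v) X)"
    "l \<in> ch_dom E \<rightarrow> ch_dom D" "smooth_map (ch_dom E) l"
    "\<And>v. v \<in> ch_dom E \<Longrightarrow> ch_proj D (l v) = f (ch_proj E v)"
    using F x unfolding smooth_complete_map_def E_def D_def l_def by (auto simp: Let_def)
  obtain C where C: "C \<in> orb_charts X" "ch_center C \<in> bd" "D = boundary_chart DIM('v) C"
    using *(3) unfolding boundary_orbifold_def by auto
  have dom: "ch_dom D = hsb (ch_dom C)" unfolding C(3) boundary_chart_def by simp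
  have proj: "ch_proj D w = ch_proj C w" if "w \<in> hsb (ch_dom C)" for w
    using that unfolding C(3) boundary_chart_def ch_proj_def orbit_def by simp
  have "0 \<in> hsb (ch_dom C)"
    using C(2) boundary_iff[OF C(1) chart.zero_in[OF chart[OF C(1)]]] unfolding ch_center_def by blast
  moreover have "l v \<in> hsb (ch_dom C)" if "v \<in> ch_dom E" for v using *(4) that unfolding dom by blast
  ultimately show ?thesis
    using that[OF *(1) _ C(1) _ *(5)] *(2,6) proj unfolding ch_center_def by metis
qed

text \<open>The lift of \<open>f\<close> in flat boundary coordinates, at a point \<open>v\<close> over \<open>x\<close>, extends to
  a submersion onto the hyperplane whose value has trivially acting stabilizer.\<close>

definition regular_at where
  "regular_at x E C e h l v W P Q \<longleftrightarrow>
     E \<in> orb_charts X \<and> C \<in> orb_charts X \<and> half_coords (ch_dom C) e h \<and>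
     (\<forall>v\<in>ch_dom E. l v \<in> hsb (ch_dom C)) \<and>
     (\<forall>v\<in>ch_dom E. ch_proj C (l v) = f (ch_proj E v)) \<and>
     v \<in> ch_dom E \<and> ch_proj E v = x \<and>
     open W \<and> v \<in> W \<and> (\<forall>k. Ck_on k P W) \<and> (\<forall>q\<in>W. P q \<bullet> e = 0) \<and>
     (\<forall>q\<in>W \<inter> ch_dom E. P q = h (l q)) \<and> range (frechet_derivative P (at v)) = hyp e \<and>
     open Q \<and> P v \<in> Q \<and> inj_on (\<lambda>z. ch_proj C (inv_into (ch_dom C) h z)) (Q \<inter> hyp e)"

definition regular where
  "regular x \<longleftrightarrow> (\<exists>E C e h l v W P Q. regular_at x E C e h l v W P Q)"

text \<open>Two kinds of values are bad: critical values of the lift, and points where \<tau> is not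
  locally injective. Both form compact sets with empty interior, the first by Sard and the second by
  minimality of stabilizers.\<close>

lemma locally_generic:
  assumes x: "x \<in> topspace T"
  obtains U B where "openin T U" "x \<in> U" "closedin (subtopology T bd) B"
    "subtopology T bd interior_of B = {}" "\<And>x'. x' \<in> U \<Longrightarrow> f x' \<notin> B \<Longrightarrow> regular x'"
proof -
  obtain E C l where E: "E \<in> orb_charts X" "ch_proj E 0 = x" and C: "C \<in> orb_charts X" "0 \<in> hsb (ch_dom C)"
    and l: "smooth_map (ch_dom E) l" "\<And>v. v \<in> ch_dom E \<Longrightarrow> l v \<in> hsb (ch_dom C)"
      "\<And>v. v \<in> ch_dom E \<Longrightarrow> ch_proj C (l v) = f (ch_proj E v)"
    using lift[OF x] by metis
  obtain e h where hc: "half_coords (ch_dom C) e h" using half_space_boundary_coords[OF C(2)] by metis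
  interpret E: chart T E by (rule chart[OF E(1)])
  interpret B: boundary_flat X C e h
    by (intro boundary_flat.intro boundary_flat_axioms.intro orbifold_with_boundary_axioms C(1) hc)
  have e: "e \<noteq> 0" by (rule B.hc.e_nonzero)
  have lA: "l v \<in> ch_dom C" if "v \<in> ch_dom E" for v
    using l(2)[OF that] unfolding half_space_boundary_def by simp
  have "smooth_map E.A (\<lambda>v. h (l v))"
    by (rule smooth_map_compose[OF l(1) _ B.hc.h_smooth]) (use lA in blast)
  then obtain W g where W: "open W" "0 \<in> W" "\<And>k. Ck_on k g W"
    "\<And>q. q \<in> W \<Longrightarrow> q \<in> E.A \<Longrightarrow> g q = h (l q)"
    using smooth_mapE[OF _ E.zero_in] by metis
  \<comment> \<open>The extension \<open>g\<close> may leave the hyperplane off the chart domain.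
    Projecting it back changes nothing on the domain and makes the hyperplane form of Sard
    applicable.\<close>
  define P where "P q = g q - ((g q \<bullet> e) / (e \<bullet> e)) *\<^sub>R e" for q
  have "bounded_linear (\<lambda>z. z - ((z \<bullet> e) / (e \<bullet> e)) *\<^sub>R e)"
    by (intro bounded_linear_sub bounded_linear_ident
        bounded_linear_compose[OF bounded_linear_scaleR_left]
        bounded_linear_compose[OF bounded_linear_divide] bounded_linear_inner_left)
  then have CP: "Ck_on k P W" for k
    unfolding P_def by (rule Ck_on_linear_compose[OF _ W(1) W(3)])
  have Pe: "P q \<bullet> e = 0" for q unfolding P_def using e by (simp add: inner_diff_left)
  have PH: "P q \<in> hyp e" for q unfolding hyp_def using Pe by simp
  have Pl: "P q = h (l q)" if "q \<in> W" "q \<in> E.A" for q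
  proof -
    have "h (l q) \<bullet> e = 0" using B.hc.h_boundary[OF l(2)[OF that(2)]] unfolding hyp_def by simp
    then show ?thesis unfolding P_def W(4)[OF that] by simp
  qed
  obtain r where r: "r > 0" "cball 0 r \<subseteq> W" using W(1,2) open_contains_cball by blast
  \<comment> \<open>Critical points are collected in the closed ball to get a compact image, while
    \<open>U\<close> will come from the open ball.\<close>
  define S where "S = cball 0 r - {p \<in> W. range (frechet_derivative P (at p)) = hyp e}"
  have contP: "continuous_on (cball 0 r) P" using Ck_on_continuous[OF CP] r(2) continuous_on_subset by blast
  have cS: "compact S" unfolding S_def
    by (intro compact_diff compact_cball open_regular_points[OF W(1) CP Pe e])
  have SW: "S \<subseteq> {p \<in> W. range (frechet_derivative P (at p)) \<noteq> hyp e}" unfolding S_def using r by blast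
  define Q where "Q = P ` S \<union> (P ` cball 0 r \<inter> {z \<in> hyp e. \<not> B.locinj z})"
  have cPS: "compact (P ` S)"
    by (intro compact_continuous_image continuous_on_subset[OF contP] cS) (simp add: S_def Diff_subset)
  have cPL: "compact (P ` cball 0 r \<inter> {z \<in> hyp e. \<not> B.locinj z})"
    by (intro compact_Int_closed compact_continuous_image contP compact_cball B.closed_not_locinj)
  have cQ: "compact Q" unfolding Q_def by (rule compact_Un[OF cPS cPL])
  have QH: "Q \<subseteq> hyp e" unfolding Q_def using PH by blast
  have int: "top_of_set (hyp e) interior_of Q = {}"
    unfolding Q_def
  proof (subst interior_of_union_eq_empty)
    show "closedin (top_of_set (hyp e)) (P ` S)"
      by (rule closed_subset) (use PH compact_imp_closed[OF cPS] in auto)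
    have "top_of_set (hyp e) interior_of (P ` S) = {}"
    proof (rule Sard_hyperplane[OF W(1) CP e Pe openin_interior_of])
      have "P ` S \<subseteq> P ` {p \<in> W. range (frechet_derivative P (at p)) \<noteq> hyp e}" by (rule image_mono[OF SW])
      then show "top_of_set (hyp e) interior_of (P ` S) \<subseteq> P ` {p \<in> W. range (frechet_derivative P (at p)) \<noteq> hyp e}"
        using interior_of_subset by (rule order_trans[rotated])
    qed
    moreover have "top_of_set (hyp e) interior_of (P ` cball 0 r \<inter> {z \<in> hyp e. \<not> B.locinj z}) = {}"
    proof (rule B.not_locinj_nowhere_dense[OF openin_interior_of])
      show "top_of_set (hyp e) interior_of (P ` cball 0 r \<inter> {z \<in> hyp e. \<not> B.locinj z})
          \<subseteq> {z \<in> hyp e. \<not> B.locinj z}"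
        using interior_of_subset by (rule order_trans) (rule Int_lower2)
    qed
    ultimately show "top_of_set (hyp e) interior_of (P ` S) = {} \<and>
      top_of_set (hyp e) interior_of (P ` cball 0 r \<inter> {z \<in> hyp e. \<not> B.locinj z}) = {}" by blast
  qed
  define U where "U = E.\<pi> ` (E.A \<inter> ball 0 r)"
  have reg: "regular x'" if x': "x' \<in> U" "f x' \<notin> B.\<tau> ` Q" for x'
  proof -
    obtain v where v: "v \<in> E.A" "v \<in> ball 0 r" "x' = E.\<pi> v" using x'(1) unfolding U_def by blast
    have vW: "v \<in> W" "v \<in> cball 0 r" using v(2) r(2) by auto
    have "B.\<tau> (P v) = f x'" unfolding Pl[OF vW(1) v(1)] B.\<tau>_h[OF lA[OF v(1)]] v(3) by (rule l(3)[OF v(1)])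
    then have nQ: "P v \<notin> Q" using x'(2) by (metis imageI)
    then have "v \<notin> S" unfolding Q_def by blast
    then have onto: "range (frechet_derivative P (at v)) = hyp e" unfolding S_def using vW by blast
    have "B.locinj (P v)" using nQ vW(2) PH unfolding Q_def by blast
    then obtain Q' where Q': "open Q'" "P v \<in> Q'" "inj_on B.\<tau> (Q' \<inter> hyp e)" unfolding B.locinj_def by blast
    have "regular_at x' E C e h l v W P Q'"
      unfolding regular_at_def
      using E(1) C(1) hc l(2,3) v(1,3) W(1) vW(1) CP Pe Pl onto Q'
      unfolding B.\<tau>_def[abs_def] B.hc.hi_def by simp
    then show ?thesis unfolding regular_def by blast
  qed
  show ?thesis
  proof (rule that[OF _ _ B.image_nowhere_dense[OF cQ QH int] reg])
    show "openin T U" unfolding U_def by (rule E.proj_open) (simp add: openin_open_Int)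
    show "x \<in> U" unfolding U_def using E(2) E.zero_in r(1) by (intro image_eqI[of _ _ 0]) auto
  qed
qed

text \<open>Finitely many sets from \<open>locally_generic\<close> cover the compact space. The
  union of their bad sets has empty interior, so it is not the whole nonempty boundary.\<close>

lemma generic_boundary_point:
  assumes "bd \<noteq> {}"
  obtains y where "y \<in> bd" "\<And>x. x \<in> topspace T \<Longrightarrow> f x = y \<Longrightarrow> regular x"
proof -
  let ?Y = "subtopology T bd"
  have "\<exists>U B. openin T U \<and> x \<in> U \<and> closedin ?Y B \<and> ?Y interior_of B = {} \<and>
      (\<forall>x'\<in>U. f x' \<notin> B \<longrightarrow> regular x')" if x: "x \<in> topspace T" for x
    by (rule locally_generic[OF x]) blast
  then obtain U B where UB: "\<And>x. x \<in> topspace T \<Longrightarrow> openin T (U x) \<and> x \<in> U x \<and> closedin ?Y (B x) \<and>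
      ?Y interior_of (B x) = {} \<and> (\<forall>x'\<in>U x. f x' \<notin> B x \<longrightarrow> regular x')" by metis
  have "\<exists>\<F>. finite \<F> \<and> \<F> \<subseteq> U ` topspace T \<and> topspace T \<subseteq> \<Union>\<F>"
    by (rule compactinD[OF compact[unfolded compact_space_def]]) (use UB in auto)
  then obtain \<F> where \<F>: "finite \<F>" "\<F> \<subseteq> U ` topspace T" "topspace T \<subseteq> \<Union>\<F>" by blast
  obtain I where I: "I \<subseteq> topspace T" "finite I" "\<F> = U ` I"
    using finite_subset_image[OF \<F>(1,2)] by blast
  have "?Y interior_of (\<Union>x\<in>I. B x) = {}"
    by (rule interior_of_UN_empty[OF I(2)]) (use UB I(1) in auto)
  moreover have "topspace ?Y = bd" using boundary_subset by auto
  then have "?Y interior_of topspace ?Y = bd" by (metis interior_of_topspace)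
  ultimately have "topspace ?Y \<noteq> (\<Union>x\<in>I. B x)" using assms by auto
  moreover have "(\<Union>x\<in>I. B x) \<subseteq> topspace ?Y" using UB I(1) closedin_subset by (meson UN_least subsetD)
  ultimately obtain y where y: "y \<in> topspace ?Y" "y \<notin> (\<Union>x\<in>I. B x)" by blast
  show ?thesis
  proof (rule that[of y])
    show "y \<in> bd" using y(1) by simp
    fix x assume x: "x \<in> topspace T" "f x = y"
    then obtain i where i: "i \<in> I" "x \<in> U i" using \<F>(3) I(3) by blast
    then have "f x \<notin> B i" using x(2) y(2) by blast
    then show "regular x" using UB[of i] i I(1) by blast
  qed
qed

text \<open>Regularity of \<open>x\<close> is known in a chart \<open>E\<close> that may be centred
  elsewhere, while the isotropy group is seen in a chart at \<open>x\<close>. The embedding \<psi>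
  carries the lift over, and its smooth left inverse makes its derivative invertible, so the lift
  stays a submersion. \<open>Z\<close> is general, to cover chart domains and flattened half-spaces
  alike.\<close>

lemma regular_model:
  fixes H :: "('h, 'm) monoid_scheme" (structure)
  assumes reg: "regular_at x E C e h l v W P Q"
    and G: "group H" "finite (carrier H)" and z0: "z0 \<in> Z" and acc: "axis_accessible Z z0"
    and act: "\<And>g u. g \<in> carrier H \<Longrightarrow> u \<in> Z \<Longrightarrow> \<alpha> g u \<in> Z"
      "\<And>g h u. g \<in> carrier H \<Longrightarrow> h \<in> carrier H \<Longrightarrow> u \<in> Z \<Longrightarrow> \<alpha> (g \<otimes> h) u = \<alpha> g (\<alpha> h u)"
      "\<And>u. u \<in> Z \<Longrightarrow> \<alpha> \<one> u = u" "\<And>g. g \<in> carrier H \<Longrightarrow> \<alpha> g z0 = z0"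
      "\<And>g. g \<in> carrier H \<Longrightarrow> smooth_map Z (\<alpha> g)"
    and \<pi>: "continuous_map (top_of_set Z) T \<pi>" "\<And>U. openin (top_of_set Z) U \<Longrightarrow> openin T (\<pi> ` U)"
      "\<And>u u'. u \<in> Z \<Longrightarrow> u' \<in> Z \<Longrightarrow> \<pi> u = \<pi> u' \<longleftrightarrow> (\<exists>g\<in>carrier H. u' = \<alpha> g u)"
    and \<psi>: "smooth_map Z \<psi>" "\<psi> ` Z \<subseteq> ch_dom E" "\<psi> z0 = v"
      "\<And>u. u \<in> Z \<Longrightarrow> ch_proj E (\<psi> u) = \<pi> u"
      "smooth_map (\<psi> ` Z) \<rho>" "\<And>u. u \<in> Z \<Longrightarrow> \<rho> (\<psi> u) = u"
  obtains V N where "fibre_model H Z z0 \<alpha> T \<pi> f (\<lambda>z. ch_proj C (inv_into (ch_dom C) h z)) N V Q e"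
    "\<And>u. u \<in> V \<Longrightarrow> u \<in> Z \<Longrightarrow> N u = h (l (\<psi> u))"
proof -
  have C: "C \<in> orb_charts X" and hc: "half_coords (ch_dom C) e h"
    and l: "\<And>v. v \<in> ch_dom E \<Longrightarrow> l v \<in> hsb (ch_dom C)"
      "\<And>v. v \<in> ch_dom E \<Longrightarrow> ch_proj C (l v) = f (ch_proj E v)"
    and W: "open W" "v \<in> W" "\<And>k. Ck_on k P W" "\<And>q. q \<in> W \<Longrightarrow> P q \<bullet> e = 0"
      "\<And>q. q \<in> W \<Longrightarrow> q \<in> ch_dom E \<Longrightarrow> P q = h (l q)" "range (frechet_derivative P (at v)) = hyp e"
    and Q: "open Q" "P v \<in> Q" "inj_on (\<lambda>z. ch_proj C (inv_into (ch_dom C) h z)) (Q \<inter> hyp e)"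
    using reg unfolding regular_at_def by auto
  interpret hc: half_coords "ch_dom C" e h by (rule hc)
  obtain W1 \<psi>' where W1: "open W1" "z0 \<in> W1" "\<And>k. Ck_on k \<psi>' W1" "\<And>u. u \<in> W1 \<Longrightarrow> u \<in> Z \<Longrightarrow> \<psi>' u = \<psi> u"
    "(\<psi> has_derivative frechet_derivative \<psi>' (at z0)) (at z0 within Z)"
    using smooth_extension[OF \<psi>(1) z0] by metis
  define V where "V = W1 \<inter> \<psi>' -` W"
  have \<psi>'z0: "\<psi>' z0 = v" using W1(4)[OF W1(2) z0] \<psi>(3) by simp
  have V: "open V" "z0 \<in> V"
    unfolding V_def using continuous_open_preimage[OF Ck_on_continuous[OF W1(3)] W1(1) W(1)] W1(2) \<psi>'z0 W(2)
    by auto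
  define N where "N u = P (\<psi>' u)" for u
  have CN: "Ck_on 2 N V"
    unfolding N_def by (rule Ck_on_compose[OF V(1) W(1) _ Ck_on_subset[OF W1(3)] W(3)]) (auto simp: V_def)
  have eqN: "N u = h (l (\<psi> u))" if "u \<in> V" "u \<in> Z" for u
    using that W1(4)[of u] W(5)[of "\<psi> u"] \<psi>(2) unfolding N_def V_def by auto
  have dP: "(P has_derivative frechet_derivative P (at v)) (at v)"
    by (rule Ck_on_2_has_derivative[OF W(3,2)])
  let ?L = "frechet_derivative \<psi>' (at z0)"
  have d\<psi>: "(\<psi>' has_derivative ?L) (at z0)" by (rule Ck_on_2_has_derivative[OF W1(3,2)])
  have lin: "linear ?L" using d\<psi> has_derivative_linear by blast
  have "inj ?L"
    using left_inverse_derivative_inj[OF acc z0 W1(5) \<psi>(5,6)] linear_injective_0[OF lin] by blast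
  then have sur: "surj ?L" using linear_injective_imp_surjective[OF lin] by blast
  have "(N has_derivative (\<lambda>u. frechet_derivative P (at v) (?L u))) (at z0)"
    unfolding N_def by (rule has_derivative_compose[OF d\<psi>]) (simp add: \<psi>'z0 dP)
  then have "frechet_derivative N (at z0) = (\<lambda>u. frechet_derivative P (at v) (?L u))"
    by (rule frechet_derivative_at[symmetric])
  moreover have "range (\<lambda>u. frechet_derivative P (at v) (?L u)) = frechet_derivative P (at v) ` range ?L"
    by (simp add: image_image)
  ultimately have onto: "range (frechet_derivative N (at z0)) = hyp e" using sur W(6) by simp
  have \<tau>N: "ch_proj C (inv_into (ch_dom C) h (N u)) = f (\<pi> u)" if u: "u \<in> V" "u \<in> Z" for u
  proof -
    have \<psi>u: "\<psi> u \<in> ch_dom E" using \<psi>(2) u(2) by blast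
    have "l (\<psi> u) \<in> ch_dom C" using l(1)[OF \<psi>u] unfolding half_space_boundary_def by simp
    then have "inv_into (ch_dom C) h (N u) = l (\<psi> u)"
      unfolding eqN[OF u] using hc.hi_h unfolding hc.hi_def by simp
    then show ?thesis using l(2)[OF \<psi>u] \<psi>(4)[OF u(2)] by simp
  qed
  have "fibre_model H Z z0 \<alpha> T \<pi> f (\<lambda>z. ch_proj C (inv_into (ch_dom C) h z)) N V Q e"
  proof (rule fibre_model.intro[OF G z0 acc act \<pi> V CN _ \<tau>N hc.e_nonzero onto Q(1) _ Q(3)])
    show "N u \<bullet> e = 0" if "u \<in> V" for u using that W(4) unfolding N_def V_def by simp
    show "N z0 \<in> Q" unfolding N_def \<psi>'z0 by (rule Q(2))
  qed
  then show ?thesis using that eqN by blast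
qed

lemma interior_regular_arc:
  assumes reg: "regular x" and x: "x \<in> topspace T" "x \<notin> bd"
  shows "\<exists>\<gamma>. \<gamma> 0 = x \<and> arc_chart (subtopology T {x'. f x' = f x}) {-1<..<1} \<gamma>"
proof -
  obtain E C e h l v W P Q where R: "regular_at x E C e h l v W P Q" using reg unfolding regular_def by blast
  then have E: "E \<in> orb_charts X" "v \<in> ch_dom E" "ch_proj E v = x" unfolding regular_at_def by auto
  interpret E: chart T E by (rule chart[OF E(1)])
  have xE: "x \<in> ch_nbhd E" unfolding E.nbhd_eq using E by blast
  \<comment> \<open>A chart centred at \<open>x\<close> is taken because the codimension assumption
    speaks of fixed spaces at chart centres.\<close>
  obtain B where B: "B \<in> orb_charts X" "ch_proj B 0 = x" "ch_nbhd B \<subseteq> ch_nbhd E"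
    using chart_at[OF E.nbhd_open xE] by metis
  interpret B: chart T B by (rule chart[OF B(1)])
  have "0 \<notin> hsb B.A" using boundary_iff[OF B(1) B.zero_in] B(2) x(2) by simp
  then have opB: "open B.A"
    using B.is_chart euclidean_domain_open unfolding is_chart_def by blast
  have pr: "ch_proj E v = ch_proj B 0" using E(3) B(2) by simp
  obtain \<psi> \<rho> where \<psi>: "smooth_map B.A \<psi>" "\<psi> ` B.A \<subseteq> ch_dom E" "\<psi> 0 = v"
    "\<And>u. u \<in> B.A \<Longrightarrow> ch_proj E (\<psi> u) = B.\<pi> u" "smooth_map (\<psi> ` B.A) \<rho>" "\<And>u. u \<in> B.A \<Longrightarrow> \<rho> (\<psi> u) = u"
    using centered_embedding[OF B(1) E(1) B(3) E(2) pr] by metis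
  obtain V N where "fibre_model B.G B.A 0 B.\<alpha> T B.\<pi> f (\<lambda>z. ch_proj C (inv_into (ch_dom C) h z)) N V Q e"
    by (rule regular_model[OF R B.group_G B.finite_G B.zero_in axis_accessible_open[OF opB B.zero_in]
          B.act_in B.act_mult B.act_one B.act_zero B.act_smooth B.proj_continuous B.proj_open B.proj_eq_iff \<psi>])
  then interpret M: fibre_model B.G B.A 0 B.\<alpha> T B.\<pi> f "\<lambda>z. ch_proj C (inv_into (ch_dom C) h z)" N V Q e .
  have "ch_center B \<in> orb_interior DIM('v) X"
    unfolding ch_center_def orb_interior_def using B(2) x by simp
  then have "dim (fixed_tangent_space B) \<noteq> DIM('v) - 1"
    using codim B(1) unfolding no_interior_codim1_strata_def by blast
  then show ?thesis using M.interior_arc[OF opB] unfolding fixed_tangent_space_def B(2) by blast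
qed

text \<open>The new point is transversality. Along the wall \<open>f\<close> is the identity, so
  there the lift coincides with a chart embedding into \<open>C\<close>, whose derivative is
  injective; the kernel of the derivative of the lift meets the wall only in 0.\<close>

lemma boundary_regular_arc:
  assumes reg: "regular x" and x: "x \<in> bd"
  shows "\<exists>\<gamma>. \<gamma> 0 = x \<and> arc_chart (subtopology T {x'. f x' = f x}) {0..<1} \<gamma>"
proof -
  obtain E C e h l v W P Q where R: "regular_at x E C e h l v W P Q" using reg unfolding regular_def by blast
  then have E: "E \<in> orb_charts X" "v \<in> ch_dom E" "ch_proj E v = x"
    and C: "C \<in> orb_charts X" and hcC: "half_coords (ch_dom C) e h"
    and l: "l v \<in> hsb (ch_dom C)" "ch_proj C (l v) = f x"
    and W: "v \<in> W" "P v = h (l v)" "P v \<in> Q"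
    and Q: "open Q" "inj_on (\<lambda>z. ch_proj C (inv_into (ch_dom C) h z)) (Q \<inter> hyp e)"
    unfolding regular_at_def by auto
  interpret E: chart T E by (rule chart[OF E(1)])
  interpret D: boundary_flat X C e h
    by (intro boundary_flat.intro boundary_flat_axioms.intro orbifold_with_boundary_axioms C hcC)
  have \<tau>_eq: "D.\<tau> = (\<lambda>z. ch_proj C (inv_into (ch_dom C) h z))"
    unfolding D.\<tau>_def[abs_def] D.hc.hi_def ..
  have lC: "l v \<in> ch_dom C" using l(1) unfolding half_space_boundary_def by simp
  have fx: "f x = x" by (rule f_id[OF x])
  have "x \<in> ch_nbhd E" unfolding E.nbhd_eq using E(2,3) by blast
  moreover have "x \<in> ch_nbhd C" unfolding D.C.nbhd_eq using l(2) lC fx by (metis imageI)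
  ultimately have "x \<in> ch_nbhd E \<inter> ch_nbhd C" by blast
  moreover have "openin T (ch_nbhd E \<inter> ch_nbhd C)"
    by (rule openin_Int[OF E.nbhd_open D.C.nbhd_open])
  \<comment> \<open>\<open>B\<close> must embed into \<open>E\<close> to carry the lift and into
    \<open>C\<close> to be compared with it.\<close>
  ultimately obtain B where B: "B \<in> orb_charts X" "ch_proj B 0 = x" "ch_nbhd B \<subseteq> ch_nbhd E \<inter> ch_nbhd C"
    using chart_at by metis
  interpret B: chart T B by (rule chart[OF B(1)])
  have B0: "0 \<in> hsb B.A" using boundary_iff[OF B(1) B.zero_in] B(2) x by simp
  obtain n k where hcB: "half_coords B.A n k" using half_space_boundary_coords[OF B0] by metis
  interpret hb: half_coords B.A n k by (rule hcB)
  let ?H = "{z. 0 \<le> z \<bullet> n}"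
  define z0 where "z0 = k 0"
  have z0n: "z0 \<bullet> n = 0" using hb.h_boundary[OF B0] unfolding z0_def hyp_def by simp
  have z0: "z0 \<in> ?H" using z0n by simp
  have hiz0: "hb.hi z0 = 0" unfolding z0_def using B.zero_in by simp
  have hiA: "hb.hi z \<in> B.A" if "z \<in> ?H" for z using hb.hi_in that by simp
  have hik: "hb.hi ` ?H \<subseteq> B.A" using hiA by blast
  define \<alpha> where "\<alpha> g z = k (B.\<alpha> g (hb.hi z))" for g z
  define \<pi> where "\<pi> z = B.\<pi> (hb.hi z)" for z
  have act: "\<alpha> g z \<in> ?H" "hb.hi (\<alpha> g z) = B.\<alpha> g (hb.hi z)" if "g \<in> carrier B.G" "z \<in> ?H" for g z
    unfolding \<alpha>_def using B.act_in[OF that(1) hiA[OF that(2)]] hb.h_in by auto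
  have mult: "\<alpha> (g \<otimes>\<^bsub>B.G\<^esub> g') z = \<alpha> g (\<alpha> g' z)"
    if "g \<in> carrier B.G" "g' \<in> carrier B.G" "z \<in> ?H" for g g' z
    using act(2)[OF that(2,3)] B.act_mult[OF that(1,2) hiA[OF that(3)]] unfolding \<alpha>_def by simp
  have one: "\<alpha> \<one>\<^bsub>B.G\<^esub> z = z" if "z \<in> ?H" for z
    unfolding \<alpha>_def using B.act_one[OF hiA[OF that]] that by simp
  have fixz: "\<alpha> g z0 = z0" if "g \<in> carrier B.G" for g
    unfolding \<alpha>_def hiz0 B.act_zero[OF that] by (rule z0_def[symmetric])
  have smooth: "smooth_map ?H (\<alpha> g)" if g: "g \<in> carrier B.G" for g
  proof -
    have 1: "smooth_map ?H (\<lambda>z. B.\<alpha> g (hb.hi z))"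
      by (rule smooth_map_compose[OF hb.hi_smooth hik B.act_smooth[OF g]])
    show ?thesis unfolding \<alpha>_def[abs_def]
      by (rule smooth_map_compose[OF 1 _ hb.h_smooth]) (use B.act_in[OF g] hiA in blast)
  qed
  have hi_cont: "continuous_on ?H hb.hi" by (rule smooth_map_continuous_on[OF hb.hi_smooth])
  have \<pi>_cont: "continuous_map (top_of_set ?H) T \<pi>"
  proof -
    have "continuous_map (top_of_set ?H) (top_of_set B.A) hb.hi"
      using hi_cont hik by (auto simp: continuous_map_iff_continuous)
    then have "continuous_map (top_of_set ?H) T (B.\<pi> \<circ> hb.hi)"
      by (rule continuous_map_compose[OF _ B.proj_continuous])
    then show ?thesis unfolding \<pi>_def[abs_def] o_def .
  qed
  have \<pi>_open: "openin T (\<pi> ` U)" if U: "openin (top_of_set ?H) U" for U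
  proof -
    have UH: "U \<subseteq> ?H" using openin_subset[OF U] by simp
    have "hb.hi ` U = B.A \<inter> k -` U"
    proof
      show "hb.hi ` U \<subseteq> B.A \<inter> k -` U" using UH hiA by auto
      show "B.A \<inter> k -` U \<subseteq> hb.hi ` U"
      proof
        fix p assume "p \<in> B.A \<inter> k -` U"
        then show "p \<in> hb.hi ` U" by (intro image_eqI[of _ _ "k p"]) auto
      qed
    qed
    moreover have "openin (top_of_set B.A) (B.A \<inter> k -` U)"
      by (rule continuous_openin_preimage[OF smooth_map_continuous_on[OF hb.h_smooth] _ U])
        (use hb.h_in in auto)
    ultimately have "openin T (B.\<pi> ` hb.hi ` U)" using B.proj_open by simp
    then show ?thesis unfolding \<pi>_def[abs_def] image_image .
  qed
  have \<pi>_eq: "\<pi> z = \<pi> z' \<longleftrightarrow> (\<exists>g\<in>carrier B.G. z' = \<alpha> g z)" if z: "z \<in> ?H" "z' \<in> ?H" for z z'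
  proof -
    have "hb.hi z' = B.\<alpha> g (hb.hi z) \<longleftrightarrow> z' = \<alpha> g z" if g: "g \<in> carrier B.G" for g
    proof -
      have "k (hb.hi z') = z'" using z(2) by simp
      then show ?thesis using act(2)[OF g z(1)] unfolding \<alpha>_def by metis
    qed
    then show ?thesis unfolding \<pi>_def using B.proj_eq_iff[OF hiA[OF z(1)] hiA[OF z(2)]] by auto
  qed
  have prE: "ch_proj E v = ch_proj B 0" using E(3) B(2) by simp
  have subE: "ch_nbhd B \<subseteq> ch_nbhd E" and subC: "ch_nbhd B \<subseteq> ch_nbhd C" using B(3) by auto
  obtain \<psi> \<rho> where \<psi>: "smooth_map B.A \<psi>" "\<psi> ` B.A \<subseteq> ch_dom E" "\<psi> 0 = v"
    "\<And>u. u \<in> B.A \<Longrightarrow> ch_proj E (\<psi> u) = B.\<pi> u" "smooth_map (\<psi> ` B.A) \<rho>" "\<And>u. u \<in> B.A \<Longrightarrow> \<rho> (\<psi> u) = u"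
    using centered_embedding[OF B(1) E(1) subE E(2) prE] by metis
  have prC: "ch_proj C (l v) = ch_proj B 0" using l(2) fx B(2) by simp
  obtain \<kappa> \<sigma> where \<kappa>: "smooth_map B.A \<kappa>" "\<kappa> ` B.A \<subseteq> ch_dom C" "\<kappa> 0 = l v"
    "\<And>u. u \<in> B.A \<Longrightarrow> ch_proj C (\<kappa> u) = B.\<pi> u" "smooth_map (\<kappa> ` B.A) \<sigma>" "\<And>u. u \<in> B.A \<Longrightarrow> \<sigma> (\<kappa> u) = u"
    using centered_embedding[OF B(1) C subC lC prC] by metis
  have acc: "axis_accessible ?H z0" by (rule axis_accessible_half_space[OF z0n])
  obtain V N where fm: "fibre_model B.G ?H z0 \<alpha> T \<pi> f (\<lambda>z. ch_proj C (inv_into (ch_dom C) h z)) N V Q e"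
  proof (rule regular_model[OF R B.group_G B.finite_G z0 acc act(1) mult one fixz smooth \<pi>_cont \<pi>_open \<pi>_eq,
        of "\<lambda>z. \<psi> (hb.hi z)" "\<lambda>p. k (\<rho> p)"])
    show "smooth_map ?H (\<lambda>z. \<psi> (hb.hi z))" by (rule smooth_map_compose[OF hb.hi_smooth hik \<psi>(1)])
    show "(\<lambda>z. \<psi> (hb.hi z)) ` ?H \<subseteq> ch_dom E" using \<psi>(2) hiA by blast
    show "\<psi> (hb.hi z0) = v" unfolding hiz0 by (rule \<psi>(3))
    show "ch_proj E (\<psi> (hb.hi u)) = \<pi> u" if "u \<in> ?H" for u unfolding \<pi>_def by (rule \<psi>(4)[OF hiA[OF that]])
    have "smooth_map ((\<lambda>z. \<psi> (hb.hi z)) ` ?H) \<rho>"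
      by (rule smooth_map_subset[OF \<psi>(5)]) (use hiA in blast)
    then show "smooth_map ((\<lambda>z. \<psi> (hb.hi z)) ` ?H) (\<lambda>p. k (\<rho> p))"
      by (rule smooth_map_compose[OF _ _ hb.h_smooth]) (use \<psi>(6) hiA in auto)
    show "k (\<rho> (\<psi> (hb.hi u))) = u" if "u \<in> ?H" for u using \<psi>(6)[OF hiA[OF that]] that by simp
  qed (assumption | rule that)+
  interpret M: fibre_model B.G ?H z0 \<alpha> T \<pi> f "\<lambda>z. ch_proj C (inv_into (ch_dom C) h z)" N V Q e by (rule fm)
  \<comment> \<open>\<open>m\<close> is the embedding of \<open>B\<close> into \<open>C\<close> in
    flat coordinates on both sides, to be compared with the lift \<open>N\<close>.\<close>
  define m where "m z = h (\<kappa> (hb.hi z))" for z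
  have \<kappa>C: "\<kappa> u \<in> ch_dom C" if "u \<in> B.A" for u using \<kappa>(2) that by blast
  have m_smooth: "smooth_map ?H m"
  proof -
    have 1: "smooth_map ?H (\<lambda>z. \<kappa> (hb.hi z))" by (rule smooth_map_compose[OF hb.hi_smooth hik \<kappa>(1)])
    show ?thesis unfolding m_def[abs_def]
      by (rule smooth_map_compose[OF 1 _ D.hc.h_smooth]) (use \<kappa>C hiA in blast)
  qed
  have m_inv: "smooth_map (m ` ?H) (\<lambda>w. k (\<sigma> (D.hc.hi w)))" "\<And>u. u \<in> ?H \<Longrightarrow> k (\<sigma> (D.hc.hi (m u))) = u"
  proof -
    have him: "D.hc.hi (m u) = \<kappa> (hb.hi u)" if "u \<in> ?H" for u unfolding m_def using \<kappa>C hiA that by simp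
    then show "k (\<sigma> (D.hc.hi (m u))) = u" if "u \<in> ?H" for u using \<kappa>(6)[OF hiA[OF that]] that by simp
    have 1: "smooth_map (m ` ?H) D.hc.hi"
      by (rule smooth_map_subset[OF D.hc.hi_smooth]) (use D.hc.h_in \<kappa>C hiA in \<open>auto simp: m_def\<close>)
    have 2: "smooth_map (m ` ?H) (\<lambda>w. \<sigma> (D.hc.hi w))"
      by (rule smooth_map_compose[OF 1 _ \<kappa>(5)]) (use him hiA in auto)
    show "smooth_map (m ` ?H) (\<lambda>w. k (\<sigma> (D.hc.hi w)))"
      by (rule smooth_map_compose[OF 2 _ hb.h_smooth]) (use him \<kappa>(6) hiA in auto)
  qed
  obtain Wm m' where Wm: "open Wm" "z0 \<in> Wm" "\<And>k. Ck_on k m' Wm" "\<And>u. u \<in> Wm \<Longrightarrow> u \<in> ?H \<Longrightarrow> m' u = m u"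
    "(m has_derivative frechet_derivative m' (at z0)) (at z0 within ?H)"
    using smooth_extension[OF m_smooth z0] by metis
  have mz0: "m z0 = h (l v)" unfolding m_def hiz0 \<kappa>(3) ..
  \<comment> \<open>Both maps are confined to \<open>Q\<close>, where \<tau> is injective on the
    hyperplane.\<close>
  define V' where "V' = (V \<inter> N -` Q) \<inter> (Wm \<inter> m' -` Q)"
  have V': "open V'" "z0 \<in> V'"
  proof -
    show "open V'" unfolding V'_def
      by (intro open_Int continuous_open_preimage[OF Ck_on_continuous[OF M.P(1)] M.W(1) Q(1)]
          continuous_open_preimage[OF Ck_on_continuous[OF Wm(3)] Wm(1) Q(1)])
    have "m' z0 \<in> Q" using Wm(4)[OF Wm(2) z0] mz0 W(2,3) by simp
    then show "z0 \<in> V'" unfolding V'_def using M.W(2) M.Q(2) Wm(2) by simp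
  qed
  \<comment> \<open>On the wall both values lie in the hyperplane and have the same image under
    \<tau>, because \<open>f\<close> fixes boundary points.\<close>
  have agree: "N u = m' u" if u: "u \<in> V'" "u \<bullet> n = 0" for u
  proof -
    have uV: "u \<in> V" "N u \<in> Q" "u \<in> Wm" "m' u \<in> Q" using u(1) unfolding V'_def by auto
    have uH: "u \<in> ?H" using u(2) by simp
    have uhyp: "u \<in> hyp n" using u(2) unfolding hyp_def by simp
    have pbd: "B.\<pi> (hb.hi u) \<in> bd"
      using boundary_iff[OF B(1) hiA[OF uH]] hb.hi_boundary[OF uhyp] by blast
    then have "ch_proj C (\<kappa> (hb.hi u)) \<in> bd" using \<kappa>(4)[OF hiA[OF uH]] by simp
    then have "\<kappa> (hb.hi u) \<in> hsb (ch_dom C)" using boundary_iff[OF C \<kappa>C[OF hiA[OF uH]]] by blast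
    then have mhyp: "m u \<in> hyp e" unfolding m_def by (rule D.hc.h_boundary)
    have "D.\<tau> (m u) = B.\<pi> (hb.hi u)"
      unfolding m_def D.\<tau>_h[OF \<kappa>C[OF hiA[OF uH]]] by (rule \<kappa>(4)[OF hiA[OF uH]])
    also have "\<dots> = f (\<pi> u)" unfolding \<pi>_def using f_id[OF pbd] by simp
    also have "\<dots> = D.\<tau> (N u)" using M.\<tau>P[OF uV(1) uH] unfolding \<tau>_eq by simp
    finally have "D.\<tau> (m u) = D.\<tau> (N u)" .
    moreover have "inj_on D.\<tau> (Q \<inter> hyp e)" unfolding \<tau>_eq by (rule Q(2))
    ultimately have "m u = N u"
      using mhyp M.P_hyp[OF uV(1)] uV(2,4) Wm(4)[OF uV(3) uH] by (metis IntI inj_onD)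
    then show ?thesis using Wm(4)[OF uV(3) uH] by simp
  qed
  \<comment> \<open>A kernel vector \<open>w\<close> tangent to the wall is tested along the line
    through \<open>z0\<close>, which stays in the wall; there \<open>N\<close> and the embedding
    agree, so the derivative of the embedding kills \<open>w\<close> too.\<close>
  have transversal: "w = 0" if w: "M.L w = 0" "w \<bullet> n = 0" for w
  proof -
    have dm: "(m' has_derivative frechet_derivative m' (at z0)) (at z0)"
      by (rule Ck_on_2_has_derivative[OF Wm(3,2)])
    have line: "((\<lambda>t::real. z0 + t *\<^sub>R w) has_derivative (\<lambda>t. t *\<^sub>R w)) (at 0)"
      by (auto intro!: derivative_eq_intros)
    have dN: "((\<lambda>t. N (z0 + t *\<^sub>R w)) has_derivative (\<lambda>t. M.L (t *\<^sub>R w))) (at 0)"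
      by (rule has_derivative_compose[OF line]) (simp add: M.L_deriv)
    have dM: "((\<lambda>t. m' (z0 + t *\<^sub>R w)) has_derivative (\<lambda>t. frechet_derivative m' (at z0) (t *\<^sub>R w))) (at 0)"
      by (rule has_derivative_compose[OF line]) (simp add: dm)
    have "continuous_on UNIV (\<lambda>t::real. z0 + t *\<^sub>R w)" by (intro continuous_intros)
    then have op: "open ((\<lambda>t::real. z0 + t *\<^sub>R w) -` V')" using V'(1) by (simp add: open_vimage)
    have in0: "(0::real) \<in> (\<lambda>t. z0 + t *\<^sub>R w) -` V'" using V'(2) by simp
    have "((\<lambda>t. m' (z0 + t *\<^sub>R w)) has_derivative (\<lambda>t. M.L (t *\<^sub>R w))) (at 0)"
      by (rule has_derivative_transform_within_open[OF dN op in0])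
        (use agree z0n w(2) in \<open>auto simp: inner_add_left\<close>)
    then have "(\<lambda>t. M.L (t *\<^sub>R w)) = (\<lambda>t. frechet_derivative m' (at z0) (t *\<^sub>R w))"
      using has_derivative_unique dM by blast
    then have "frechet_derivative m' (at z0) w = 0" using w(1) by (metis scaleR_one)
    then show ?thesis
      using left_inverse_derivative_inj[OF acc z0 Wm(5) m_inv(1)] m_inv(2) by blast
  qed
  have "\<pi> z0 = x" unfolding \<pi>_def hiz0 by (rule B(2))
  then show ?thesis using M.boundary_arc[OF refl z0n transversal] by simp
qed

lemma boundary_empty: "bd = {}"
proof (rule ccontr)
  assume "bd \<noteq> {}"
  then obtain y where y: "y \<in> bd" "\<And>x. x \<in> topspace T \<Longrightarrow> f x = y \<Longrightarrow> regular x"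
    using generic_boundary_point by metis
  let ?N = "{x. f x = y}"
  have yT: "y \<in> topspace T" using y(1) boundary_subset by blast
  have fy: "f y = y" by (rule f_id[OF y(1)])
  have "closedin (subtopology T bd) {y}"
    using Hausdorff_space_subtopology[OF Hausdorff] yT y(1) by (simp add: closedin_Hausdorff_singleton)
  then have "closedin T {x \<in> topspace T. f x \<in> {y}}"
    using closedin_continuous_map_preimage[OF f_continuous] by blast
  moreover have "{x \<in> topspace T. f x \<in> {y}} = topspace T \<inter> ?N" by auto
  ultimately have cl: "closedin T (topspace T \<inter> ?N)" by simp
  have sub: "subtopology T ?N = subtopology T (topspace T \<inter> ?N)" by (simp add: subtopology_restrict)
  have "compact_space (subtopology T ?N)"
    unfolding sub using closedin_compact_space[OF compact cl] by (simp add: compact_space_subtopology)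
  moreover have "Hausdorff_space (subtopology T ?N)" by (rule Hausdorff_space_subtopology[OF Hausdorff])
  moreover have "y \<in> topspace (subtopology T ?N)" using yT fy by simp
  moreover have "\<exists>\<gamma>. \<gamma> 0 = x \<and> arc_chart (subtopology T ?N) (if x = y then {0..<1} else {-1<..<1}) \<gamma>"
    if x: "x \<in> topspace (subtopology T ?N)" for x
  proof -
    have xT: "x \<in> topspace T" "f x = y" using x by auto
    have reg: "regular x" by (rule y(2)[OF xT])
    show ?thesis
    proof (cases "x = y")
      case True
      then show ?thesis using boundary_regular_arc[OF reg] y(1) xT(2) by simp
    next
      case False
      \<comment> \<open>A boundary point of the fibre equals its own image, which is
        \<open>y\<close>.\<close>
      then have "x \<notin> bd" using f_id xT(2) by auto
      then show ?thesis using interior_regular_arc[OF reg xT(1)] xT(2) False by simp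
    qed
  qed
  ultimately show False by (rule no_compact_one_manifold_with_one_end)
qed

end

theorem theorem25:
  fixes X :: "('a, 'v::euclidean_space, 'g) orbifold"
  assumes "smooth_orbifold DIM('v) X"
    and "compact_space (orb_space X)"
    and "orb_boundary DIM('v) X \<noteq> {}"
    and "no_interior_codim1_strata X"
  shows "\<not> (\<exists>F. smooth_complete_map X (boundary_orbifold DIM('v) X) F \<and>
                is_identity_on_boundary DIM('v) X F)"
proof
  assume "\<exists>F. smooth_complete_map X (boundary_orbifold DIM('v) X) F \<and> is_identity_on_boundary DIM('v) X F"
  then obtain F where "smooth_complete_map X (boundary_orbifold DIM('v) X) F" "is_identity_on_boundary DIM('v) X F"
    by blast
  then interpret retraction X F by unfold_locales (use assms in auto)
  show False using boundary_empty assms(3) by blast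
qed

end
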